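(* Let $G_1,\ldots,G_m$ be finite groups and $G=\prod_{i=1}^mG_i$. There are direct-sum decompositions $$V_G=\left(\bigoplus_{i=1}^{m}\operatorname{Inf}_i(V_{G_i})\right)\oplus\bigcap_{i=1}^{m}\ker\operatorname{Fix}_i,\qquad \mathfrak D_G=\left(\bigoplus_{i=1}^{m}\operatorname{Inf}_i(\mathfrak D_{G_i})\right)\oplus\bigcap_{i=1}^{m}\ker\operatorname{Fix}_i$$ (the last intersections taken in $V_G$ and $\mathfrak D_G$ respectively), and with respect to them $$\operatorname{Def}_G\cong\left(\bigoplus_{i=1}^{m}\operatorname{Def}_{G_i}\right)\oplus\left.\operatorname{Def}_G\right|_{\bigcap_{i=1}^{m}\ker\operatorname{Fix}_i},$$ i.e. $\operatorname{Def}_G$ maps each $\operatorname{Inf}_i(V_{G_i})$ into $\operatorname{Inf}_i(\mathfrak D_{G_i})$, where it is identified via the injections $\operatorname{Inf}_i$ with $\operatorname{Def}_{G_i}$, and maps $\bigcap_i\ker\operatorname{Fix}_i\subseteq V_G$ into $\bigcap_i\ker\operatorname{Fix}_i\subseteq\mathfrak D_G$. Consequently, $$\mathcal S_2(G)=\left(\bigoplus_{i=1}^{m}\operatorname{Inf}_i\bigl(\mathcal S_2(G_i)\bigr)\right)\oplus\left(\mathcal S_2(G)\cap\bigcap_{i=1}^{m}\ker\operatorname{Fix}_i\right),$$ and, in particular, $$\dim_{\mathbb F_2}\mathcal S_2(G)=\sum_{i=1}^{m}\dim_{\mathbb F_2}\mathcal S_2(G_i)+\dim_{\mathbb F_2}\left(\mathcal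 S_2(G)\cap\bigcap_{i=1}^{m}\ker\operatorname{Fix}_i\right).$$
   Context: For a finite group $G$, $\Omega(G)$ is the Burnside ring, with $\mathbb Z$-basis $[G/H]$, $(H)\in\operatorname{Sub}(G)^c$ (conjugacy classes of subgroups). For $K\le G$, the mark $\varphi_K^G:\Omega(G)\to\mathbb Z$ is $[X]\mapsto\#X^K$; $e_H^G\in\mathbb Q\otimes\Omega(G)$ is the primitive idempotent with $\varphi_K^G(e_H^G)=1$ if $(K)=(H)$ and $0$ otherwise, and $e_S:=\sum_{(H)\in S}e_H^G$. $\operatorname{core}_G(H)=\bigcap_{g\in G}gHg^{-1}$; $\operatorname{Sub}_{\mathrm{ncc}}(G)$ is the set of subgroups $H\le G$ with $H/\operatorname{core}_G(H)$ noncyclic (non-core-cyclic), $\operatorname{Sub}_{\mathrm{ncc}}(G)^c$ the set of their conjugacy classes, $V_G:=\mathbb F_2^{\operatorname{Sub}_{\mathrm{ncc}}(G)^c}$. $\mathcal S_2(G):=\{S\subseteq\operatorname{Sub}_{\mathrm{ncc}}(G)^c\mid 2e_S\in\Omega(G)\}$, viewed as a subspace of $V_G$ by identifying $S$ with its characteristic function. For a finite group $W$, $\operatorname{Cl}_0(W,\mathbb F_2)$ is the $\mathbb F_2$-space of class functions $f:W\to\mathbb F_2$ with $f(1)=0$, and $\mathfrak D(W):=\operatorname{Cl}_0(W,\mathbb F_2)/\operatorname{Hom}(W,\mathbb F_2)$. Put $W_G(K)=N_G(K)/K$. For $x\in V_G$ let $\widetilde x\in\mathbb F_2^{\operatorname{Sub}(G)^c}$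 be its extension by $0$. For $K\le G$, $g\in N_G(K)$ put $\lambda_{x,K}(gK)=\widetilde x_{(\langle K,g\rangle)}+\widetilde x_{(K)}$, an element of $\operatorname{Cl}_0(W_G(K),\mathbb F_2)$. Choosing one representative $K$ of each class, $\mathfrak D_G:=\bigoplus_{(K)\in\operatorname{Sub}(G)^c}\mathfrak D(W_G(K))$, and $\operatorname{Def}_G:V_G\to\mathfrak D_G$ is the linear map $x\mapsto([\lambda_{x,K}])_{(K)}$. Let $G=\prod_iG_i$ with projections $\pi_i:G\to G_i$. For $L\le G_i$ put $\widehat L=\pi_i^{-1}(L)$. (If $H\le G$ is core-cyclic so is $\pi_i(H)$; $L$ is core-cyclic in $G_i$ iff $\widehat L$ is core-cyclic in $G$.) Define linear maps: $\operatorname{Inf}_i:V_{G_i}\to V_G$ by $\operatorname{Inf}_i(x)_{(H)}=x_{(\pi_i(H))}$ if $\pi_i(H)\in\operatorname{Sub}_{\mathrm{ncc}}(G_i)$ and $0$ otherwise; $\operatorname{Fix}_i:V_G\to V_{G_i}$ by $\operatorname{Fix}_i(y)_{(L)}=y_{(\widehat L)}$. For $H\le G$, $\pi_i$ induces a homomorphism $\overline\pi_{i,H}:W_G(H)\to W_{G_i}(\pi_i(H))$, $gH\mapsto\pi_i(g)\pi_i(H)$, with pullback $\overline\pi_{i,H}^*:\mathfrak D(W_{G_i}(\pi_i(H)))\to\mathfrak D(W_G(H))$; for $H=\widehat L$, $\overline\pi_{i,\widehat L}$ is an isomorphism onto $W_{G_i}(L)$. Local defect spaces of conjugate subgroups are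 identified via conjugation. Define linear maps with the same names: $\operatorname{Inf}_i:\mathfrak D_{G_i}\to\mathfrak D_G$, $\operatorname{Inf}_i(\omega)_H=\overline\pi_{i,H}^*(\omega_{\pi_i(H)})$; $\operatorname{Fix}_i:\mathfrak D_G\to\mathfrak D_{G_i}$, $\operatorname{Fix}_i(\eta)_L=(\overline\pi_{i,\widehat L}^* )^{-1}(\eta_{\widehat L})$. Known result available (Yoshida's unit criterion): a conjugation-invariant function $H\mapsto\varepsilon_H\in\{\pm1\}$ on subgroups of $G$ is the mark vector of a unit of $\Omega(G)$ if and only if for every $K\le G$ the map $W_G(K)\to\{\pm1\}$, $gK\mapsto\varepsilon_{\langle K,g\rangle}/\varepsilon_K$, is a group homomorphism. *)

theory Defs
  imports
    "HOL-Algebra.Algebra"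
    "HOL-Algebra.Algebraic_Closure_Type"
    "HOL-Library.Function_Algebras"
    "HOL-Library.Z2"
begin

section \<open>Linear algebra over the field with two elements\<close>

abbreviation F2 :: "bit ring" where
  "F2 \<equiv> ring_of_type_algebra"

text \<open>The space of functions \<open>I \<rightarrow> F2\<close>. Functions are extended by zero outside \<open>I\<close>, so that
  pointwise operations of the whole function type can be used. The fields \<open>mult\<close> and \<open>one\<close> of
  module records carry no meaning.\<close>

definition f2_functions :: "'x set \<Rightarrow> (bit, 'x \<Rightarrow> bit) module" where
  "f2_functions I = \<lparr>carrier = {f. \<forall>x. x \<notin> I \<longrightarrow> f x = 0}, monoid.mult = undefined, one = undefined,
     ring.zero = (\<lambda>x. 0), add = (\<lambda>f h x. f x + h x), module.smult = (\<lambda>c f x. c * f x)\<rparr>"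

text \<open>Elements of the quotient of \<open>M\<close> by a submodule \<open>N\<close> are cosets of \<open>N\<close>.\<close>

definition quot_module :: "(bit, 'v) module \<Rightarrow> 'v set \<Rightarrow> (bit, 'v set) module" where
  "quot_module M N = \<lparr>carrier = a_rcosets\<^bsub>M\<^esub> N, monoid.mult = undefined, one = undefined,
     ring.zero = N, add = set_add M, module.smult = (\<lambda>c A. \<Union>a\<in>A. N +>\<^bsub>M\<^esub> (c \<odot>\<^bsub>M\<^esub> a))\<rparr>"

text \<open>External direct sum; only used for finite index sets, where it is the product.\<close>

definition sum_module :: "'i set \<Rightarrow> ('i \<Rightarrow> (bit, 'v) module) \<Rightarrow> (bit, 'i \<Rightarrow> 'v) module" where
  "sum_module I M = \<lparr>carrier = (\<Pi>\<^sub>E i\<in>I. carrier (M i)), monoid.mult = undefined, one = undefined,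
     ring.zero = (\<lambda>i\<in>I. \<zero>\<^bsub>M i\<^esub>), add = (\<lambda>v w. \<lambda>i\<in>I. v i \<oplus>\<^bsub>M i\<^esub> w i),
     module.smult = (\<lambda>c v. \<lambda>i\<in>I. c \<odot>\<^bsub>M i\<^esub> v i)\<rparr>"

definition f2_linear :: "(bit, 'v) module \<Rightarrow> (bit, 'w) module \<Rightarrow> ('v \<Rightarrow> 'w) \<Rightarrow> bool" where
  "f2_linear M N f \<longleftrightarrow> f \<in> hom (add_monoid M) (add_monoid N) \<and>
     (\<forall>c. \<forall>v\<in>carrier M. f (c \<odot>\<^bsub>M\<^esub> v) = c \<odot>\<^bsub>N\<^esub> f v)"

text \<open>\<open>N\<close> is the internal direct sum of the subspaces \<open>A i\<close>, \<open>i \<in> I\<close>, and the subspace \<open>B\<close> of \<open>M\<close>.\<close>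

definition direct_decomposition ::
    "(bit, 'v) module \<Rightarrow> 'v set \<Rightarrow> 'i set \<Rightarrow> ('i \<Rightarrow> 'v set) \<Rightarrow> 'v set \<Rightarrow> bool" where
  "direct_decomposition M N I A B \<longleftrightarrow>
     (\<forall>i\<in>I. submodule (A i) F2 M) \<and> submodule B F2 M \<and>
     bij_betw (\<lambda>(u, b). (\<Oplus>\<^bsub>M\<^esub>i\<in>I. u i) \<oplus>\<^bsub>M\<^esub> b) ((\<Pi>\<^sub>E i\<in>I. A i) \<times> B) N"

definition joint_kernel ::
    "(bit, 'v) module \<Rightarrow> 'i set \<Rightarrow> ('i \<Rightarrow> (bit, 'w) module) \<Rightarrow> ('i \<Rightarrow> 'v \<Rightarrow> 'w) \<Rightarrow> 'v set" where
  "joint_kernel M I N F = {v \<in> carrier M. \<forall>i\<in>I. F i v = \<zero>\<^bsub>N i\<^esub>}"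

definition f2_dim :: "('x \<Rightarrow> bit) set \<Rightarrow> nat" where
  "f2_dim = vector_space.dim (\<lambda>(c::bit) f x. c * f x)"


section \<open>Conjugacy classes of subgroups\<close>

definition conj_class :: "('a, 'b) monoid_scheme \<Rightarrow> 'a set \<Rightarrow> 'a set set" where
  "conj_class G H = {g <#\<^bsub>G\<^esub> H #>\<^bsub>G\<^esub> inv\<^bsub>G\<^esub> g | g. g \<in> carrier G}"

definition sub_classes :: "('a, 'b) monoid_scheme \<Rightarrow> 'a set set set" where
  "sub_classes G = conj_class G ` {H. subgroup H G}"

definition crep :: "'a set set \<Rightarrow> 'a set" where
  "crep C = (SOME K. K \<in> C)"

definition core :: "('a, 'b) monoid_scheme \<Rightarrow> 'a set \<Rightarrow> 'a set" where
  "core G H = (\<Inter>g\<in>carrier G. g <#\<^bsub>G\<^esub> H #>\<^bsub>G\<^esub> inv\<^bsub>G\<^esub> g)"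

definition ncc_subgroups :: "('a, 'b) monoid_scheme \<Rightarrow> 'a set set" where
  "ncc_subgroups G = {H. subgroup H G \<and> \<not> cyclic_group (G\<lparr>carrier := H\<rparr> Mod core G H)}"

definition ncc_classes :: "('a, 'b) monoid_scheme \<Rightarrow> 'a set set set" where
  "ncc_classes G = conj_class G ` ncc_subgroups G"


section \<open>The Burnside ring\<close>

definition coset_action :: "('a, 'b) monoid_scheme \<Rightarrow> 'a set \<Rightarrow> 'a \<Rightarrow> 'a set \<Rightarrow> 'a set" where
  "coset_action G H = (\<lambda>g. \<lambda>T\<in>lcosets\<^bsub>G\<^esub> H. g <#\<^bsub>G\<^esub> T)"

text \<open>The class \<open>[X]\<close> of a finite \<open>G\<close>-set \<open>X\<close>, in the basis of the \<open>[G/H]\<close>: the coefficient at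
  \<open>(H)\<close> is the number of orbits of \<open>X\<close> isomorphic to \<open>G/H\<close>.\<close>

definition gset_class ::
    "('a, 'b) monoid_scheme \<Rightarrow> 'e set \<Rightarrow> ('a \<Rightarrow> 'e \<Rightarrow> 'e) \<Rightarrow> 'a set set \<Rightarrow> 'k::comm_ring_1" where
  "gset_class G E \<phi> C =
     of_nat (card {Y \<in> orbits G E \<phi>. \<exists>y\<in>Y. conj_class G (stabilizer G \<phi> y) = C})"

text \<open>The Burnside ring with coefficients in \<open>'k\<close>: the free module on the classes \<open>(H)\<close>, standing
  for \<open>[G/H]\<close>, with the bilinear product determined by \<open>[G/H] [G/K] = [G/H \<times> G/K]\<close>. The
  Burnside ring of \<open>G\<close> is the case \<open>'k = int\<close>, its tensor product with the rationals the case
  \<open>'k = rat\<close>.\<close>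

definition burnside_ring :: "('a, 'b) monoid_scheme \<Rightarrow> ('a set set \<Rightarrow> 'k::comm_ring_1) ring" where
  "burnside_ring G = \<lparr>carrier = {f. \<forall>C. C \<notin> sub_classes G \<longrightarrow> f C = 0},
     monoid.mult = (\<lambda>f h C. \<Sum>A\<in>sub_classes G. \<Sum>B\<in>sub_classes G. f A * h B *
       gset_class G ((lcosets\<^bsub>G\<^esub> (crep A)) \<times> (lcosets\<^bsub>G\<^esub> (crep B)))
         (\<lambda>g. \<lambda>(T, U)\<in>(lcosets\<^bsub>G\<^esub> (crep A)) \<times> (lcosets\<^bsub>G\<^esub> (crep B)). (g <#\<^bsub>G\<^esub> T, g <#\<^bsub>G\<^esub> U)) C),
     one = (\<lambda>C. if C = conj_class G (carrier G) then 1 else 0),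
     ring.zero = (\<lambda>C. 0), add = (\<lambda>f h C. f C + h C)\<rparr>"

text \<open>The linear extension of \<open>[X] \<mapsto> #X\<^sup>K\<close>.\<close>

definition mark ::
    "('a, 'b) monoid_scheme \<Rightarrow> 'a set \<Rightarrow> ('a set set \<Rightarrow> 'k::comm_ring_1) \<Rightarrow> 'k" where
  "mark G K f = (\<Sum>A\<in>sub_classes G.
     f A * of_nat (card {T \<in> (lcosets\<^bsub>G\<^esub> (crep A)). \<forall>k\<in>K. coset_action G (crep A) k T = T}))"

definition primitive_idempotent :: "('r, 'm) ring_scheme \<Rightarrow> 'r \<Rightarrow> bool" where
  "primitive_idempotent R e \<longleftrightarrow> e \<in> carrier R \<and> e \<noteq> \<zero>\<^bsub>R\<^esub> \<and> e \<otimes>\<^bsub>R\<^esub> e = e \<and>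
     (\<forall>a\<in>carrier R. \<forall>b\<in>carrier R. a \<otimes>\<^bsub>R\<^esub> a = a \<and> b \<otimes>\<^bsub>R\<^esub> b = b \<and>
        a \<otimes>\<^bsub>R\<^esub> b = \<zero>\<^bsub>R\<^esub> \<and> b \<otimes>\<^bsub>R\<^esub> a = \<zero>\<^bsub>R\<^esub> \<and> e = a \<oplus>\<^bsub>R\<^esub> b \<longrightarrow> a = \<zero>\<^bsub>R\<^esub> \<or> b = \<zero>\<^bsub>R\<^esub>)"

definition burnside_idem :: "('a, 'b) monoid_scheme \<Rightarrow> 'a set \<Rightarrow> 'a set set \<Rightarrow> rat" where
  "burnside_idem G H = (THE e. primitive_idempotent (burnside_ring G) e \<and>
     (\<forall>K. subgroup K G \<longrightarrow> mark G K e = (if conj_class G K = conj_class G H then 1 else 0)))"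

definition burnside_idem_sum :: "('a, 'b) monoid_scheme \<Rightarrow> 'a set set set \<Rightarrow> 'a set set \<Rightarrow> rat" where
  "burnside_idem_sum G S = (\<lambda>A. \<Sum>C\<in>S. burnside_idem G (crep C) A)"

definition V_space :: "('a, 'b) monoid_scheme \<Rightarrow> (bit, 'a set set \<Rightarrow> bit) module" where
  "V_space G = f2_functions (ncc_classes G)"

text \<open>Sets \<open>S\<close> of classes are represented by their characteristic functions.\<close>

definition S2 :: "('a, 'b) monoid_scheme \<Rightarrow> ('a set set \<Rightarrow> bit) set" where
  "S2 G = {\<lambda>C. if C \<in> S then 1 else 0 | S. S \<subseteq> ncc_classes G \<and>
     (\<exists>z\<in>carrier (burnside_ring G :: ('a set set \<Rightarrow> int) ring).
        (\<lambda>A. 2 * burnside_idem_sum G S A) = (\<lambda>A. of_int (z A)))}"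


section \<open>Defect spaces and the defect map\<close>

definition weyl_group :: "('a, 'b) monoid_scheme \<Rightarrow> 'a set \<Rightarrow> 'a set monoid" where
  "weyl_group G K = G\<lparr>carrier := normalizer G K\<rparr> Mod K"

definition class_functions0 :: "('w, 'b) monoid_scheme \<Rightarrow> (bit, 'w \<Rightarrow> bit) module" where
  "class_functions0 W = (f2_functions (carrier W))\<lparr>carrier :=
     {f \<in> carrier (f2_functions (carrier W)). f \<one>\<^bsub>W\<^esub> = 0 \<and>
        (\<forall>x\<in>carrier W. \<forall>y\<in>carrier W. f (x \<otimes>\<^bsub>W\<^esub> y \<otimes>\<^bsub>W\<^esub> inv\<^bsub>W\<^esub> x) = f y)}\<rparr>"

definition f2_homs :: "('w, 'b) monoid_scheme \<Rightarrow> ('w \<Rightarrow> bit) set" where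
  "f2_homs W = {f \<in> carrier (f2_functions (carrier W)).
     \<forall>x\<in>carrier W. \<forall>y\<in>carrier W. f (x \<otimes>\<^bsub>W\<^esub> y) = f x + f y}"

definition local_defect :: "('w, 'b) monoid_scheme \<Rightarrow> (bit, ('w \<Rightarrow> bit) set) module" where
  "local_defect W = quot_module (class_functions0 W) (f2_homs W)"

definition defect_class :: "('w, 'b) monoid_scheme \<Rightarrow> ('w \<Rightarrow> bit) \<Rightarrow> ('w \<Rightarrow> bit) set" where
  "defect_class W f = f2_homs W +>\<^bsub>class_functions0 W\<^esub> f"

text \<open>For a coset \<open>c = gK\<close> one has \<open>\<langle>K, g\<rangle> = \<langle>K \<union> c\<rangle>\<close>. Elements of \<open>V_space G\<close>
  already are extended by zero to all classes of subgroups.\<close>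

definition lambda_fun ::
    "('a, 'b) monoid_scheme \<Rightarrow> ('a set set \<Rightarrow> bit) \<Rightarrow> 'a set \<Rightarrow> 'a set \<Rightarrow> bit" where
  "lambda_fun G x K = (\<lambda>c. if c \<in> carrier (weyl_group G K)
     then x (conj_class G (generate G (K \<union> c))) + x (conj_class G K) else 0)"

definition D_space ::
    "('a, 'b) monoid_scheme \<Rightarrow> (bit, 'a set set \<Rightarrow> ('a set \<Rightarrow> bit) set) module" where
  "D_space G = sum_module (sub_classes G) (\<lambda>C. local_defect (weyl_group G (crep C)))"

definition Def_map ::
    "('a, 'b) monoid_scheme \<Rightarrow> ('a set set \<Rightarrow> bit) \<Rightarrow> 'a set set \<Rightarrow> ('a set \<Rightarrow> bit) set" where
  "Def_map G x = (\<lambda>C\<in>sub_classes G.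
     defect_class (weyl_group G (crep C)) (lambda_fun G x (crep C)))"

text \<open>Pullback of defect classes to \<open>W\<close> along a homomorphism \<open>\<theta>\<close> defined on \<open>W\<close>.\<close>

definition defect_pullback ::
    "('w, 'b) monoid_scheme \<Rightarrow> ('w \<Rightarrow> 'u) \<Rightarrow> ('u \<Rightarrow> bit) set \<Rightarrow> ('w \<Rightarrow> bit) set" where
  "defect_pullback W \<theta> \<omega> =
     (\<Union>f\<in>\<omega>. defect_class W (\<lambda>w. if w \<in> carrier W then f (\<theta> w) else 0))"

text \<open>The component at an arbitrary subgroup \<open>K\<close> of an element of the defect space: the
  component at the chosen representative of the class of \<open>K\<close>, transported by conjugation.
  Since defect classes consist of class functions, the conjugating element does not matter.\<close>

definition component ::
    "('a, 'b) monoid_scheme \<Rightarrow> ('a set set \<Rightarrow> ('a set \<Rightarrow> bit) set) \<Rightarrow> 'a set \<Rightarrow> ('a set \<Rightarrow> bit) set" where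
  "component G \<eta> K =
     (let C = conj_class G K;
          a = (SOME a. a \<in> carrier G \<and> a <#\<^bsub>G\<^esub> K #>\<^bsub>G\<^esub> inv\<^bsub>G\<^esub> a = crep C)
      in defect_pullback (weyl_group G K) (\<lambda>c. a <#\<^bsub>G\<^esub> c #>\<^bsub>G\<^esub> inv\<^bsub>G\<^esub> a) (\<eta> C))"


section \<open>Inflation and fixed points along a surjective homomorphism\<close>

text \<open>Throughout, \<open>p\<close> is a surjective homomorphism from \<open>G\<close> to \<open>Q\<close>; it will be a projection
  from a product. The homomorphism of Weyl groups induced by \<open>p\<close> sends a coset \<open>gH\<close>, as a set,
  to its image under \<open>p\<close>.\<close>

definition preimage :: "('a, 'b) monoid_scheme \<Rightarrow> ('a \<Rightarrow> 'c) \<Rightarrow> 'c set \<Rightarrow> 'a set" where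
  "preimage G p L = {g \<in> carrier G. p g \<in> L}"

definition Inf_V :: "('a, 'b) monoid_scheme \<Rightarrow> ('c, 'd) monoid_scheme \<Rightarrow> ('a \<Rightarrow> 'c) \<Rightarrow>
    ('c set set \<Rightarrow> bit) \<Rightarrow> 'a set set \<Rightarrow> bit" where
  "Inf_V G Q p x = (\<lambda>C. if C \<in> ncc_classes G \<and> p ` crep C \<in> ncc_subgroups Q
     then x (conj_class Q (p ` crep C)) else 0)"

definition Fix_V :: "('a, 'b) monoid_scheme \<Rightarrow> ('c, 'd) monoid_scheme \<Rightarrow> ('a \<Rightarrow> 'c) \<Rightarrow>
    ('a set set \<Rightarrow> bit) \<Rightarrow> 'c set set \<Rightarrow> bit" where
  "Fix_V G Q p y = (\<lambda>C. if C \<in> ncc_classes Q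
     then y (conj_class G (preimage G p (crep C))) else 0)"

definition Inf_D :: "('a, 'b) monoid_scheme \<Rightarrow> ('c, 'd) monoid_scheme \<Rightarrow> ('a \<Rightarrow> 'c) \<Rightarrow>
    ('c set set \<Rightarrow> ('c set \<Rightarrow> bit) set) \<Rightarrow> 'a set set \<Rightarrow> ('a set \<Rightarrow> bit) set" where
  "Inf_D G Q p \<omega> = (\<lambda>C\<in>sub_classes G.
     defect_pullback (weyl_group G (crep C)) (image p) (component Q \<omega> (p ` crep C)))"

definition Fix_D :: "('a, 'b) monoid_scheme \<Rightarrow> ('c, 'd) monoid_scheme \<Rightarrow> ('a \<Rightarrow> 'c) \<Rightarrow>
    ('a set set \<Rightarrow> ('a set \<Rightarrow> bit) set) \<Rightarrow> 'c set set \<Rightarrow> ('c set \<Rightarrow> bit) set" where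
  "Fix_D G Q p \<eta> = (\<lambda>C\<in>sub_classes Q.
     the_inv_into (carrier (local_defect (weyl_group Q (crep C))))
       (defect_pullback (weyl_group G (preimage G p (crep C))) (image p))
       (component G \<eta> (preimage G p (crep C))))"

end

theory Submission
  imports Defs
begin

text \<open>Put \<open>G = \<Prod>i. G_i\<close>. Each \<open>Fix_i\<close> is a retraction of \<open>Inf_i\<close>, and \<open>Fix_j\<close> kills the image of \<open>Inf_i\<close> for
  \<open>j \<noteq> i\<close>, because the preimage of a subgroup under \<open>\<pi>_j\<close> projects onto all of \<open>G_i\<close>, which is core-cyclic and
  has trivial Weyl group in itself. This alone gives the decompositions of \<open>V_G\<close> and \<open>D_G\<close>, and the defect map
  commutes with \<open>Inf_i\<close> and \<open>Fix_i\<close> by the formulas \<open>Inf_i(x)_(H) = x_(\<pi>_i H)\<close> and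
  \<open>Fix_i(y)_(L) = y_(\<pi>_i\<inverse> L)\<close>, valid for all subgroups.

  For \<open>S2\<close>, Yoshida's criterion is not needed: \<open>x\<close> lies in \<open>S2 G\<close> iff the function \<open>K \<mapsto> 2 x_(K)\<close>, with values in
  \<open>{0, 2}\<close>, is the mark vector of an element of the Burnside ring, and inflation \<open>[Q/L] \<mapsto> [G/p\<inverse>(L)]\<close> and
  fixed points \<open>X \<mapsto> X\<^sup>N\<close> under \<open>N = ker p\<close> are maps of Burnside rings that induce \<open>Inf\<close> and \<open>Fix\<close> on marks.\<close>

section \<open>Linear algebra over the field with two elements\<close>

text \<open>These rules turn addition and multiplication of bits into \<open>of_bool\<close> terms, out of reach of ring arithmetic.\<close>

declare add_bit_eq_xor [simp del] mult_bit_eq_and [simp del]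

text \<open>Conjugacy classes enter through the choice \<open>crep\<close>, so every formula on
  classes is given at first only at chosen representatives. The projection of a chosen subgroup is
  in general not the chosen one of its own class; hence the lemmas that restate
  \<open>Inf_V\<close>, \<open>Fix_V\<close> and \<open>component\<close> at arbitrary subgroups. On
  defect spaces a change of representative is harmless because class functions ignore inner
  automorphisms of Weyl groups.

  On the Burnside side let N be the kernel of \<open>p\<close>. As N is normal, it fixes all of G/H
  if it lies in H, and no point otherwise. In the basis of the [G/H], taking N-fixed points
  therefore deletes the coefficients at all H not containing N and relabels the others by the
  correspondence theorem; inflation is the same relabelling backwards, extended by zero. Integral
  coefficients stay integral, and the mark of an inflated element at K is the mark at p(K), while
  the mark of the fixed points at L is the mark at the preimage of L. These are the formulas for Inf
  and Fix on V.\<close>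

definition f2_module :: "(bit, 'v) module \<Rightarrow> bool" where
  "f2_module M \<longleftrightarrow> comm_group (add_monoid M) \<and>
     (\<forall>v\<in>carrier M. (0::bit) \<odot>\<^bsub>M\<^esub> v = \<zero>\<^bsub>M\<^esub> \<and> (1::bit) \<odot>\<^bsub>M\<^esub> v = v)"

lemma f2_module_abelian_group: "f2_module M \<Longrightarrow> abelian_group M"
  unfolding f2_module_def abelian_group_def abelian_group_axioms_def abelian_monoid_def
  by (auto simp: comm_group_def)

lemma f2_module_smult:
  "f2_module M \<Longrightarrow> v \<in> carrier M \<Longrightarrow> c \<odot>\<^bsub>M\<^esub> v = (if c = 0 then \<zero>\<^bsub>M\<^esub> else v)"
  by (cases c) (auto simp: f2_module_def)

text \<open>The only scalars are 0 and 1, and \<open>f2_module\<close> fixes how both act. An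
  additive map is therefore linear once it preserves zero, which every homomorphism of groups
  does.\<close>

lemma f2_linearI:
  assumes M: "f2_module M" and N: "f2_module N"
    and f: "\<And>v. v \<in> carrier M \<Longrightarrow> f v \<in> carrier N"
    and add: "\<And>v w. v \<in> carrier M \<Longrightarrow> w \<in> carrier M \<Longrightarrow> f (v \<oplus>\<^bsub>M\<^esub> w) = f v \<oplus>\<^bsub>N\<^esub> f w"
  shows "f2_linear M N f"
proof -
  have hom: "f \<in> hom (add_monoid M) (add_monoid N)"
    using f add by (auto simp: hom_def)
  interpret group_hom "add_monoid M" "add_monoid N" f
    using M N hom by (auto simp: group_hom_def group_hom_axioms_def f2_module_def comm_group_def)
  show ?thesis
    unfolding f2_linear_def using hom hom_one f by (auto simp: f2_module_smult[OF M] f2_module_smult[OF N])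
qed

lemma f2_linear_closed: "f2_linear M N f \<Longrightarrow> v \<in> carrier M \<Longrightarrow> f v \<in> carrier N"
  by (auto simp: f2_linear_def hom_def)

lemma f2_linear_add:
  "f2_linear M N f \<Longrightarrow> v \<in> carrier M \<Longrightarrow> w \<in> carrier M \<Longrightarrow> f (v \<oplus>\<^bsub>M\<^esub> w) = f v \<oplus>\<^bsub>N\<^esub> f w"
  by (auto simp: f2_linear_def hom_def)

lemma f2_linear_group_hom:
  "f2_module M \<Longrightarrow> f2_module N \<Longrightarrow> f2_linear M N f \<Longrightarrow> group_hom (add_monoid M) (add_monoid N) f"
  by (auto simp: group_hom_def group_hom_axioms_def f2_module_def comm_group_def f2_linear_def)

lemma f2_linear_zero:
  assumes "f2_module M" "f2_module N" "f2_linear M N f" shows "f \<zero>\<^bsub>M\<^esub> = \<zero>\<^bsub>N\<^esub>"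
  using group_hom.hom_one[OF f2_linear_group_hom[OF assms]] by simp

text \<open>Closure under scalars is free over two elements: 0 gives zero and 1 changes nothing.
  Subspaces are therefore handled as additive subgroups.\<close>

lemma submodule_F2I:
  assumes "f2_module M" and H: "subgroup H (add_monoid M)"
  shows "submodule H F2 M"
proof -
  have "H \<subseteq> carrier M" using H by (auto simp: subgroup_def)
  moreover have "\<zero>\<^bsub>M\<^esub> \<in> H" using H subgroup.one_closed by fastforce
  ultimately show ?thesis
    using assms by (auto simp: submodule_def submodule_axioms_def f2_module_smult)
qed

lemma f2_linear_finsum:
  assumes M: "f2_module M" and N: "f2_module N" and f: "f2_linear M N f"
    and "finite I" "u \<in> I \<rightarrow> carrier M"
  shows "f (\<Oplus>\<^bsub>M\<^esub>i\<in>I. u i) = (\<Oplus>\<^bsub>N\<^esub>i\<in>I. f (u i))"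
  using assms(4,5)
proof (induction I rule: finite_induct)
  case empty
  interpret M: abelian_group M using M by (rule f2_module_abelian_group)
  interpret N: abelian_group N using N by (rule f2_module_abelian_group)
  show ?case using f2_linear_zero[OF M N f] by simp
next
  case (insert i I)
  interpret M: abelian_group M using M by (rule f2_module_abelian_group)
  interpret N: abelian_group N using N by (rule f2_module_abelian_group)
  have "(\<lambda>i. f (u i)) \<in> insert i I \<rightarrow> carrier N"
    using insert.prems f2_linear_closed[OF f] by auto
  then show ?case
    using insert f2_linear_add[OF f] by (simp add: M.finsum_insert N.finsum_insert M.finsum_closed)
qed

lemma finsum_subgroup_closed:
  assumes M: "f2_module M" and H: "subgroup H (add_monoid M)"
    and "finite I" "u \<in> I \<rightarrow> H"
  shows "(\<Oplus>\<^bsub>M\<^esub>i\<in>I. u i) \<in> H"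
  using assms(3,4)
proof (induction I rule: finite_induct)
  case empty
  interpret M: abelian_group M using M by (rule f2_module_abelian_group)
  show ?case using subgroup.one_closed[OF H] by simp
next
  case (insert i I)
  interpret M: abelian_group M using M by (rule f2_module_abelian_group)
  have "u \<in> insert i I \<rightarrow> carrier M" using insert.prems subgroup.subset[OF H] by auto
  then show ?case using insert subgroup.m_closed[OF H] by (simp add: M.finsum_insert)
qed

text \<open>The subspaces \<open>M0\<close> and \<open>N0\<close> let the same lemma treat \<open>S2\<close>.\<close>

lemma direct_decomposition_retractions:
  assumes M: "f2_module M" and N: "\<And>i. i \<in> I \<Longrightarrow> f2_module (N i)" and I: "finite I"
    and infl: "\<And>i. i \<in> I \<Longrightarrow> f2_linear (N i) M (infl i)"
    and fixm: "\<And>i. i \<in> I \<Longrightarrow> f2_linear M (N i) (fixm i)"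
    and retract: "\<And>i x. i \<in> I \<Longrightarrow> x \<in> carrier (N i) \<Longrightarrow> fixm i (infl i x) = x"
    and orth: "\<And>i j x. i \<in> I \<Longrightarrow> j \<in> I \<Longrightarrow> i \<noteq> j \<Longrightarrow> x \<in> carrier (N i) \<Longrightarrow> fixm j (infl i x) = \<zero>\<^bsub>N j\<^esub>"
    and M0: "subgroup M0 (add_monoid M)"
    and N0: "\<And>i. i \<in> I \<Longrightarrow> subgroup (N0 i) (add_monoid (N i))"
    and inf0: "\<And>i x. i \<in> I \<Longrightarrow> x \<in> N0 i \<Longrightarrow> infl i x \<in> M0"
    and fix0: "\<And>i x. i \<in> I \<Longrightarrow> x \<in> M0 \<Longrightarrow> fixm i x \<in> N0 i"
  shows "direct_decomposition M M0 I (\<lambda>i. infl i ` N0 i) (M0 \<inter> joint_kernel M I N fixm)"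
proof -
  interpret M: abelian_group M using M by (rule f2_module_abelian_group)
  let ?K = "M0 \<inter> joint_kernel M I N fixm"
  let ?s = "\<lambda>u. \<Oplus>\<^bsub>M\<^esub>i\<in>I. u i"
  have M0s: "M0 \<subseteq> carrier M" using subgroup.subset[OF M0] by simp
  have N0s: "\<And>i. i \<in> I \<Longrightarrow> N0 i \<subseteq> carrier (N i)" using subgroup.subset[OF N0] by simp
  have sub_im: "subgroup (infl i ` N0 i) (add_monoid M)" if "i \<in> I" for i
    using group_hom.subgroup_img_is_subgroup[OF f2_linear_group_hom[OF N[OF that] M infl[OF that]] N0[OF that]] .
  have sub_K: "subgroup ?K (add_monoid M)"
  proof (rule group.subgroupI)
    show "group (add_monoid M)" using M by (simp add: f2_module_def comm_group_def)
    show "?K \<subseteq> carrier (add_monoid M)" using M0s by auto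
    show "?K \<noteq> {}"
      using subgroup.one_closed[OF M0] f2_linear_zero[OF M N fixm] by (auto simp: joint_kernel_def)
    show "inv\<^bsub>add_monoid M\<^esub> a \<in> ?K" if a: "a \<in> ?K" for a
    proof -
      have "inv\<^bsub>add_monoid M\<^esub> a \<in> M0" using a subgroup.m_inv_closed[OF M0] by auto
      moreover have "fixm i (inv\<^bsub>add_monoid M\<^esub> a) = \<zero>\<^bsub>N i\<^esub>" if "i \<in> I" for i
      proof -
        interpret group_hom "add_monoid M" "add_monoid (N i)" "fixm i"
          using f2_linear_group_hom[OF M N fixm] that by blast
        show ?thesis using hom_inv[of a] a that H.inv_one by (simp add: joint_kernel_def)
      qed
      ultimately show ?thesis using M0s by (auto simp: joint_kernel_def)
    qed
    show "a \<otimes>\<^bsub>add_monoid M\<^esub> b \<in> ?K" if a: "a \<in> ?K" and b: "b \<in> ?K" for a b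
    proof -
      have "fixm i (a \<oplus>\<^bsub>M\<^esub> b) = \<zero>\<^bsub>N i\<^esub>" if i: "i \<in> I" for i
      proof -
        interpret Ni: abelian_group "N i" using N[OF i] by (rule f2_module_abelian_group)
        show ?thesis using a b i f2_linear_add[OF fixm[OF i]] by (simp add: joint_kernel_def)
      qed
      then show ?thesis using a b subgroup.m_closed[OF M0, of a b] by (auto simp: joint_kernel_def)
    qed
  qed
  \<comment> \<open>\<open>fixm j\<close> reads off the coordinate at \<open>j\<close>: it kills
    \<open>b\<close> and, by \<open>orth\<close>, every other summand, and \<open>retract\<close>
    recovers \<open>x\<close> from the remaining one. Injectivity and the location of the remainder
    below both rest on this.\<close>
  have fix_sum: "fixm j (?s u \<oplus>\<^bsub>M\<^esub> b) = x"
    if j: "j \<in> I" and u: "u \<in> (\<Pi> i\<in>I. infl i ` N0 i)" and b: "b \<in> ?K" and x: "x \<in> N0 j" "u j = infl j x"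
    for j u b x
  proof -
    interpret Nj: abelian_group "N j" using N[OF j] by (rule f2_module_abelian_group)
    have uc: "u \<in> I \<rightarrow> carrier M" using u N0s f2_linear_closed[OF infl] by fastforce
    have bc: "b \<in> carrier M" using b by (auto simp: joint_kernel_def)
    have xc: "x \<in> carrier (N j)" using x N0s[OF j] by auto
    have "fixm j (?s u \<oplus>\<^bsub>M\<^esub> b) = fixm j (?s u) \<oplus>\<^bsub>N j\<^esub> fixm j b"
      using f2_linear_add[OF fixm[OF j]] uc bc by (simp add: M.finsum_closed)
    also have "fixm j b = \<zero>\<^bsub>N j\<^esub>" using b j by (auto simp: joint_kernel_def)
    also have "fixm j (?s u) = (\<Oplus>\<^bsub>N j\<^esub>i\<in>I. fixm j (u i))"
      by (rule f2_linear_finsum[OF M N[OF j] fixm[OF j] I uc])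
    also have "\<dots> = (\<Oplus>\<^bsub>N j\<^esub>i\<in>I. if j = i then x else \<zero>\<^bsub>N j\<^esub>)"
    proof (rule Nj.finsum_cong')
      show "(\<lambda>i. if j = i then x else \<zero>\<^bsub>N j\<^esub>) \<in> I \<rightarrow> carrier (N j)" using xc by auto
      fix i assume i: "i \<in> I"
      show "fixm j (u i) = (if j = i then x else \<zero>\<^bsub>N j\<^esub>)"
      proof (cases "j = i")
        case True then show ?thesis using x xc retract[OF j] by simp
      next
        case False
        obtain y where "y \<in> N0 i" "u i = infl i y" using u i by auto
        then show ?thesis using False orth[OF i j] N0s[OF i] by auto
      qed
    qed simp
    also have "\<dots> = x" using Nj.finsum_singleton[of j I "\<lambda>_. x"] j I xc by simp
    finally show ?thesis using xc by simp
  qed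
  have "bij_betw (\<lambda>(u, b). ?s u \<oplus>\<^bsub>M\<^esub> b) ((\<Pi>\<^sub>E i\<in>I. infl i ` N0 i) \<times> ?K) M0"
    unfolding bij_betw_def
  proof
    show "inj_on (\<lambda>(u, b). ?s u \<oplus>\<^bsub>M\<^esub> b) ((\<Pi>\<^sub>E i\<in>I. infl i ` N0 i) \<times> ?K)"
    proof (rule inj_onI, clarify)
      fix u b u' b'
      assume u: "u \<in> (\<Pi>\<^sub>E i\<in>I. infl i ` N0 i)" and u': "u' \<in> (\<Pi>\<^sub>E i\<in>I. infl i ` N0 i)"
        and b: "b \<in> M0" "b \<in> joint_kernel M I N fixm" and b': "b' \<in> M0" "b' \<in> joint_kernel M I N fixm"
        and eq: "?s u \<oplus>\<^bsub>M\<^esub> b = ?s u' \<oplus>\<^bsub>M\<^esub> b'"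
      have "u i = u' i" if i: "i \<in> I" for i
      proof -
        obtain x where x: "x \<in> N0 i" "u i = infl i x" using u i by auto
        obtain x' where x': "x' \<in> N0 i" "u' i = infl i x'" using u' i by auto
        have "fixm i (?s u \<oplus>\<^bsub>M\<^esub> b) = x" by (rule fix_sum[where u = u and x = x]) (use u b i x in auto)
        moreover have "fixm i (?s u' \<oplus>\<^bsub>M\<^esub> b') = x'" by (rule fix_sum[where u = u' and x = x']) (use u' b' i x' in auto)
        ultimately have "x = x'" using eq by simp
        then show ?thesis using x x' by simp
      qed
      then have uu: "u = u'" using u u' by (auto intro: PiE_ext)
      have "u \<in> I \<rightarrow> carrier M" using u N0s f2_linear_closed[OF infl] by fastforce
      then have "?s u \<in> carrier M" by (rule M.finsum_closed)
      then show "u = u' \<and> b = b'" using uu eq b b' by (auto simp: joint_kernel_def)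
    qed
    show "(\<lambda>(u, b). ?s u \<oplus>\<^bsub>M\<^esub> b) ` ((\<Pi>\<^sub>E i\<in>I. infl i ` N0 i) \<times> ?K) = M0"
    proof
      show "(\<lambda>(u, b). ?s u \<oplus>\<^bsub>M\<^esub> b) ` ((\<Pi>\<^sub>E i\<in>I. infl i ` N0 i) \<times> ?K) \<subseteq> M0"
      proof clarify
        fix u b assume u: "u \<in> (\<Pi>\<^sub>E i\<in>I. infl i ` N0 i)" and b: "b \<in> M0"
        have "?s u \<in> M0"
          by (rule finsum_subgroup_closed[OF M M0 I]) (use u inf0 in fastforce)
        then show "?s u \<oplus>\<^bsub>M\<^esub> b \<in> M0" using b subgroup.m_closed[OF M0, of "?s u" b] by simp
      qed
      show "M0 \<subseteq> (\<lambda>(u, b). ?s u \<oplus>\<^bsub>M\<^esub> b) ` ((\<Pi>\<^sub>E i\<in>I. infl i ` N0 i) \<times> ?K)"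
      proof
        fix v assume v: "v \<in> M0"
        \<comment> \<open>These coordinates are forced by \<open>fix_sum\<close>. What is left of
          \<open>v\<close>, the element \<open>b\<close> below, is then killed by every
          \<open>fixm j\<close>.\<close>
        define u where "u = (\<lambda>i\<in>I. infl i (fixm i v))"
        have u: "u \<in> (\<Pi>\<^sub>E i\<in>I. infl i ` N0 i)" using fix0 v by (auto simp: u_def)
        have su: "?s u \<in> M0"
          by (rule finsum_subgroup_closed[OF M M0 I]) (use u inf0 in fastforce)
        define b where "b = \<ominus>\<^bsub>M\<^esub> ?s u \<oplus>\<^bsub>M\<^esub> v"
        have suc: "?s u \<in> carrier M" "v \<in> carrier M" using su v M0s by auto
        have bM: "b \<in> M0"
          unfolding b_def using subgroup.m_closed[OF M0 subgroup.m_inv_closed[OF M0]] su v by (simp add: a_inv_def)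
        have v_eq: "?s u \<oplus>\<^bsub>M\<^esub> b = v" unfolding b_def using suc M.r_neg2 by simp
        have zero: "\<zero>\<^bsub>M\<^esub> \<in> ?K" using subgroup.one_closed[OF sub_K] by simp
        have "fixm j b = \<zero>\<^bsub>N j\<^esub>" if j: "j \<in> I" for j
        proof -
          interpret Nj: abelian_group "N j" using N[OF j] by (rule f2_module_abelian_group)
          have "fixm j (?s u \<oplus>\<^bsub>M\<^esub> \<zero>\<^bsub>M\<^esub>) = fixm j v"
            by (rule fix_sum[OF j _ zero fix0[OF j v]]) (use u j PiE_mem[OF u] in \<open>auto simp: u_def PiE_iff\<close>)
          then have su_fix: "fixm j (?s u) = fixm j v" using suc by simp
          have "fixm j v = fixm j (?s u) \<oplus>\<^bsub>N j\<^esub> fixm j b"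
            using v_eq f2_linear_add[OF fixm[OF j] suc(1), of b] bM M0s by auto
          moreover have "fixm j v \<in> carrier (N j)" "fixm j b \<in> carrier (N j)"
            using suc bM M0s f2_linear_closed[OF fixm[OF j]] by auto
          ultimately show ?thesis using su_fix by (metis Nj.r_zero Nj.zero_closed Nj.add.l_cancel)
        qed
        then have "b \<in> ?K" using bM M0s by (auto simp: joint_kernel_def)
        then show "v \<in> (\<lambda>(u, b). ?s u \<oplus>\<^bsub>M\<^esub> b) ` ((\<Pi>\<^sub>E i\<in>I. infl i ` N0 i) \<times> ?K)"
          using u v_eq by force
      qed
    qed
  qed
  then show ?thesis
    unfolding direct_decomposition_def using sub_K sub_im submodule_F2I[OF M] by blast
qed

lemma bit_self_add [simp]: "(b::bit) + b = 0"
  by (cases b) simp_all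

lemma f2_functions_module: "f2_module (f2_functions I)"
proof -
  have "comm_group (add_monoid (f2_functions I))"
  proof (rule comm_groupI)
    fix x assume "x \<in> carrier (add_monoid (f2_functions I))"
    then show "\<exists>y\<in>carrier (add_monoid (f2_functions I)). y \<otimes>\<^bsub>add_monoid (f2_functions I)\<^esub> x = \<one>\<^bsub>add_monoid (f2_functions I)\<^esub>"
      by (intro bexI[of _ x]) (simp_all add: f2_functions_def)
  qed (auto simp: f2_functions_def fun_eq_iff add_ac)
  then show ?thesis by (auto simp: f2_module_def f2_functions_def)
qed

text \<open>The axioms only see carrier, product and unit. This moves the group structure of
  \<open>Mod\<close> and \<open>product_group\<close> to the additive parts of
  \<open>quot_module\<close> and \<open>sum_module\<close>, which are different records with the
  same operations.\<close>

lemma comm_group_transfer: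
  fixes A :: "('a, 'b) monoid_scheme" and B :: "('a, 'c) monoid_scheme"
  assumes "comm_group A" "carrier B = carrier A" "monoid.mult B = monoid.mult A" "one B = one A"
  shows "comm_group B"
proof (rule comm_groupI; simp only: assms)
  interpret A: comm_group A by fact
  show "x \<otimes>\<^bsub>A\<^esub> y \<otimes>\<^bsub>A\<^esub> z = x \<otimes>\<^bsub>A\<^esub> (y \<otimes>\<^bsub>A\<^esub> z)"
    if "x \<in> carrier A" "y \<in> carrier A" "z \<in> carrier A" for x y z
    using that by (rule A.m_assoc)
  show "\<exists>y\<in>carrier A. y \<otimes>\<^bsub>A\<^esub> x = \<one>\<^bsub>A\<^esub>" if "x \<in> carrier A" for x
    using that A.l_inv by blast
qed (use assms(1) in \<open>auto simp: comm_group_def comm_monoid.m_comm monoid.m_closed monoid.one_closed monoid.l_one group.is_monoid\<close>)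

lemma quot_module_module:
  assumes M: "f2_module M" and N: "subgroup N (add_monoid M)"
  shows "f2_module (quot_module M N)"
proof -
  interpret comm_group "add_monoid M" using M by (simp add: f2_module_def)
  interpret N: normal N "add_monoid M" using N by (rule subgroup_imp_normal)
  have "comm_group (add_monoid M Mod N)" using abelian_FactGroup[OF N] .
  moreover have "(0::bit) \<odot>\<^bsub>quot_module M N\<^esub> v = \<zero>\<^bsub>quot_module M N\<^esub> \<and> (1::bit) \<odot>\<^bsub>quot_module M N\<^esub> v = v"
    if v: "v \<in> carrier (quot_module M N)" for v
  proof -
    obtain a where a: "a \<in> carrier M" "v = N #>\<^bsub>add_monoid M\<^esub> a"
      using v by (auto simp: quot_module_def A_RCOSETS_def RCOSETS_def)
    \<comment> \<open>\<open>quot_module\<close> scales a coset by a union over all its elements, so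
      the result has to be checked at every \<open>w\<close> in \<open>v\<close> and not only at
      \<open>a\<close>.\<close>
    have av: "w \<in> carrier M \<and> N #>\<^bsub>add_monoid M\<^esub> w = v" if "w \<in> v" for w
      using a v that repr_independence[OF _ _ N, of w a] r_coset_subset_G[OF _ , of N a] N.subset by auto
    have "a \<in> v" using a rcos_self[OF _ N] by auto
    have N0: "N #>\<^bsub>add_monoid M\<^esub> \<zero>\<^bsub>M\<^esub> = N" using coset_mult_one[OF N.subset] by simp
    show ?thesis
      using \<open>a \<in> v\<close> av N0 f2_module_smult[OF M] by (auto simp: quot_module_def a_r_coset_def)
  qed
  ultimately show ?thesis using comm_group_transfer[of "add_monoid M Mod N" "add_monoid (quot_module M N)"]
    by (auto simp: f2_module_def quot_module_def FactGroup_def A_RCOSETS_def set_add_def)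
qed

lemma sum_module_module:
  assumes M: "\<And>i. i \<in> I \<Longrightarrow> f2_module (M i)"
  shows "f2_module (sum_module I M)"
proof -
  have g: "comm_group (add_monoid (M i))" if "i \<in> I" for i
    using M[OF that] by (simp add: f2_module_def)
  interpret group "product_group I (\<lambda>i. add_monoid (M i))"
    by (rule product_group) (use g in \<open>simp add: comm_group_def\<close>)
  have "comm_group (product_group I (\<lambda>i. add_monoid (M i)))"
  proof (rule group_comm_groupI)
    fix x y
    assume "x \<in> carrier (product_group I (\<lambda>i. add_monoid (M i)))"
      and "y \<in> carrier (product_group I (\<lambda>i. add_monoid (M i)))"
    then show "x \<otimes>\<^bsub>product_group I (\<lambda>i. add_monoid (M i))\<^esub> y = y \<otimes>\<^bsub>product_group I (\<lambda>i. add_monoid (M i))\<^esub> x"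
      using comm_groupE(4)[OF g] by (auto simp: PiE_iff intro!: restrict_ext)
  qed
  moreover have "(0::bit) \<odot>\<^bsub>sum_module I M\<^esub> v = \<zero>\<^bsub>sum_module I M\<^esub> \<and> (1::bit) \<odot>\<^bsub>sum_module I M\<^esub> v = v"
    if "v \<in> carrier (sum_module I M)" for v
    using that M by (fastforce simp: sum_module_def f2_module_def PiE_iff extensional_def)
  ultimately show ?thesis using comm_group_transfer[of "product_group I (\<lambda>i. add_monoid (M i))" "add_monoid (sum_module I M)"]
    by (auto simp: f2_module_def sum_module_def product_group_def)
qed

section \<open>Dimension of finite subspaces by counting\<close>

interpretation f2: vector_space "\<lambda>(c::bit) (f::'x \<Rightarrow> bit) x. c * f x"
  by unfold_locales (auto simp: fun_eq_iff algebra_simps)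

text \<open>With scalars 0 and 1 only, adjoining \<open>b\<close> to \<open>B\<close> turns the span
  into the union of \<open>f2.span B\<close> and its translate by \<open>b\<close>. Independence
  makes the two disjoint, so each basis vector doubles the span.\<close>

lemma card_f2_span:
  assumes "finite B" "\<not> f2.dependent (B :: ('x \<Rightarrow> bit) set)"
  shows "finite (f2.span B) \<and> card (f2.span B) = 2 ^ card B"
  using assms
proof (induction B rule: finite_induct)
  case empty
  show ?case by (simp only: f2.span_empty) simp
next
  case (insert b B)
  have indep: "\<not> f2.dependent B" and b: "b \<notin> f2.span B"
    using insert.prems insert.hyps f2.independent_insert[of b B] by auto
  have IH: "finite (f2.span B)" "card (f2.span B) = 2 ^ card B" using insert.IH[OF indep] by auto
  have eq: "f2.span (insert b B) = f2.span B \<union> (\<lambda>x. b + x) ` f2.span B"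
  proof (intro equalityI subsetI)
    fix x assume "x \<in> f2.span (insert b B)"
    then have "\<exists>k. x - (\<lambda>y. k * b y) \<in> f2.span B" by (simp only: f2.span_insert mem_Collect_eq)
    then obtain k where k: "x - (\<lambda>y. k * b y) \<in> f2.span B" ..
    show "x \<in> f2.span B \<union> (\<lambda>x. b + x) ` f2.span B"
    proof (cases k)
      case zero
      moreover have "(\<lambda>y. 0) = (0 :: 'x \<Rightarrow> bit)" by (simp add: fun_eq_iff)
      ultimately show ?thesis using k by simp
    next
      case one
      then have "x - b \<in> f2.span B" using k by simp
      then show ?thesis by (intro UnI2 image_eqI[of _ _ "x - b"]) auto
    qed
  next
    fix x assume "x \<in> f2.span B \<union> (\<lambda>x. b + x) ` f2.span B"
    moreover have "f2.span B \<subseteq> f2.span (insert b B)" by (rule f2.span_mono) auto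
    moreover have "b \<in> f2.span (insert b B)" by (rule f2.span_base) auto
    ultimately show "x \<in> f2.span (insert b B)" by (auto intro!: f2.span_add)
  qed
  have disj: "f2.span B \<inter> (\<lambda>x. b + x) ` f2.span B = {}"
  proof -
    have False if "x \<in> f2.span B" "b + x \<in> f2.span B" for x
      using f2.span_diff[OF that(2,1)] b by simp
    then show ?thesis by auto
  qed
  have "card (f2.span (insert b B)) = card (f2.span B) + card ((\<lambda>x. b + x) ` f2.span B)"
    unfolding eq using IH disj by (simp add: card_Un_disjoint)
  also have "card ((\<lambda>x. b + x) ` f2.span B) = card (f2.span B)"
    by (rule card_image) (auto intro: inj_onI)
  finally show ?case using IH insert.hyps eq by auto
qed

text \<open>A basis of \<open>S\<close> is finite and spans \<open>S\<close>, so
  \<open>card_f2_span\<close> applies. Dimensions become exponents of cardinalities, to which the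
  bijection in \<open>direct_decomposition\<close> applies directly.\<close>

lemma card_eq_power_f2_dim:
  assumes fin: "finite (S :: ('x \<Rightarrow> bit) set)" and sub: "f2.subspace S"
  shows "card S = 2 ^ f2_dim S"
proof -
  obtain B where B: "B \<subseteq> S" "\<not> f2.dependent B" "S \<subseteq> f2.span B" "card B = f2.dim S"
    using f2.basis_exists by blast
  have "f2.span B = S"
    using B f2.span_minimal[OF B(1) sub] by auto
  moreover have "finite B" using B fin finite_subset by auto
  ultimately have "card S = 2 ^ f2.dim S" using card_f2_span[of B] B by auto
  then show ?thesis by (simp add: f2_dim_def)
qed

lemma f2_subspaceI:
  assumes "subgroup S (add_monoid (f2_functions I))"
  shows "f2.subspace S"
proof (rule f2.subspaceI)
  have z: "(\<lambda>x. 0) \<in> S" using subgroup.one_closed[OF assms] by (simp add: f2_functions_def)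
  then show "0 \<in> S" by (simp add: zero_fun_def)
  show "x + y \<in> S" if "x \<in> S" "y \<in> S" for x y
    using subgroup.m_closed[OF assms that] by (simp add: f2_functions_def plus_fun_def)
  show "(\<lambda>y. c * x y) \<in> S" if "x \<in> S" for c x
    using that z by (cases c) simp_all
qed

section \<open>Conjugacy classes and core-cyclic subgroups\<close>

text \<open>As a map on elements, conjugation by \<open>a\<close> is an endomorphism, so images of
  subgroups, cosets and generated subgroups under it are covered by
  \<open>group_hom\<close>.\<close>

definition conjugate :: "('a, 'b) monoid_scheme \<Rightarrow> 'a \<Rightarrow> 'a \<Rightarrow> 'a" where
  "conjugate G a x = a \<otimes>\<^bsub>G\<^esub> x \<otimes>\<^bsub>G\<^esub> inv\<^bsub>G\<^esub> a"

lemma conjugate_image: "a <#\<^bsub>G\<^esub> H #>\<^bsub>G\<^esub> inv\<^bsub>G\<^esub> a = conjugate G a ` H"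
  by (auto simp: l_coset_def r_coset_def conjugate_def)

lemma conj_class_image: "conj_class G H = (\<lambda>a. conjugate G a ` H) ` carrier G"
  by (auto simp: conj_class_def conjugate_image)

context group
begin

lemma conjugate_closed [simp]: "a \<in> carrier G \<Longrightarrow> x \<in> carrier G \<Longrightarrow> conjugate G a x \<in> carrier G"
  by (simp add: conjugate_def)

lemma conjugate_mult:
  "a \<in> carrier G \<Longrightarrow> x \<in> carrier G \<Longrightarrow> y \<in> carrier G \<Longrightarrow>
     conjugate G a (x \<otimes> y) = conjugate G a x \<otimes> conjugate G a y"
  by (simp add: conjugate_def m_assoc) (simp add: m_assoc[symmetric])

lemma conjugate_group_hom: "a \<in> carrier G \<Longrightarrow> group_hom G G (conjugate G a)"
  by (auto simp: group_hom_def group_hom_axioms_def hom_def conjugate_mult is_group)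

lemma conjugate_conjugate:
  "a \<in> carrier G \<Longrightarrow> b \<in> carrier G \<Longrightarrow> x \<in> carrier G \<Longrightarrow>
     conjugate G a (conjugate G b x) = conjugate G (a \<otimes> b) x"
  by (simp add: conjugate_def m_assoc inv_mult_group)

lemma conjugate_one [simp]: "x \<in> carrier G \<Longrightarrow> conjugate G \<one> x = x"
  by (simp add: conjugate_def)

lemma conjugate_set_conjugate:
  "a \<in> carrier G \<Longrightarrow> b \<in> carrier G \<Longrightarrow> H \<subseteq> carrier G \<Longrightarrow>
     conjugate G a ` conjugate G b ` H = conjugate G (a \<otimes> b) ` H"
  by (auto simp: image_image conjugate_conjugate subset_eq intro!: image_cong)

lemma conjugate_set_one [simp]: "H \<subseteq> carrier G \<Longrightarrow> conjugate G \<one> ` H = H"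
  by (auto simp: subset_eq image_iff)

lemma conjugate_set_inv:
  assumes "a \<in> carrier G" "H \<subseteq> carrier G"
  shows "conjugate G (inv a) ` conjugate G a ` H = H"
  using assms by (simp add: conjugate_set_conjugate)

lemma conjugate_set_closed: "a \<in> carrier G \<Longrightarrow> H \<subseteq> carrier G \<Longrightarrow> conjugate G a ` H \<subseteq> carrier G"
  by auto

lemma conjugate_subgroup: "a \<in> carrier G \<Longrightarrow> subgroup H G \<Longrightarrow> subgroup (conjugate G a ` H) G"
  by (rule group_hom.subgroup_img_is_subgroup[OF conjugate_group_hom])

lemma inj_on_conjugate: "a \<in> carrier G \<Longrightarrow> inj_on (conjugate G a) (carrier G)"
  by (auto simp: inj_on_def conjugate_def)

lemma conj_class_self: "H \<subseteq> carrier G \<Longrightarrow> H \<in> conj_class G H"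
  unfolding conj_class_image by (rule image_eqI[of _ _ \<one>]) auto

lemma conj_class_conjugate:
  assumes a: "a \<in> carrier G" and H: "H \<subseteq> carrier G"
  shows "conj_class G (conjugate G a ` H) = conj_class G H"
proof -
  have "conjugate G b ` H \<in> conj_class G (conjugate G a ` H)" if b: "b \<in> carrier G" for b
  proof -
    have "conjugate G b ` H = conjugate G (b \<otimes> inv a) ` conjugate G a ` H"
      using a b H by (simp add: conjugate_set_conjugate m_assoc)
    then show ?thesis using a b unfolding conj_class_image by blast
  qed
  moreover have "conjugate G b ` conjugate G a ` H \<in> conj_class G H" if b: "b \<in> carrier G" for b
    using a b H unfolding conj_class_image by (simp add: conjugate_set_conjugate)
  ultimately show ?thesis
    by (intro equalityI; subst conj_class_image) (simp_all add: image_subset_iff)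
qed

lemma conj_class_eq_iff:
  assumes "H \<subseteq> carrier G" "K \<subseteq> carrier G"
  shows "conj_class G H = conj_class G K \<longleftrightarrow> (\<exists>a\<in>carrier G. K = conjugate G a ` H)"
proof
  assume "conj_class G H = conj_class G K"
  then have "K \<in> conj_class G H" using conj_class_self[OF assms(2)] by simp
  then show "\<exists>a\<in>carrier G. K = conjugate G a ` H" by (auto simp: conj_class_image)
qed (use conj_class_conjugate[OF _ assms(1)] in auto)

lemma crep_subgroup:
  assumes "C \<in> sub_classes G" shows "subgroup (crep C) G" "conj_class G (crep C) = C"
proof -
  obtain H where H: "subgroup H G" "C = conj_class G H" using assms by (auto simp: sub_classes_def)
  have "crep C \<in> C" unfolding crep_def
    using conj_class_self[OF subgroup.subset[OF H(1)]] H(2) by (auto intro: someI)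
  then obtain a where a: "a \<in> carrier G" "crep C = conjugate G a ` H"
    using H(2) by (auto simp: conj_class_image)
  show "subgroup (crep C) G" using a H conjugate_subgroup by simp
  show "conj_class G (crep C) = C" using a H conj_class_conjugate[OF a(1) subgroup.subset[OF H(1)]] by simp
qed

lemma conj_class_in_sub_classes: "subgroup H G \<Longrightarrow> conj_class G H \<in> sub_classes G"
  by (simp add: sub_classes_def)

lemma crep_conj_class:
  assumes "subgroup H G"
  obtains a where "a \<in> carrier G" "crep (conj_class G H) = conjugate G a ` H"
proof -
  note c = crep_subgroup[OF conj_class_in_sub_classes[OF assms]]
  have "\<exists>a\<in>carrier G. crep (conj_class G H) = conjugate G a ` H"
    using c(2)[symmetric] unfolding conj_class_eq_iff[OF subgroup.subset[OF assms] subgroup.subset[OF c(1)]] .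
  then show ?thesis using that by blast
qed

lemma finite_sub_classes: "finite (carrier G) \<Longrightarrow> finite (sub_classes G)"
  unfolding sub_classes_def
  by (intro finite_imageI) (auto intro: finite_subset[of _ "Pow (carrier G)"] dest: subgroup.subset)

lemma ncc_classes_subset: "ncc_classes G \<subseteq> sub_classes G"
  by (auto simp: ncc_classes_def sub_classes_def ncc_subgroups_def)

lemma normalizer_alt:
  "K \<subseteq> carrier G \<Longrightarrow> normalizer G K = {g \<in> carrier G. conjugate G g ` K = K}"
  by (auto simp: normalizer_def stabilizer_def conjugate_image)

text \<open>The powers of one element \<open>h\<close> have to meet every coset of \<open>N\<close>.
  In this elementwise form generators can be pushed forward and lifted along a homomorphism without
  comparing quotient groups.\<close>

lemma cyclic_quotient_iff:
  assumes "N \<lhd> G"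
  shows "cyclic_group (G Mod N) \<longleftrightarrow> (\<exists>h\<in>carrier G. \<forall>x\<in>carrier G. \<exists>n::int. x \<in> N #> h [^] n)"
proof -
  interpret N: normal N G by fact
  have Nx: "(\<exists>T\<in>carrier (G Mod N). P T) \<longleftrightarrow> (\<exists>h\<in>carrier G. P (N #> h))" for P
    by (simp add: carrier_FactGroup)
  interpret Q: group "G Mod N" by (rule N.factorgroup_is_group)
  have gen: "carrier (G Mod N) = range (\<lambda>n::int. (N #> h) [^]\<^bsub>G Mod N\<^esub> n) \<longleftrightarrow>
      (\<forall>x\<in>carrier G. \<exists>n::int. x \<in> N #> h [^] n)" if h: "h \<in> carrier G" for h
  proof -
    have pow: "(N #> h) [^]\<^bsub>G Mod N\<^esub> (n::int) = N #> h [^] n" for n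
      using N.FactGroup_int_pow[OF h] by simp
    have "carrier (G Mod N) = range (\<lambda>n::int. N #> h [^] n) \<longleftrightarrow>
        (\<forall>x\<in>carrier G. \<exists>n::int. N #> x = N #> h [^] n)"
    proof -
      have "range (\<lambda>n::int. N #> h [^] n) \<subseteq> carrier (G Mod N)"
        using h by (auto simp: carrier_FactGroup)
      then have "carrier (G Mod N) = range (\<lambda>n::int. N #> h [^] n) \<longleftrightarrow>
          (\<forall>T\<in>carrier (G Mod N). T \<in> range (\<lambda>n::int. N #> h [^] n))"
        by (simp add: set_eq_subset subset_iff Ball_def)
      then show ?thesis by (simp add: carrier_FactGroup image_iff)
    qed
    also have "\<dots> \<longleftrightarrow> (\<forall>x\<in>carrier G. \<exists>n::int. x \<in> N #> h [^] n)"
    proof -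
      have "N #> x = N #> h [^] n \<longleftrightarrow> x \<in> N #> h [^] n" if "x \<in> carrier G" for x and n :: int
        using repr_independence[OF _ int_pow_closed[OF h] N.subgroup_axioms, of x n]
          rcos_self[OF that N.subgroup_axioms] by auto
      then show ?thesis by simp
    qed
    finally show ?thesis by (simp add: pow)
  qed
  show ?thesis
    unfolding Q.cyclic_group Nx by (rule bex_cong[OF refl gen])
qed

lemma core_iff: "x \<in> core G H \<longleftrightarrow> (\<forall>g\<in>carrier G. x \<in> conjugate G g ` H)"
  by (auto simp: core_def conjugate_image)

lemma core_subset: "H \<subseteq> carrier G \<Longrightarrow> core G H \<subseteq> H"
proof
  fix x assume "H \<subseteq> carrier G" "x \<in> core G H"
  then have "x \<in> conjugate G \<one> ` H" unfolding core_iff by blast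
  then show "x \<in> H" using conjugate_set_one[OF \<open>H \<subseteq> carrier G\<close>] by simp
qed

text \<open>Conjugation by \<open>a\<close> permutes the conjugates of \<open>H\<close> whose
  intersection is the core.\<close>

lemma core_normal:
  assumes "subgroup H G" shows "core G H \<lhd> G"
proof -
  have "core G H = (\<Inter>g\<in>carrier G. conjugate G g ` H)" by (simp add: core_def conjugate_image)
  moreover have "subgroup (\<Inter>g\<in>carrier G. conjugate G g ` H) G"
    using subgroups_Inter[of "(\<lambda>g. conjugate G g ` H) ` carrier G"] conjugate_subgroup[OF _ assms] by auto
  ultimately have sub: "subgroup (core G H) G" by simp
  show ?thesis
  proof (rule normal_invI[OF sub])
    fix a x assume a: "a \<in> carrier G" and x: "x \<in> core G H"
    have "conjugate G a x \<in> conjugate G g ` H" if g: "g \<in> carrier G" for g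
    proof -
      have "x \<in> conjugate G (inv a \<otimes> g) ` H" using x a g by (auto simp: core_iff)
      then have "conjugate G a x \<in> conjugate G a ` conjugate G (inv a \<otimes> g) ` H" by blast
      also have "\<dots> = conjugate G g ` H"
        using a g subgroup.subset[OF assms] by (simp add: conjugate_set_conjugate m_assoc[symmetric])
      finally show ?thesis .
    qed
    then show "a \<otimes> x \<otimes> inv a \<in> core G H" unfolding core_iff conjugate_def[symmetric] by blast
  qed
qed

lemma ncc_subgroups_iff:
  "H \<in> ncc_subgroups G \<longleftrightarrow>
     subgroup H G \<and> \<not> (\<exists>h\<in>H. \<forall>x\<in>H. \<exists>n::int. x \<in> core G H #> h [^] n)"
proof (cases "subgroup H G")
  case True
  interpret H: group "G\<lparr>carrier := H\<rparr>" using subgroup_imp_group[OF True] .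
  have "core G H \<lhd> G\<lparr>carrier := H\<rparr>"
    using normal_restrict_supergroup[OF True core_normal[OF True] core_subset[OF subgroup.subset[OF True]]] .
  then have "cyclic_group (G\<lparr>carrier := H\<rparr> Mod core G H) \<longleftrightarrow>
      (\<exists>h\<in>H. \<forall>x\<in>H. \<exists>n::int. x \<in> core G H #> h [^]\<^bsub>G\<lparr>carrier := H\<rparr>\<^esub> n)"
    by (simp add: H.cyclic_quotient_iff)
  also have "\<dots> \<longleftrightarrow> (\<exists>h\<in>H. \<forall>x\<in>H. \<exists>n::int. x \<in> core G H #> h [^] n)"
    by (rule bex_cong) (simp_all add: int_pow_consistent[OF True, symmetric])
  finally show ?thesis using True by (simp add: ncc_subgroups_def)
qed (simp add: ncc_subgroups_def)

end

section \<open>Subgroups along an epimorphism\<close>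

locale group_epi = group_hom G Q p for G (structure) and Q (structure) and p +
  assumes surj: "p ` carrier G = carrier Q"
begin

lemma p_conjugate: "a \<in> carrier G \<Longrightarrow> x \<in> carrier G \<Longrightarrow> p (conjugate G a x) = conjugate Q (p a) (p x)"
  by (simp add: conjugate_def)

lemma p_conjugate_set: "a \<in> carrier G \<Longrightarrow> H \<subseteq> carrier G \<Longrightarrow> p ` conjugate G a ` H = conjugate Q (p a) ` p ` H"
  by (auto simp: image_image p_conjugate subset_eq intro!: image_cong)

lemma image_closed: "H \<subseteq> carrier G \<Longrightarrow> p ` H \<subseteq> carrier Q"
  by auto

lemma image_subgroup: "subgroup K G \<Longrightarrow> subgroup (p ` K) Q"
  by (rule subgroup_img_is_subgroup)

lemma preimage_subset: "preimage G p L \<subseteq> carrier G"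
  by (auto simp: preimage_def)

lemma preimage_subgroup: "subgroup L Q \<Longrightarrow> subgroup (preimage G p L) G"
  unfolding subgroup_def by (auto simp: preimage_def subset_eq)

lemma image_preimage: "L \<subseteq> carrier Q \<Longrightarrow> p ` preimage G p L = L"
  using surj by (auto simp: preimage_def image_iff subset_eq)

lemma preimage_conjugate:
  assumes a: "a \<in> carrier G" and L: "L \<subseteq> carrier Q"
  shows "preimage G p (conjugate Q (p a) ` L) = conjugate G a ` preimage G p L"
proof
  show "preimage G p (conjugate Q (p a) ` L) \<subseteq> conjugate G a ` preimage G p L"
  proof
    fix x assume x: "x \<in> preimage G p (conjugate Q (p a) ` L)"
    then obtain l where l: "l \<in> L" "p x = conjugate Q (p a) l" and xG: "x \<in> carrier G"
      by (auto simp: preimage_def)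
    have "conjugate Q (inv\<^bsub>Q\<^esub> p a) (p x) = l" using l a L by (auto simp: H.conjugate_conjugate subset_eq)
    then have "conjugate G (inv\<^bsub>G\<^esub> a) x \<in> preimage G p L"
      using a xG l by (simp add: preimage_def p_conjugate)
    moreover have "x = conjugate G a (conjugate G (inv\<^bsub>G\<^esub> a) x)" using a xG by (simp add: G.conjugate_conjugate)
    ultimately show "x \<in> conjugate G a ` preimage G p L" by blast
  qed
  show "conjugate G a ` preimage G p L \<subseteq> preimage G p (conjugate Q (p a) ` L)"
    using a by (auto simp: preimage_def p_conjugate)
qed

lemma conj_class_p_cong:
  assumes "H \<subseteq> carrier G" "K \<subseteq> carrier G" "conj_class G H = conj_class G K"
  shows "conj_class Q (p ` H) = conj_class Q (p ` K)"
proof -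
  obtain a where "a \<in> carrier G" "K = conjugate G a ` H" using assms(3) unfolding G.conj_class_eq_iff[OF assms(1,2)] by blast
  then show ?thesis using assms p_conjugate_set[of a H] H.conj_class_conjugate[of "p a" "p ` H"] image_closed[of H] by simp
qed

lemma conj_class_preimage_cong:
  assumes "L \<subseteq> carrier Q" "M \<subseteq> carrier Q" "conj_class Q L = conj_class Q M"
  shows "conj_class G (preimage G p L) = conj_class G (preimage G p M)"
proof -
  obtain b where "b \<in> carrier Q" "M = conjugate Q b ` L" using assms(3) unfolding H.conj_class_eq_iff[OF assms(1,2)] by blast
  moreover from this have "b \<in> p ` carrier G" using surj by simp
  ultimately obtain a where "a \<in> carrier G" "M = conjugate Q (p a) ` L" by auto
  then show ?thesis
    using preimage_conjugate[OF _ assms(1)] G.conj_class_conjugate[OF _ preimage_subset] by simp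
qed

text \<open>Since \<open>p\<close> is onto, every conjugating element of \<open>Q\<close> lifts, so
  \<open>p\<close> maps the core of \<open>K\<close> into the core of its image. A generator of
  \<open>K\<close> modulo its core then maps to one for the image.\<close>

lemma ncc_of_image:
  assumes K: "subgroup K G" and ncc: "p ` K \<in> ncc_subgroups Q"
  shows "K \<in> ncc_subgroups G"
proof (rule ccontr)
  assume "K \<notin> ncc_subgroups G"
  then obtain h where h: "h \<in> K" "\<And>x. x \<in> K \<Longrightarrow> \<exists>n::int. x \<in> core G K #>\<^bsub>G\<^esub> h [^]\<^bsub>G\<^esub> n"
    using K by (auto simp: G.ncc_subgroups_iff)
  have KG: "K \<subseteq> carrier G" using K by (rule subgroup.subset)
  have core: "p ` core G K \<subseteq> core Q (p ` K)"
  proof clarify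
    fix x assume x: "x \<in> core G K"
    have "p x \<in> conjugate Q q ` p ` K" if "q \<in> carrier Q" for q
    proof -
      obtain g where g: "g \<in> carrier G" "q = p g" using \<open>q \<in> carrier Q\<close> unfolding surj[symmetric] by blast
      then have "x \<in> conjugate G g ` K" using x by (simp add: G.core_iff)
      then have "p x \<in> p ` conjugate G g ` K" by blast
      then show ?thesis using p_conjugate_set[OF g(1) KG] g by simp
    qed
    then show "p x \<in> core Q (p ` K)" by (simp add: H.core_iff)
  qed
  have "\<exists>n::int. p x \<in> core Q (p ` K) #>\<^bsub>Q\<^esub> p h [^]\<^bsub>Q\<^esub> n" if "x \<in> K" for x
  proof -
    obtain n :: int and c where c: "c \<in> core G K" "x = c \<otimes>\<^bsub>G\<^esub> h [^]\<^bsub>G\<^esub> n"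
      using h(2)[OF \<open>x \<in> K\<close>] by (auto simp: r_coset_def)
    moreover have "c \<in> carrier G" using c G.core_subset[OF KG] KG by auto
    ultimately have "p x = p c \<otimes>\<^bsub>Q\<^esub> p h [^]\<^bsub>Q\<^esub> n" using h KG by (auto simp: hom_int_pow)
    then show ?thesis using c core by (auto simp: r_coset_def)
  qed
  then have "\<forall>y\<in>p ` K. \<exists>n::int. y \<in> core Q (p ` K) #>\<^bsub>Q\<^esub> p h [^]\<^bsub>Q\<^esub> n" by simp
  then have "\<exists>h\<in>p ` K. \<forall>y\<in>p ` K. \<exists>n::int. y \<in> core Q (p ` K) #>\<^bsub>Q\<^esub> h [^]\<^bsub>Q\<^esub> n"
    by (rule bexI) (use h(1) in simp)
  moreover note ncc[unfolded H.ncc_subgroups_iff]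
  ultimately show False by (elim conjE notE)
qed

text \<open>A generator \<open>l\<close> of \<open>L\<close> modulo its core lifts to some
  \<open>h\<close>. Elements lying over the core of \<open>L\<close> are in the core of the
  preimage, because conjugates of the preimage are preimages of conjugates; so the powers of
  \<open>h\<close> suffice upstairs.\<close>

lemma ncc_of_preimage:
  assumes L: "subgroup L Q" and ncc: "preimage G p L \<in> ncc_subgroups G"
  shows "L \<in> ncc_subgroups Q"
proof (rule ccontr)
  assume "L \<notin> ncc_subgroups Q"
  then obtain l where l: "l \<in> L" "\<And>y. y \<in> L \<Longrightarrow> \<exists>n::int. y \<in> core Q L #>\<^bsub>Q\<^esub> l [^]\<^bsub>Q\<^esub> n"
    using L by (auto simp: H.ncc_subgroups_iff)
  have LQ: "L \<subseteq> carrier Q" using L by (rule subgroup.subset)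
  have "l \<in> p ` carrier G" using l(1) LQ surj by auto
  then obtain h where h: "h \<in> carrier G" "p h = l" by auto
  have core: "x \<in> core G (preimage G p L)" if x: "x \<in> carrier G" "p x \<in> core Q L" for x
  proof -
    have "x \<in> conjugate G g ` preimage G p L" if "g \<in> carrier G" for g
      unfolding preimage_conjugate[OF that LQ, symmetric] using x that by (simp add: H.core_iff preimage_def)
    then show ?thesis by (simp add: G.core_iff)
  qed
  have "\<exists>n::int. x \<in> core G (preimage G p L) #>\<^bsub>G\<^esub> h [^]\<^bsub>G\<^esub> n" if "x \<in> preimage G p L" for x
  proof -
    have x: "x \<in> carrier G" "p x \<in> L" using that by (auto simp: preimage_def)
    obtain n :: int and c where c: "c \<in> core Q L" "p x = c \<otimes>\<^bsub>Q\<^esub> l [^]\<^bsub>Q\<^esub> n"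
      using l(2)[OF x(2)] by (auto simp: r_coset_def)
    have cQ: "c \<in> carrier Q" using c H.core_subset[OF LQ] LQ by auto
    define d where "d = x \<otimes>\<^bsub>G\<^esub> inv\<^bsub>G\<^esub> (h [^]\<^bsub>G\<^esub> n)"
    have "p d = c"
      using x h l LQ c cQ by (auto simp: d_def hom_int_pow H.m_assoc)
    then have "d \<in> core G (preimage G p L)" using core[of d] x h c by (simp add: d_def)
    moreover have "x = d \<otimes>\<^bsub>G\<^esub> h [^]\<^bsub>G\<^esub> n" using x h by (simp add: d_def G.m_assoc)
    ultimately show ?thesis by (auto simp: r_coset_def)
  qed
  moreover have "h \<in> preimage G p L" using h l by (simp add: preimage_def)
  ultimately have "\<exists>h\<in>preimage G p L. \<forall>x\<in>preimage G p L. \<exists>n::int. x \<in> core G (preimage G p L) #>\<^bsub>G\<^esub> h [^]\<^bsub>G\<^esub> n"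
    by (intro bexI[of _ h] ballI)
  moreover note ncc[unfolded G.ncc_subgroups_iff]
  ultimately show False by (elim conjE notE)
qed

end

text \<open>Makes the results on epimorphisms available for conjugation, in particular the
  invariance of \<open>ncc_subgroups\<close> under it.\<close>

lemma (in group) conjugate_epi: "a \<in> carrier G \<Longrightarrow> group_epi G G (conjugate G a)"
proof (rule group_epi.intro[OF conjugate_group_hom])
  assume a: "a \<in> carrier G"
  then have "conjugate G a ` conjugate G (inv a) ` carrier G = carrier G"
    by (simp add: conjugate_set_conjugate)
  then show "group_epi_axioms G G (conjugate G a)"
    unfolding group_epi_axioms_def
    using conjugate_set_closed[OF a order.refl] image_mono[OF conjugate_set_closed[OF inv_closed[OF a] order.refl], of "conjugate G a"]
    by (intro equalityI) simp_all
qed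

text \<open>Conjugation is an epimorphism of \<open>G\<close> onto itself, so
  \<open>ncc_of_image\<close> moves the property between members of a class. Membership in
  \<open>ncc_classes\<close> may thus be tested on any representative.\<close>

lemma (in group) ncc_conj_class_iff:
  assumes H: "subgroup H G"
  shows "conj_class G H \<in> ncc_classes G \<longleftrightarrow> H \<in> ncc_subgroups G"
proof
  assume "conj_class G H \<in> ncc_classes G"
  then obtain K where K: "K \<in> ncc_subgroups G" "conj_class G H = conj_class G K"
    by (auto simp: ncc_classes_def)
  then have "subgroup K G" by (simp add: ncc_subgroups_def)
  then obtain a where "a \<in> carrier G" "K = conjugate G a ` H"
    using K(2) unfolding conj_class_eq_iff[OF subgroup.subset[OF H] subgroup.subset[OF \<open>subgroup K G\<close>]] by blast
  then show "H \<in> ncc_subgroups G"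
    using group_epi.ncc_of_image[OF conjugate_epi H] K by simp
qed (simp add: ncc_classes_def)

section \<open>Marks\<close>

text \<open>The entry of the table of marks for \<open>G/H\<close> and \<open>K\<close>, kept as a
  natural number so that it serves integral and rational coefficients alike.\<close>

definition coset_mark :: "('a, 'b) monoid_scheme \<Rightarrow> 'a set \<Rightarrow> 'a set \<Rightarrow> nat" where
  "coset_mark G H K = card {T \<in> lcosets\<^bsub>G\<^esub> H. \<forall>k\<in>K. coset_action G H k T = T}"

text \<open>The elements \<open>g\<close> with \<open>K\<close> contained in the conjugate of
  \<open>H\<close> by \<open>g\<close>; their set is the union of the cosets \<open>gH\<close> fixed
  by \<open>K\<close>. Marks are counted through these elements because translations of the group
  and fibres of homomorphisms are easy to count on elements.\<close>

definition transporter :: "('a, 'b) monoid_scheme \<Rightarrow> 'a set \<Rightarrow> 'a set \<Rightarrow> 'a set" where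
  "transporter G H K = {g \<in> carrier G. \<forall>k\<in>K. conjugate G (inv\<^bsub>G\<^esub> g) k \<in> H}"

lemma mark_coset_mark:
  "mark G K f = (\<Sum>A\<in>sub_classes G. f A * of_nat (coset_mark G (crep A) K))"
  by (simp add: mark_def coset_mark_def)

lemma mark_add: "mark G K (\<lambda>A. f A + h A) = mark G K f + mark G K h"
  by (simp add: mark_def sum.distrib distrib_right)

lemma mark_scale: "mark G K (\<lambda>A. c * f A) = c * mark G K f"
  by (simp add: mark_def sum_distrib_left mult.assoc)

lemma mark_sum: "finite S \<Longrightarrow> mark G K (\<lambda>A. \<Sum>i\<in>S. f i A) = (\<Sum>i\<in>S. mark G K (f i))"
  by (simp add: mark_def sum_distrib_right) (rule sum.swap)

lemma mark_of_int: "mark G K (\<lambda>A. of_int (z A)) = of_int (mark G K z)"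
  by (simp add: mark_def)

lemma transporter_subset: "transporter G H K \<subseteq> carrier G"
  by (auto simp: transporter_def)

locale finite_group = group G for G (structure) +
  assumes finite_carrier: "finite (carrier G)"
begin

lemma finite_subset_carrier: "H \<subseteq> carrier G \<Longrightarrow> finite H"
  using finite_carrier finite_subset by blast

lemma card_subgroup_pos: "subgroup H G \<Longrightarrow> card H > 0"
  using finite_subset_carrier[OF subgroup.subset] subgroup.one_closed by (fastforce simp: card_gt_0_iff)

lemma card_conjugate: "a \<in> carrier G \<Longrightarrow> H \<subseteq> carrier G \<Longrightarrow> card (conjugate G a ` H) = card H"
  by (intro card_image inj_on_subset[OF inj_on_conjugate])

lemma card_conj_class_cong:
  assumes "H \<subseteq> carrier G" "K \<subseteq> carrier G" "conj_class G H = conj_class G K"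
  shows "card H = card K"
  using assms(3) card_conjugate[OF _ assms(1)] unfolding conj_class_eq_iff[OF assms(1,2)] by auto

lemma coset_action_fixed_iff:
  assumes H: "subgroup H G" and g: "g \<in> carrier G" and k: "k \<in> carrier G"
  shows "coset_action G H k (g <# H) = g <# H \<longleftrightarrow> conjugate G (inv g) k \<in> H"
proof -
  interpret H: subgroup H G by fact
  have "coset_action G H k (g <# H) = k <# (g <# H)"
    using g by (auto simp: coset_action_def LCOSETS_def)
  also have "\<dots> = (k \<otimes> g) <# H" using g k H.subset by (simp add: lcos_m_assoc)
  finally have "coset_action G H k (g <# H) = g <# H \<longleftrightarrow> (k \<otimes> g) <# H = g <# H" by simp
  also have "\<dots> \<longleftrightarrow> k \<otimes> g \<in> g <# H"
    using l_repr_independence[OF _ g H, of "k \<otimes> g"] lcos_self[OF _ H, of "k \<otimes> g"] g k by auto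
  also have "\<dots> \<longleftrightarrow> inv g \<otimes> (k \<otimes> g) \<in> H"
    using H.lcos_module_rev[OF is_group g, of "k \<otimes> g"] H.lcos_module_imp[OF is_group g, of "k \<otimes> g"] g k by auto
  finally show ?thesis using g k by (simp add: conjugate_def m_assoc)
qed

text \<open>The left cosets of \<open>H\<close> fixed by \<open>K\<close> partition the transporter,
  and each has the size of \<open>H\<close>.\<close>

lemma card_transporter:
  assumes H: "subgroup H G" and K: "K \<subseteq> carrier G"
  shows "card (transporter G H K) = card H * coset_mark G H K"
proof -
  interpret H: subgroup H G by fact
  let ?F = "{T \<in> lcosets H. \<forall>k\<in>K. coset_action G H k T = T}"
  have sub: "\<Union>?F \<subseteq> carrier G" using lcosets_part_G[OF H] by blast
  have "transporter G H K = \<Union>?F"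
  proof (intro equalityI subsetI)
    fix g assume g: "g \<in> transporter G H K"
    then have gG: "g \<in> carrier G" by (simp add: transporter_def)
    have "g <# H \<in> ?F"
      using g gG K coset_action_fixed_iff[OF H gG] by (auto simp: LCOSETS_def transporter_def)
    then show "g \<in> \<Union>?F" using lcos_self[OF gG H] by (rule UnionI)
  next
    fix g assume g: "g \<in> \<Union>?F"
    then have gG: "g \<in> carrier G" using sub by auto
    obtain T where T: "T \<in> ?F" "g \<in> T" using g by auto
    then obtain a where a: "a \<in> carrier G" "T = a <# H" by (auto simp: LCOSETS_def)
    then have "T = g <# H" using l_repr_independence[OF _ a(1) H] T by simp
    then show "g \<in> transporter G H K"
      using T K gG coset_action_fixed_iff[OF H gG] by (auto simp: transporter_def)
  qed
  moreover have "card H * card ?F = card (\<Union>?F)"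
  proof (rule card_partition)
    show "finite (\<Union>?F)" using sub finite_subset_carrier by blast
    then show "finite ?F" by (rule finite_UnionD)
    show "card c = card H" if "c \<in> ?F" for c
      using that l_card_cosets_equal[OF _ H.subset finite_carrier] by auto
    show "c1 \<inter> c2 = {}" if "c1 \<in> ?F" "c2 \<in> ?F" "c1 \<noteq> c2" for c1 c2
      using that lcos_disjoint[OF H] by auto
  qed
  ultimately show ?thesis by (simp add: coset_mark_def)
qed

lemma coset_mark_nonzero_iff:
  assumes H: "subgroup H G" and K: "K \<subseteq> carrier G"
  shows "coset_mark G H K \<noteq> 0 \<longleftrightarrow> (\<exists>a\<in>carrier G. conjugate G a ` K \<subseteq> H)"
proof -
  have "finite (transporter G H K)" by (rule finite_subset_carrier) (auto simp: transporter_def)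
  then have "coset_mark G H K \<noteq> 0 \<longleftrightarrow> transporter G H K \<noteq> {}"
    using card_transporter[OF assms] card_subgroup_pos[OF H] by auto
  also have "\<dots> \<longleftrightarrow> (\<exists>a\<in>carrier G. conjugate G a ` K \<subseteq> H)"
  proof
    assume "transporter G H K \<noteq> {}"
    then obtain g where "g \<in> carrier G" "\<forall>k\<in>K. conjugate G (inv g) k \<in> H" by (auto simp: transporter_def)
    then show "\<exists>a\<in>carrier G. conjugate G a ` K \<subseteq> H" by (intro bexI[of _ "inv g"]) auto
  next
    assume "\<exists>a\<in>carrier G. conjugate G a ` K \<subseteq> H"
    then obtain a where "a \<in> carrier G" "conjugate G a ` K \<subseteq> H" by auto
    then have "inv a \<in> transporter G H K" by (auto simp: transporter_def)
    then show "transporter G H K \<noteq> {}" by auto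
  qed
  finally show ?thesis .
qed

lemma coset_mark_conjugate:
  assumes H: "subgroup H G" and K: "K \<subseteq> carrier G" and a: "a \<in> carrier G" and b: "b \<in> carrier G"
  shows "coset_mark G (conjugate G a ` H) (conjugate G b ` K) = coset_mark G H K"
proof -
  have HG: "H \<subseteq> carrier G" using H by (rule subgroup.subset)
  have inj: "conjugate G a x \<in> conjugate G a ` H \<longleftrightarrow> x \<in> H" if "x \<in> carrier G" for x
    using that inj_on_image_mem_iff[OF inj_on_conjugate[OF a] that HG] by simp
  have "g \<in> transporter G H K \<longleftrightarrow> b \<otimes> g \<otimes> inv a \<in> transporter G (conjugate G a ` H) (conjugate G b ` K)"
    if g: "g \<in> carrier G" for g
  proof -
    have "conjugate G (inv (b \<otimes> g \<otimes> inv a)) (conjugate G b k) = conjugate G a (conjugate G (inv g) k)"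
      if "k \<in> carrier G" for k
      using that g a b by (simp add: conjugate_conjugate inv_mult_group m_assoc)
    then show ?thesis using g a b K inj by (auto simp: transporter_def subset_iff)
  qed
  \<comment> \<open>The transporter of the conjugates by \<open>a\<close> and \<open>b\<close> is a
    two-sided translate of the original one, and a translation is invertible.\<close>
  then have "bij_betw (\<lambda>g. b \<otimes> g \<otimes> inv a) (transporter G H K) (transporter G (conjugate G a ` H) (conjugate G b ` K))"
  proof (intro bij_betw_byWitness[where f' = "\<lambda>g. inv b \<otimes> g \<otimes> a"])
    assume *: "\<And>g. g \<in> carrier G \<Longrightarrow> g \<in> transporter G H K \<longleftrightarrow>
      b \<otimes> g \<otimes> inv a \<in> transporter G (conjugate G a ` H) (conjugate G b ` K)"
    show "(\<lambda>g. b \<otimes> g \<otimes> inv a) ` transporter G H K \<subseteq> transporter G (conjugate G a ` H) (conjugate G b ` K)"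
      using * by (auto simp: transporter_def)
    show "\<forall>g\<in>transporter G H K. inv b \<otimes> (b \<otimes> g \<otimes> inv a) \<otimes> a = g"
      using a b by (auto simp: transporter_def m_assoc inv_solve_left')
    show **: "\<forall>g\<in>transporter G (conjugate G a ` H) (conjugate G b ` K). b \<otimes> (inv b \<otimes> g \<otimes> a) \<otimes> inv a = g"
    proof
      fix g assume "g \<in> transporter G (conjugate G a ` H) (conjugate G b ` K)"
      then have "g \<in> carrier G" by (simp add: transporter_def)
      moreover from this have "b \<otimes> (inv b \<otimes> g \<otimes> a) \<otimes> inv a = (b \<otimes> inv b) \<otimes> g \<otimes> (a \<otimes> inv a)"
        using a b by (simp only: m_assoc m_closed inv_closed)
      ultimately show "b \<otimes> (inv b \<otimes> g \<otimes> a) \<otimes> inv a = g" using a b by simp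
    qed
    show "(\<lambda>g. inv b \<otimes> g \<otimes> a) ` transporter G (conjugate G a ` H) (conjugate G b ` K) \<subseteq> transporter G H K"
    proof (rule image_subsetI)
      fix g assume g: "g \<in> transporter G (conjugate G a ` H) (conjugate G b ` K)"
      then have "inv b \<otimes> g \<otimes> a \<in> carrier G" using a b by (auto simp: transporter_def)
      then show "inv b \<otimes> g \<otimes> a \<in> transporter G H K" using *[of "inv b \<otimes> g \<otimes> a"] ** g by simp
    qed
  qed
  then have "card (transporter G H K) = card (transporter G (conjugate G a ` H) (conjugate G b ` K))"
    by (rule bij_betw_same_card)
  then show ?thesis
    using card_transporter[OF H K] card_transporter[OF conjugate_subgroup[OF a H] conjugate_set_closed[OF b K]]
      card_conjugate[OF a HG] card_subgroup_pos[OF H] by simp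
qed

lemma coset_mark_cong:
  assumes "subgroup H G" "subgroup H' G" "K \<subseteq> carrier G" "K' \<subseteq> carrier G"
    and "conj_class G H = conj_class G H'" "conj_class G K = conj_class G K'"
  shows "coset_mark G H K = coset_mark G H' K'"
proof -
  obtain a where "a \<in> carrier G" "H' = conjugate G a ` H"
    using assms(5) unfolding conj_class_eq_iff[OF subgroup.subset[OF assms(1)] subgroup.subset[OF assms(2)]] by auto
  moreover obtain b where "b \<in> carrier G" "K' = conjugate G b ` K"
    using assms(6) unfolding conj_class_eq_iff[OF assms(3,4)] by auto
  ultimately show ?thesis using coset_mark_conjugate[OF assms(1,3)] by simp
qed

lemma mark_cong:
  assumes "K \<subseteq> carrier G" "K' \<subseteq> carrier G" "conj_class G K = conj_class G K'"
  shows "mark G K f = mark G K' f"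
  unfolding mark_coset_mark
  using coset_mark_cong[OF crep_subgroup(1) crep_subgroup(1) assms(1,2) refl assms(3)] by simp

text \<open>A nonzero mark means that a conjugate of \<open>K\<close> lies in \<open>H\<close>. This
  makes the table of marks triangular with respect to the order of subgroups; both
  \<open>mark_inject\<close> and \<open>exists_dual_marks\<close> rest on it.\<close>

lemma coset_mark_nonzero_card:
  assumes H: "subgroup H G" and K: "subgroup K G" and nz: "coset_mark G H K \<noteq> 0"
  shows "card K \<le> card H" "card H \<le> card K \<Longrightarrow> conj_class G K = conj_class G H"
proof -
  have KG: "K \<subseteq> carrier G" and HG: "H \<subseteq> carrier G" using H K subgroup.subset by auto
  obtain a where a: "a \<in> carrier G" "conjugate G a ` K \<subseteq> H"
    using nz coset_mark_nonzero_iff[OF H KG] by auto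
  have fin: "finite H" using HG by (rule finite_subset_carrier)
  show "card K \<le> card H" using card_mono[OF fin a(2)] card_conjugate[OF a(1) KG] by simp
  assume "card H \<le> card K"
  then have "conjugate G a ` K = H" using card_seteq[OF fin a(2)] card_conjugate[OF a(1) KG] by simp
  then show "conj_class G K = conj_class G H" using conj_class_conjugate[OF a(1) KG] by simp
qed

lemma coset_mark_self: "subgroup H G \<Longrightarrow> coset_mark G H H \<noteq> 0"
  using coset_mark_nonzero_iff[OF _ subgroup.subset, of H H] conjugate_set_one[OF subgroup.subset, of H]
  by (metis one_closed order_refl)

lemma mark_inject:
  fixes f h :: "'a set set \<Rightarrow> rat"
  assumes f: "f \<in> carrier (burnside_ring G)" and h: "h \<in> carrier (burnside_ring G)"
    and eq: "\<And>K. subgroup K G \<Longrightarrow> mark G K f = mark G K h"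
  shows "f = h"
proof (rule ccontr)
  assume "f \<noteq> h"
  define d where "d = (\<lambda>A. f A + (-1) * h A)"
  let ?S = "{A \<in> sub_classes G. d A \<noteq> 0}"
  have d0: "mark G K d = 0" if "subgroup K G" for K
    unfolding d_def mark_add mark_scale using eq[OF that] by simp
  have "?S \<noteq> {}"
  proof
    assume "?S = {}"
    then have "f A = h A" for A using f h by (cases "A \<in> sub_classes G") (auto simp: d_def burnside_ring_def)
    then show False using \<open>f \<noteq> h\<close> by auto
  qed
  moreover have fin: "finite ?S" using finite_sub_classes[OF finite_carrier] by simp
  \<comment> \<open>Extremal choice: \<open>A\<close> has a representative of maximal order among
    the classes where \<open>d\<close> does not vanish. In the mark at this subgroup, classes of
    larger order have coefficient zero and all others except \<open>A\<close> have mark zero, so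
    only the diagonal term is left.\<close>
  ultimately have "Max ((\<lambda>B. card (crep B)) ` ?S) \<in> (\<lambda>B. card (crep B)) ` ?S" by (intro Max_in) auto
  then obtain A where A: "A \<in> ?S" "Max ((\<lambda>B. card (crep B)) ` ?S) = card (crep A)" by auto
  have max: "card (crep B) \<le> card (crep A)" if "B \<in> ?S" for B
    unfolding A(2)[symmetric] using that fin by (intro Max_ge) auto
  have subA: "subgroup (crep A) G" using A crep_subgroup by auto
  have "mark G (crep A) d = (\<Sum>B\<in>{A}. d B * of_nat (coset_mark G (crep B) (crep A)))"
    unfolding mark_coset_mark
  proof (rule sum.mono_neutral_right)
    show "finite (sub_classes G)" using finite_sub_classes[OF finite_carrier] .
    show "{A} \<subseteq> sub_classes G" using A by auto
    show "\<forall>B\<in>sub_classes G - {A}. d B * of_nat (coset_mark G (crep B) (crep A)) = 0"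
    proof
      fix B assume B: "B \<in> sub_classes G - {A}"
      show "d B * of_nat (coset_mark G (crep B) (crep A)) = 0"
      proof (rule ccontr)
        assume nz: "d B * of_nat (coset_mark G (crep B) (crep A)) \<noteq> 0"
        then have "card (crep B) \<le> card (crep A)" using max B by simp
        then have "conj_class G (crep A) = conj_class G (crep B)"
          using coset_mark_nonzero_card(2)[OF _ subA, of "crep B"] nz B crep_subgroup(1) by auto
        then show False using A B crep_subgroup(2) by auto
      qed
    qed
  qed
  then have "d A * of_nat (coset_mark G (crep A) (crep A)) = 0" using d0[OF subA] by simp
  then show False using A coset_mark_self[OF subA] by simp
qed

end

section \<open>Fixed points of finite G-sets\<close>

context group_action
begin

lemma stabilizer_conjugate:
  assumes g: "g \<in> carrier G" and x: "x \<in> E"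
  shows "stabilizer G \<phi> (\<phi> g x) = conjugate G g ` stabilizer G \<phi> x"
proof -
  interpret group G using group_hom group_hom.axioms(1) by auto
  have *: "conjugate G g h \<in> stabilizer G \<phi> (\<phi> g x)" if "h \<in> stabilizer G \<phi> x" "g \<in> carrier G" "x \<in> E" for g h x
  proof -
    have h: "h \<in> carrier G" "\<phi> h x = x" using that by (auto simp: stabilizer_def)
    have "\<phi> (conjugate G g h) (\<phi> g x) = \<phi> (conjugate G g h \<otimes> g) x"
      using h that by (simp add: composition_rule)
    also have "conjugate G g h \<otimes> g = g \<otimes> h" using h that by (simp add: conjugate_def m_assoc)
    also have "\<phi> (g \<otimes> h) x = \<phi> g x" using h that by (simp add: composition_rule)
    finally show ?thesis using h that by (simp add: stabilizer_def)
  qed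
  show ?thesis
  proof
    show "conjugate G g ` stabilizer G \<phi> x \<subseteq> stabilizer G \<phi> (\<phi> g x)" using *[OF _ g x] by auto
    show "stabilizer G \<phi> (\<phi> g x) \<subseteq> conjugate G g ` stabilizer G \<phi> x"
    proof
      fix k assume k: "k \<in> stabilizer G \<phi> (\<phi> g x)"
      then have kG: "k \<in> carrier G" by (simp add: stabilizer_def)
      have y: "\<phi> g x \<in> E" using element_image[OF g x refl] .
      have "\<phi> (inv g) (\<phi> g x) = x" using orbit_sym_aux[OF g x refl] .
      then have "conjugate G (inv g) k \<in> stabilizer G \<phi> x" using *[OF k _ y, of "inv g"] g by simp
      moreover have "k = conjugate G g (conjugate G (inv g) k)" using g kG by (simp add: conjugate_conjugate)
      ultimately show "k \<in> conjugate G g ` stabilizer G \<phi> x" by blast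
    qed
  qed
qed

text \<open>Acting on \<open>x\<close> sends the transporter onto the fixed points of the orbit,
  with fibres the left cosets of the stabilizer. Comparing sizes replaces an explicit isomorphism
  between the orbit and a coset space.\<close>

lemma card_fixed_points_orbit:
  assumes fin: "finite (carrier G)" and x: "x \<in> E" and K: "K \<subseteq> carrier G"
  shows "card {y \<in> orbit G \<phi> x. \<forall>k\<in>K. \<phi> k y = y} = coset_mark G (stabilizer G \<phi> x) K"
proof -
  interpret group G using group_hom group_hom.axioms(1) by auto
  interpret finite_group G by unfold_locales (rule fin)
  let ?H = "stabilizer G \<phi> x" and ?Y = "{y \<in> orbit G \<phi> x. \<forall>k\<in>K. \<phi> k y = y}"
  have H: "subgroup ?H G" using x by (rule stabilizer_subgroup)
  have mem: "g \<in> transporter G ?H K \<longleftrightarrow> \<phi> g x \<in> ?Y" if g: "g \<in> carrier G" for g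
  proof -
    have y: "\<phi> g x \<in> E" using element_image[OF g x refl] .
    have "conjugate G (inv g) k \<in> ?H \<longleftrightarrow> \<phi> k (\<phi> g x) = \<phi> g x" if "k \<in> carrier G" for k
    proof -
      have "\<phi> k (\<phi> g x) = \<phi> g x \<longleftrightarrow> k \<in> conjugate G g ` ?H"
        unfolding stabilizer_conjugate[OF g x, symmetric] using that by (simp add: stabilizer_def)
      also have "\<dots> \<longleftrightarrow> conjugate G (inv g) k \<in> conjugate G (inv g) ` conjugate G g ` ?H"
        using inj_on_image_mem_iff[OF inj_on_conjugate[of "inv g"] that conjugate_set_closed[OF g subgroup.subset[OF H]]] g by simp
      also have "conjugate G (inv g) ` conjugate G g ` ?H = ?H"
        using g subgroup.subset[OF H] by (rule conjugate_set_inv)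
      finally show ?thesis by simp
    qed
    then show ?thesis using g K by (auto simp: transporter_def orbit_def subset_iff)
  qed
  have fib: "card {g \<in> transporter G ?H K. \<phi> g x = y} = card ?H" if y: "y \<in> ?Y" for y
  proof -
    obtain a where a: "a \<in> carrier G" "y = \<phi> a x" using y by (auto simp: orbit_def)
    have "{g \<in> transporter G ?H K. \<phi> g x = y} = {g \<in> carrier G. \<phi> g x = \<phi> a x}"
    proof (rule Collect_cong)
      fix g
      have "g \<in> carrier G" if "g \<in> transporter G ?H K" using that by (rule subsetD[OF transporter_subset])
      moreover have "g \<in> transporter G ?H K" if "g \<in> carrier G" "\<phi> g x = y"
        unfolding mem[OF that(1)] that(2) by (rule y)
      ultimately show "(g \<in> transporter G ?H K \<and> \<phi> g x = y) = (g \<in> carrier G \<and> \<phi> g x = \<phi> a x)"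
        using a(2) by auto
    qed
    also have "\<dots> = (\<lambda>h. a \<otimes> h) ` ?H"
    proof (intro equalityI subsetI)
      fix g assume "g \<in> {g \<in> carrier G. \<phi> g x = \<phi> a x}"
      then have g: "g \<in> carrier G" "\<phi> g x = \<phi> a x" by auto
      have "\<phi> (inv a \<otimes> g) x = x"
        using g a x orbit_sym_aux[OF a(1) x refl] by (simp add: composition_rule)
      then have "inv a \<otimes> g \<in> ?H" using g a by (simp add: stabilizer_def)
      moreover have "g = a \<otimes> (inv a \<otimes> g)" using g a by (simp flip: m_assoc)
      ultimately show "g \<in> (\<lambda>h. a \<otimes> h) ` ?H" by (rule rev_image_eqI)
    next
      fix g assume "g \<in> (\<lambda>h. a \<otimes> h) ` ?H"
      then show "g \<in> {g \<in> carrier G. \<phi> g x = \<phi> a x}" using a x by (auto simp: stabilizer_def composition_rule)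
    qed
    finally show ?thesis using inj_on_g'[OF subgroup.subset[OF H] a(1)] by (simp add: card_image)
  qed
  have finT: "finite (transporter G ?H K)" by (rule finite_subset_carrier) (auto simp: transporter_def)
  have finY: "finite ?Y"
  proof (rule finite_subset)
    show "?Y \<subseteq> (\<lambda>g. \<phi> g x) ` carrier G" by (auto simp: orbit_def)
  qed (simp add: fin)
  have "card (transporter G ?H K) = (\<Sum>y\<in>?Y. card {g \<in> transporter G ?H K. \<phi> g x = y})"
  proof -
    have "(\<lambda>g. \<phi> g x) ` transporter G ?H K \<subseteq> ?Y"
    proof (rule image_subsetI)
      fix g assume g: "g \<in> transporter G ?H K"
      then have "g \<in> carrier G" by (rule subsetD[OF transporter_subset])
      then show "\<phi> g x \<in> ?Y" using g by (simp only: mem)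
    qed
    from sum.group[OF finT finY this, of "\<lambda>_. 1::nat"] show ?thesis by simp
  qed
  also have "\<dots> = card ?H * card ?Y" using fib by simp
  finally show ?thesis using card_transporter[OF H K] card_subgroup_pos[OF H] by simp
qed

text \<open>Each orbit contributes the mark of its stabilizer by
  \<open>card_fixed_points_orbit\<close>, and \<open>gset_class\<close> merely sorts the orbits by
  stabilizer class. So the formal mark of the class of a G-set is its true number of fixed
  points.\<close>

lemma sum_gset_class:
  assumes fin: "finite (carrier G)" and finE: "finite E" and K: "K \<subseteq> carrier G"
  shows "(\<Sum>C\<in>sub_classes G. gset_class G E \<phi> C * of_nat (coset_mark G (crep C) K)) =
    (of_nat (card {x \<in> E. \<forall>k\<in>K. \<phi> k x = x}) :: 'k::comm_ring_1)"
proof -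
  interpret group G using group_hom group_hom.axioms(1) by auto
  interpret finite_group G by unfold_locales (rule fin)
  let ?st = "\<lambda>x. stabilizer G \<phi> x"
  \<comment> \<open>The class of an orbit, read off at an arbitrary point; stabilizers along an
    orbit are conjugate, so the choice does not matter.\<close>
  define c where "c Y = conj_class G (?st (SOME y. y \<in> Y))" for Y
  let ?O = "orbits G E \<phi>"
  have OE: "\<Union>?O = E" by (rule orbits_coverture)
  have finO: "finite ?O" using finite_UnionD[of ?O] OE finE by simp
  have same: "conj_class G (?st y) = conj_class G (?st x)" if x: "x \<in> E" and y: "y \<in> orbit G \<phi> x" for x y
  proof -
    obtain g where g: "g \<in> carrier G" "y = \<phi> g x" using y by (auto simp: orbit_def)
    then show ?thesis
      using stabilizer_conjugate[OF g(1) x] conj_class_conjugate[OF g(1) stabilizer_subset] by simp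
  qed
  have cY: "c Y = conj_class G (?st y)" if Y: "Y \<in> ?O" and y: "y \<in> Y" for Y y
  proof -
    obtain x where x: "x \<in> E" "Y = orbit G \<phi> x" using Y by (auto simp: orbits_def)
    have "(SOME y. y \<in> Y) \<in> Y" using y by (rule someI)
    then show ?thesis using same[OF x(1)] x(2) y by (simp add: c_def)
  qed
  have ne: "\<exists>y. y \<in> Y \<and> y \<in> E" if "Y \<in> ?O" for Y
    using that orbit_refl by (auto simp: orbits_def)
  have c_sub: "c ` ?O \<subseteq> sub_classes G"
  proof (rule image_subsetI)
    fix Y assume Y: "Y \<in> ?O"
    then obtain y where y: "y \<in> Y" "y \<in> E" using ne by blast
    show "c Y \<in> sub_classes G"
      unfolding cY[OF Y y(1)] by (rule conj_class_in_sub_classes[OF stabilizer_subgroup[OF y(2)]])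
  qed
  have fixY: "card {y \<in> Y. \<forall>k\<in>K. \<phi> k y = y} = coset_mark G (crep (c Y)) K" if Y: "Y \<in> ?O" for Y
  proof -
    obtain x where x: "x \<in> E" "Y = orbit G \<phi> x" using Y by (auto simp: orbits_def)
    have C: "c Y = conj_class G (?st x)" using cY[OF Y] orbit_refl x by auto
    have mem: "c Y \<in> sub_classes G" using c_sub Y by auto
    have "coset_mark G (?st x) K = coset_mark G (crep (c Y)) K"
      using crep_subgroup[OF mem] C
      by (intro coset_mark_cong[OF stabilizer_subgroup[OF x(1)] _ K K]) simp_all
    then show ?thesis using card_fixed_points_orbit[OF fin x(1) K] x(2) by simp
  qed
  have gs: "gset_class G E \<phi> C = (\<Sum>Y\<in>{Y \<in> ?O. c Y = C}. 1 :: 'k)" for C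
  proof -
    have "{Y \<in> ?O. \<exists>y\<in>Y. conj_class G (?st y) = C} = {Y \<in> ?O. c Y = C}"
    proof (intro Collect_cong conj_cong refl)
      fix Y assume Y: "Y \<in> ?O"
      then obtain y where "y \<in> Y" using ne by blast
      then show "(\<exists>y\<in>Y. conj_class G (?st y) = C) = (c Y = C)" using cY[OF Y] by auto
    qed
    then show ?thesis by (simp add: gset_class_def)
  qed
  have "(\<Sum>C\<in>sub_classes G. gset_class G E \<phi> C * of_nat (coset_mark G (crep C) K)) =
      (\<Sum>C\<in>sub_classes G. \<Sum>Y\<in>{Y \<in> ?O. c Y = C}. of_nat (coset_mark G (crep (c Y)) K) :: 'k)"
    by (rule sum.cong) (simp_all add: gs)
  also have "\<dots> = (\<Sum>Y\<in>?O. of_nat (coset_mark G (crep (c Y)) K))"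
    by (rule sum.group[OF finO finite_sub_classes[OF fin] c_sub])
  also have "\<dots> = of_nat (\<Sum>Y\<in>?O. card {y \<in> Y. \<forall>k\<in>K. \<phi> k y = y})"
    using fixY by simp
  also have "(\<Sum>Y\<in>?O. card {y \<in> Y. \<forall>k\<in>K. \<phi> k y = y}) = card (\<Union>Y\<in>?O. {y \<in> Y. \<forall>k\<in>K. \<phi> k y = y})"
  proof (rule card_UN_disjoint[symmetric, OF finO])
    show "\<forall>Y\<in>?O. finite {y \<in> Y. \<forall>k\<in>K. \<phi> k y = y}"
    proof
      fix Y assume "Y \<in> ?O"
      then have "{y \<in> Y. \<forall>k\<in>K. \<phi> k y = y} \<subseteq> \<Union>?O" by auto
      then show "finite {y \<in> Y. \<forall>k\<in>K. \<phi> k y = y}" unfolding OE using finE by (rule finite_subset)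
    qed
    show "\<forall>Y\<in>?O. \<forall>Z\<in>?O. Y \<noteq> Z \<longrightarrow> {y \<in> Y. \<forall>k\<in>K. \<phi> k y = y} \<inter> {y \<in> Z. \<forall>k\<in>K. \<phi> k y = y} = {}"
    proof (intro ballI impI)
      fix Y Z assume "Y \<in> ?O" "Z \<in> ?O" "Y \<noteq> Z"
      then have "Y \<inter> Z = {}" using disjoint_union[of Y Z] by simp
      then show "{y \<in> Y. \<forall>k\<in>K. \<phi> k y = y} \<inter> {y \<in> Z. \<forall>k\<in>K. \<phi> k y = y} = {}" by auto
    qed
  qed
  also have "(\<Union>Y\<in>?O. {y \<in> Y. \<forall>k\<in>K. \<phi> k y = y}) = {x \<in> E. \<forall>k\<in>K. \<phi> k x = x}"
  proof -
    have "x \<in> \<Union>?O \<longleftrightarrow> (\<exists>Y\<in>?O. x \<in> Y)" for x by simp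
    then have "x \<in> E \<longleftrightarrow> (\<exists>Y\<in>?O. x \<in> Y)" for x unfolding OE .
    then show ?thesis by auto
  qed
  finally show ?thesis .
qed

end

section \<open>Multiplicativity of marks, idempotents and S2\<close>

context finite_group
begin

lemma lcosets_act:
  assumes H: "subgroup H G" and T: "T \<in> lcosets H"
  shows "g \<in> carrier G \<Longrightarrow> g <# T \<in> lcosets H"
    and "g \<in> carrier G \<Longrightarrow> h \<in> carrier G \<Longrightarrow> g <# (h <# T) = (g \<otimes> h) <# T"
    and "\<one> <# T = T"
proof -
  obtain a where a: "a \<in> carrier G" "T = a <# H" using T by (auto simp: LCOSETS_def)
  have TG: "T \<subseteq> carrier G" using a l_coset_subset_G[OF subgroup.subset[OF H]] by simp
  show "g <# T \<in> lcosets H" if "g \<in> carrier G"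
    using that a subgroup.subset[OF H] by (auto simp: LCOSETS_def lcos_m_assoc intro!: bexI[of _ "g \<otimes> a"])
  show "g <# (h <# T) = (g \<otimes> h) <# T" if "g \<in> carrier G" "h \<in> carrier G"
    using lcos_m_assoc[OF TG that] .
  show "\<one> <# T = T" using lcos_mult_one[OF TG] .
qed

lemma product_action:
  assumes H: "subgroup H G" and K: "subgroup K G"
  shows "group_action G ((lcosets H) \<times> (lcosets K))
    (\<lambda>g. \<lambda>(T, U)\<in>(lcosets H) \<times> (lcosets K). (g <# T, g <# U))"
proof -
  let ?E = "(lcosets H) \<times> (lcosets K)" and ?f = "\<lambda>g. \<lambda>(T, U)\<in>(lcosets H) \<times> (lcosets K). (g <# T, g <# U)"
  note act = lcosets_act[OF H] lcosets_act[OF K]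
  have maps: "?f g ` ?E \<subseteq> ?E" if "g \<in> carrier G" for g
    using that act(1,4) by auto
  have inverse: "\<forall>x\<in>?E. ?f (inv g) (?f g x) = x" if "g \<in> carrier G" for g
    using that act by auto
  have "bij_betw (?f g) ?E ?E" if g: "g \<in> carrier G" for g
    using maps[OF g] maps[OF inv_closed[OF g]] inverse[OF g] inverse[OF inv_closed[OF g]] g
    by (intro bij_betw_byWitness[where f' = "?f (inv g)"]) auto
  then have Bij: "?f g \<in> Bij ?E" if "g \<in> carrier G" for g
    using that by (simp add: Bij_def)
  have "?f \<in> hom G (BijGroup ?E)"
  proof (rule homI)
    show "?f g \<in> carrier (BijGroup ?E)" if "g \<in> carrier G" for g
      using Bij[OF that] by (simp add: BijGroup_def)
    show "?f (g \<otimes> h) = ?f g \<otimes>\<^bsub>BijGroup ?E\<^esub> ?f h" if "g \<in> carrier G" "h \<in> carrier G" for g h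
      using that act Bij by (auto simp: BijGroup_def compose_def fun_eq_iff restrict_def)
  qed
  then show ?thesis
    by (simp add: group_action_def group_hom_def group_hom_axioms_def group_BijGroup)
qed

text \<open>A point of a product of two coset spaces is fixed exactly if both coordinates are, so
  marks multiply on basis elements; the general case follows as the product is bilinear by
  definition.\<close>

lemma mark_mult:
  assumes K: "K \<subseteq> carrier G"
  shows "mark G K (f \<otimes>\<^bsub>burnside_ring G\<^esub> h) = mark G K f * mark G K (h :: 'a set set \<Rightarrow> 'k::comm_ring_1)"
proof -
  let ?E = "\<lambda>A B. (lcosets (crep A)) \<times> (lcosets (crep B))"
  let ?f = "\<lambda>A B g. \<lambda>(T, U)\<in>?E A B. (g <# T, g <# U)"
  let ?m = "\<lambda>A. of_nat (coset_mark G (crep A) K) :: 'k"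
  let ?S = "sub_classes G"
  have fix_prod: "(\<Sum>C\<in>?S. gset_class G (?E A B) (?f A B) C * ?m C) = ?m A * ?m B"
    if A: "A \<in> ?S" and B: "B \<in> ?S" for A B
  proof -
    interpret group_action G "?E A B" "?f A B"
      using product_action[OF crep_subgroup(1)[OF A] crep_subgroup(1)[OF B]] .
    have "finite (lcosets (crep C))" if "C \<in> ?S" for C
      using finite_subset[OF lcosets_subset_PowG[OF crep_subgroup(1)[OF that]]] finite_carrier by simp
    then have fin: "finite (?E A B)" using A B by simp
    have "{x \<in> ?E A B. \<forall>k\<in>K. ?f A B k x = x} =
        {T \<in> lcosets (crep A). \<forall>k\<in>K. coset_action G (crep A) k T = T} \<times>
        {T \<in> lcosets (crep B). \<forall>k\<in>K. coset_action G (crep B) k T = T}"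
      by (auto simp: coset_action_def)
    then show ?thesis
      using sum_gset_class[OF finite_carrier fin K, where 'k = 'k]
      by (simp add: coset_mark_def card_cartesian_product)
  qed
  have "mark G K (f \<otimes>\<^bsub>burnside_ring G\<^esub> h) =
      (\<Sum>C\<in>?S. \<Sum>A\<in>?S. \<Sum>B\<in>?S. f A * h B * (gset_class G (?E A B) (?f A B) C * ?m C))"
    by (simp add: mark_coset_mark burnside_ring_def sum_distrib_right mult.assoc)
  \<comment> \<open>Moving the sum over \<open>C\<close> innermost isolates the mark of a single
    product of coset spaces, which \<open>fix_prod\<close> evaluates.\<close>
  also have "\<dots> = (\<Sum>A\<in>?S. \<Sum>C\<in>?S. \<Sum>B\<in>?S. f A * h B * (gset_class G (?E A B) (?f A B) C * ?m C))"
    by (rule sum.swap)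
  also have "\<dots> = (\<Sum>A\<in>?S. \<Sum>B\<in>?S. \<Sum>C\<in>?S. f A * h B * (gset_class G (?E A B) (?f A B) C * ?m C))"
    by (intro sum.cong refl sum.swap)
  also have "\<dots> = (\<Sum>A\<in>?S. \<Sum>B\<in>?S. f A * h B * (?m A * ?m B))"
    by (intro sum.cong refl) (simp add: fix_prod flip: sum_distrib_left)
  also have "\<dots> = (\<Sum>A\<in>?S. f A * ?m A) * (\<Sum>B\<in>?S. h B * ?m B)"
    by (simp add: sum_product mult_ac)
  finally show ?thesis by (simp add: mark_coset_mark)
qed

text \<open>Stabilizers are subgroups, so no orbit has a class outside \<open>sub_classes G\<close>,
  and the structure constants vanish there.\<close>

lemma burnside_ring_mult_closed:
  "f \<otimes>\<^bsub>burnside_ring G\<^esub> h \<in> carrier (burnside_ring G :: ('a set set \<Rightarrow> 'k::comm_ring_1) ring)"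
proof -
  have "gset_class G E \<phi> C = (0::'k)" if C: "C \<notin> sub_classes G" and act: "group_action G E \<phi>" for C \<phi>
    and E :: "('a set \<times> 'a set) set"
  proof -
    have "{Y \<in> orbits G E \<phi>. \<exists>y\<in>Y. conj_class G (stabilizer G \<phi> y) = C} = {}"
    proof -
      have "conj_class G (stabilizer G \<phi> y) \<noteq> C" if "Y \<in> orbits G E \<phi>" "y \<in> Y" for Y y
      proof -
        have "y \<in> E" using that group_action.orbits_coverture[OF act] by auto
        then have "conj_class G (stabilizer G \<phi> y) \<in> sub_classes G"
          by (rule conj_class_in_sub_classes[OF group_action.stabilizer_subgroup[OF act]])
        then show ?thesis using C by auto
      qed
      then show ?thesis by auto
    qed
    then show ?thesis unfolding gset_class_def by (simp only: card.empty of_nat_0)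
  qed
  then show ?thesis
    using product_action[OF crep_subgroup(1) crep_subgroup(1)] by (simp add: burnside_ring_def)
qed

text \<open>Inverts the table of marks by induction on the order of \<open>H\<close>: the marks of
  [G/H] at smaller subgroups are removed with the elements already found, and the result is
  normalized by the mark at \<open>H\<close>. This division is where rational coefficients come
  in.\<close>

lemma exists_dual_marks:
  assumes "subgroup H G"
  shows "\<exists>e\<in>carrier (burnside_ring G :: ('a set set \<Rightarrow> rat) ring).
    \<forall>K. subgroup K G \<longrightarrow> mark G K e = (if conj_class G K = conj_class G H then 1 else 0)"
  using assms
proof (induction "card H" arbitrary: H rule: less_induct)
  case less
  let ?S = "{D \<in> sub_classes G. card (crep D) < card H}"
  let ?R = "burnside_ring G :: ('a set set \<Rightarrow> rat) ring"
  have HG: "H \<subseteq> carrier G" using less.prems by (rule subgroup.subset)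
  have "\<forall>D\<in>?S. \<exists>e. e \<in> carrier ?R \<and> (\<forall>K. subgroup K G \<longrightarrow> mark G K e = (if conj_class G K = D then 1 else 0))"
  proof
    fix D assume D: "D \<in> ?S"
    then have "D \<in> sub_classes G" "card (crep D) < card H" by auto
    from less.hyps[OF this(2) crep_subgroup(1)[OF this(1)], unfolded crep_subgroup(2)[OF this(1)]]
    show "\<exists>e. e \<in> carrier ?R \<and> (\<forall>K. subgroup K G \<longrightarrow> mark G K e = (if conj_class G K = D then 1 else 0))"
      unfolding Bex_def .
  qed
  from bchoice[OF this] obtain e where e: "\<And>D. D \<in> ?S \<Longrightarrow> e D \<in> carrier ?R"
    "\<And>D K. D \<in> ?S \<Longrightarrow> subgroup K G \<Longrightarrow> mark G K (e D) = (if conj_class G K = D then 1 else 0)"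
    by auto
  let ?m = "\<lambda>K. of_nat (coset_mark G H K) :: rat"
  define b where "b = (\<lambda>C. if C = conj_class G H then 1 else (0::rat))"
  define u where "u = (\<lambda>A. (1 / ?m H) * (b A + (-1) * (\<Sum>D\<in>?S. ?m (crep D) * e D A)))"
  have fin: "finite ?S" using finite_sub_classes[OF finite_carrier] by simp
  have cH: "conj_class G H \<in> sub_classes G" using less.prems by (rule conj_class_in_sub_classes)
  have m_crep: "coset_mark G (crep (conj_class G H)) K = coset_mark G H K" if "K \<subseteq> carrier G" for K
    using that crep_subgroup[OF cH] less.prems by (intro coset_mark_cong) simp_all
  have mark_b: "mark G K b = ?m K" if "K \<subseteq> carrier G" for K
  proof -
    have "mark G K b = (\<Sum>A\<in>sub_classes G. if A = conj_class G H then ?m K else 0)"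
      unfolding mark_coset_mark b_def using m_crep[OF that] by (intro sum.cong) auto
    then show ?thesis using cH finite_sub_classes[OF finite_carrier] by simp
  qed
  have "mark G K u = (if conj_class G K = conj_class G H then 1 else 0)" if K: "subgroup K G" for K
  proof -
    have KG: "K \<subseteq> carrier G" using K by (rule subgroup.subset)
    have "mark G K u = (1 / ?m H) * (?m K - (\<Sum>D\<in>?S. ?m (crep D) * mark G K (e D)))"
      unfolding u_def mark_scale mark_add mark_sum[OF fin] mark_b[OF KG] by simp
    also have "(\<Sum>D\<in>?S. ?m (crep D) * mark G K (e D)) = (\<Sum>D\<in>?S. if D = conj_class G K then ?m (crep D) else 0)"
      by (intro sum.cong) (auto simp: e(2)[OF _ K])
    also have "\<dots> = (if card K < card H then ?m K else 0)"
    proof -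
      have cK: "conj_class G K \<in> sub_classes G" using K by (rule conj_class_in_sub_classes)
      have "card (crep (conj_class G K)) = card K"
        using crep_subgroup(2)[OF cK] by (intro card_conj_class_cong KG subgroup.subset[OF crep_subgroup(1)[OF cK]])
      moreover have "coset_mark G H (crep (conj_class G K)) = coset_mark G H K"
        using crep_subgroup(2)[OF cK]
        by (intro coset_mark_cong KG less.prems refl subgroup.subset[OF crep_subgroup(1)[OF cK]])
      ultimately show ?thesis using fin cK by simp
    qed
    \<comment> \<open>If \<open>K\<close> is smaller than \<open>H\<close>, the correction cancels
      its mark. Otherwise triangularity leaves a nonzero mark only for conjugates of
      \<open>H\<close>, where the quotient is 1.\<close>
    also have "(1 / ?m H) * (?m K - (if card K < card H then ?m K else 0)) =
        (if conj_class G K = conj_class G H then 1 else 0)"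
    proof (cases "conj_class G K = conj_class G H")
      case True
      have "card K = card H" using card_conj_class_cong[OF KG HG True] .
      moreover have "coset_mark G H K = coset_mark G H H"
        using less.prems KG HG True by (intro coset_mark_cong) auto
      ultimately show ?thesis using True coset_mark_self[OF less.prems] by simp
    next
      case False
      then show ?thesis using coset_mark_nonzero_card(2)[OF less.prems K] by auto
    qed
    finally show ?thesis .
  qed
  moreover have "u \<in> carrier ?R"
    using e(1) cH by (auto simp: burnside_ring_def u_def b_def)
  ultimately show ?case by blast
qed

text \<open>\<open>burnside_idem\<close> is a definite description, so an element with the right
  marks must be shown primitive and unique. Uniqueness is \<open>mark_inject\<close>; primitivity
  holds because two orthogonal summands cannot both have a nonzero mark at \<open>H\<close>.\<close>

lemma burnside_idem_marks:
  assumes H: "subgroup H G"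
  shows "burnside_idem G H \<in> carrier (burnside_ring G)"
    and "\<And>K. subgroup K G \<Longrightarrow> mark G K (burnside_idem G H) = (if conj_class G K = conj_class G H then 1 else 0)"
proof -
  let ?R = "burnside_ring G :: ('a set set \<Rightarrow> rat) ring"
  obtain e where e: "e \<in> carrier ?R"
    "\<And>K. subgroup K G \<Longrightarrow> mark G K e = (if conj_class G K = conj_class G H then 1 else 0)"
    using exists_dual_marks[OF H] by auto
  have zero: "\<zero>\<^bsub>?R\<^esub> \<in> carrier ?R" "mark G K \<zero>\<^bsub>?R\<^esub> = 0" for K
    by (simp_all add: burnside_ring_def mark_def)
  have prim: "primitive_idempotent ?R e"
    unfolding primitive_idempotent_def
  proof (intro conjI ballI impI)
    show "e \<in> carrier ?R" by fact
    show "e \<noteq> \<zero>\<^bsub>?R\<^esub>" using e(2)[OF H] zero(2)[of H] by auto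
    show "e \<otimes>\<^bsub>?R\<^esub> e = e"
      by (rule mark_inject[OF burnside_ring_mult_closed e(1)]) (auto simp: mark_mult subgroup.subset e(2))
    fix a b assume ab: "a \<in> carrier ?R" "b \<in> carrier ?R"
      and *: "a \<otimes>\<^bsub>?R\<^esub> a = a \<and> b \<otimes>\<^bsub>?R\<^esub> b = b \<and> a \<otimes>\<^bsub>?R\<^esub> b = \<zero>\<^bsub>?R\<^esub> \<and> b \<otimes>\<^bsub>?R\<^esub> a = \<zero>\<^bsub>?R\<^esub> \<and> e = a \<oplus>\<^bsub>?R\<^esub> b"
    have prod: "mark G K a * mark G K b = 0" if "subgroup K G" for K
      using * zero(2)[of K] mark_mult[OF subgroup.subset[OF that], of a b] by simp
    have sum: "mark G K a + mark G K b = mark G K e" for K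
      using * mark_add[of G K a b] by (simp add: burnside_ring_def)
    \<comment> \<open>Away from the class of \<open>H\<close> both marks are zero, because their sum
      and their product are. A summand whose mark at \<open>H\<close> vanishes as well is therefore
      zero.\<close>
    have vanish: "f = \<zero>\<^bsub>?R\<^esub>" if f: "f \<in> carrier ?R" "f = a \<or> f = b" and fH: "mark G H f = 0" for f
    proof (rule mark_inject[OF f(1) zero(1)])
      fix K assume K: "subgroup K G"
      show "mark G K f = mark G K \<zero>\<^bsub>?R\<^esub>"
      proof (cases "conj_class G K = conj_class G H")
        case True
        then show ?thesis
          using mark_cong[OF subgroup.subset[OF K] subgroup.subset[OF H] True, of f] fH zero(2) by simp
      next
        case False
        then have "mark G K a + mark G K b = 0" using sum e(2)[OF K] by simp
        then show ?thesis using prod[OF K] f(2) zero(2) by auto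
      qed
    qed
    show "a = \<zero>\<^bsub>?R\<^esub> \<or> b = \<zero>\<^bsub>?R\<^esub>"
      using prod[OF H] vanish[OF ab(1)] vanish[OF ab(2)] by auto
  qed
  have unique: "e' = e" if "primitive_idempotent ?R e'"
    "\<forall>K. subgroup K G \<longrightarrow> mark G K e' = (if conj_class G K = conj_class G H then 1 else 0)" for e'
  proof (rule mark_inject[OF _ e(1)])
    show "e' \<in> carrier ?R" using that(1) unfolding primitive_idempotent_def by (elim conjE)
    show "mark G K e' = mark G K e" if "subgroup K G" for K
      using \<open>\<forall>K. subgroup K G \<longrightarrow> _ K\<close> e(2) that by simp
  qed
  have "burnside_idem G H = e"
    unfolding burnside_idem_def
  proof (rule the_equality)
    show "primitive_idempotent ?R e \<and>
        (\<forall>K. subgroup K G \<longrightarrow> mark G K e = (if conj_class G K = conj_class G H then 1 else 0))"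
      using prim e(2) by (intro conjI allI impI)
  qed (elim conjE, rule unique)
  then show "burnside_idem G H \<in> carrier ?R"
    and "\<And>K. subgroup K G \<Longrightarrow> mark G K (burnside_idem G H) = (if conj_class G K = conj_class G H then 1 else 0)"
    using e by simp_all
qed

lemma burnside_idem_sum_marks:
  assumes S: "S \<subseteq> sub_classes G"
  shows "burnside_idem_sum G S \<in> carrier (burnside_ring G)"
    and "subgroup K G \<Longrightarrow> mark G K (burnside_idem_sum G S) = (if conj_class G K \<in> S then 1 else 0)"
proof -
  have fin: "finite S" using S finite_sub_classes[OF finite_carrier] finite_subset by blast
  show "burnside_idem_sum G S \<in> carrier (burnside_ring G)"
    using burnside_idem_marks(1)[OF crep_subgroup(1)] S
    by (auto simp: burnside_idem_sum_def burnside_ring_def subset_iff)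
  assume K: "subgroup K G"
  have "mark G K (burnside_idem_sum G S) = (\<Sum>C\<in>S. mark G K (burnside_idem G (crep C)))"
    unfolding burnside_idem_sum_def by (rule mark_sum[OF fin])
  also have "\<dots> = (\<Sum>C\<in>S. if C = conj_class G K then 1 else 0)"
    using burnside_idem_marks(2)[OF crep_subgroup(1) K] crep_subgroup(2) S
    by (intro sum.cong refl) (simp add: subset_iff eq_commute)
  finally show "mark G K (burnside_idem_sum G S) = (if conj_class G K \<in> S then 1 else 0)"
    using fin by simp
qed

text \<open>Marks separate rational elements, so twice the idempotent of \<open>S\<close> equals an
  integral \<open>z\<close> exactly if \<open>z\<close> has mark 2 on \<open>S\<close> and 0
  elsewhere. This removes idempotents and rational coefficients from all later arguments.\<close>

lemma S2_iff:
  "x \<in> S2 G \<longleftrightarrow> x \<in> carrier (V_space G) \<and>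
    (\<exists>z\<in>carrier (burnside_ring G :: ('a set set \<Rightarrow> int) ring).
      \<forall>K. subgroup K G \<longrightarrow> mark G K z = (if x (conj_class G K) = 0 then 0 else 2))"
proof -
  have key: "(\<lambda>A. 2 * burnside_idem_sum G S A) = (\<lambda>A. of_int (z A)) \<longleftrightarrow>
      (\<forall>K. subgroup K G \<longrightarrow> mark G K z = (if conj_class G K \<in> S then 2 else 0))"
    if S: "S \<subseteq> ncc_classes G" and z: "z \<in> carrier (burnside_ring G :: ('a set set \<Rightarrow> int) ring)" for S z
  proof -
    note idem = burnside_idem_sum_marks[OF order_trans[OF S ncc_classes_subset]]
    have mem: "(\<lambda>A. 2 * burnside_idem_sum G S A) \<in> carrier (burnside_ring G)"
      "(\<lambda>A. of_int (z A)) \<in> carrier (burnside_ring G :: ('a set set \<Rightarrow> rat) ring)"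
      using idem(1) z by (auto simp: burnside_ring_def)
    have "(\<lambda>A. 2 * burnside_idem_sum G S A) = (\<lambda>A. of_int (z A)) \<longleftrightarrow>
        (\<forall>K. subgroup K G \<longrightarrow> 2 * mark G K (burnside_idem_sum G S) = of_int (mark G K z))"
    proof
      assume eq: "(\<lambda>A. 2 * burnside_idem_sum G S A) = (\<lambda>A. of_int (z A))"
      show "\<forall>K. subgroup K G \<longrightarrow> 2 * mark G K (burnside_idem_sum G S) = of_int (mark G K z)"
        unfolding mark_scale[symmetric] mark_of_int[symmetric] eq by simp
    next
      assume "\<forall>K. subgroup K G \<longrightarrow> 2 * mark G K (burnside_idem_sum G S) = of_int (mark G K z)"
      then show "(\<lambda>A. 2 * burnside_idem_sum G S A) = (\<lambda>A. of_int (z A))"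
        by (intro mark_inject[OF mem]) (simp add: mark_scale mark_of_int)
    qed
    also have "\<dots> \<longleftrightarrow> (\<forall>K. subgroup K G \<longrightarrow> mark G K z = (if conj_class G K \<in> S then 2 else 0))"
    proof (intro all_cong1 imp_cong refl)
      fix K assume K: "subgroup K G"
      have "2 * mark G K (burnside_idem_sum G S) = rat_of_int (if conj_class G K \<in> S then 2 else 0)"
        using idem(2)[OF K] by simp
      then show "2 * mark G K (burnside_idem_sum G S) = of_int (mark G K z) \<longleftrightarrow>
          mark G K z = (if conj_class G K \<in> S then 2 else 0)"
        by (simp only: of_int_eq_iff) auto
    qed
    finally show ?thesis .
  qed
  show ?thesis
  proof
    assume "x \<in> S2 G"
    then obtain S z where S: "S \<subseteq> ncc_classes G" "x = (\<lambda>C. if C \<in> S then 1 else 0)"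
      and z: "z \<in> carrier (burnside_ring G :: ('a set set \<Rightarrow> int) ring)"
        "(\<lambda>A. 2 * burnside_idem_sum G S A) = (\<lambda>A. of_int (z A))"
      by (auto simp: S2_def)
    then show "x \<in> carrier (V_space G) \<and>
      (\<exists>z\<in>carrier (burnside_ring G :: ('a set set \<Rightarrow> int) ring).
        \<forall>K. subgroup K G \<longrightarrow> mark G K z = (if x (conj_class G K) = 0 then 0 else 2))"
      using key[OF S(1) z(1)] by (intro conjI bexI[of _ z]) (auto simp: V_space_def f2_functions_def)
  next
    assume R: "x \<in> carrier (V_space G) \<and>
      (\<exists>z\<in>carrier (burnside_ring G :: ('a set set \<Rightarrow> int) ring).
        \<forall>K. subgroup K G \<longrightarrow> mark G K z = (if x (conj_class G K) = 0 then 0 else 2))"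
    then obtain z where z: "z \<in> carrier (burnside_ring G :: ('a set set \<Rightarrow> int) ring)"
        "\<And>K. subgroup K G \<Longrightarrow> mark G K z = (if x (conj_class G K) = 0 then 0 else 2)" by auto
    let ?S = "{C. x C \<noteq> 0}"
    have S: "?S \<subseteq> ncc_classes G" using R by (auto simp: V_space_def f2_functions_def)
    have "x = (\<lambda>C. if C \<in> ?S then 1 else 0)" by (auto simp: fun_eq_iff)
    moreover have "(\<lambda>A. 2 * burnside_idem_sum G ?S A) = (\<lambda>A. of_int (z A))"
      unfolding key[OF S z(1)] using z(2) by auto
    ultimately show "x \<in> S2 G" unfolding S2_def using S z(1) by blast
  qed
qed

text \<open>Closure under addition: \<open>2e_S + 2e_T - (2e_S)(2e_T)\<close> is twice the idempotent of the symmetric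
  difference of \<open>S\<close> and \<open>T\<close>.\<close>

lemma S2_subgroup: "subgroup (S2 G) (add_monoid (V_space G))"
proof (rule group.subgroupI)
  let ?R = "burnside_ring G :: ('a set set \<Rightarrow> int) ring"
  have V: "f2_module (V_space G)" unfolding V_space_def by (rule f2_functions_module)
  interpret V: abelian_group "V_space G" using V by (rule f2_module_abelian_group)
  show "group (add_monoid (V_space G))" by (rule V.add.is_group)
  show "S2 G \<subseteq> carrier (add_monoid (V_space G))" by (auto simp: S2_iff)
  have "mark G K (\<lambda>C. 0 :: int) = 0" for K by (simp add: mark_def)
  then have "(\<lambda>C. 0) \<in> S2 G"
    unfolding S2_iff by (intro conjI bexI[of _ "\<lambda>C. 0"]) (simp_all add: V_space_def f2_functions_def burnside_ring_def)
  then show "S2 G \<noteq> {}" by auto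
  show "inv\<^bsub>add_monoid (V_space G)\<^esub> x \<in> S2 G" if x: "x \<in> S2 G" for x
  proof -
    have "x \<in> carrier (V_space G)" using x by (simp add: S2_iff)
    moreover have "x \<oplus>\<^bsub>V_space G\<^esub> x = \<zero>\<^bsub>V_space G\<^esub>" by (simp add: V_space_def f2_functions_def)
    ultimately have "inv\<^bsub>add_monoid (V_space G)\<^esub> x = x"
      using V.minus_equality[of x x] by (simp add: a_inv_def)
    then show ?thesis using x by simp
  qed
  show "x \<otimes>\<^bsub>add_monoid (V_space G)\<^esub> y \<in> S2 G" if x: "x \<in> S2 G" and y: "y \<in> S2 G" for x y
  proof -
    obtain u where u: "u \<in> carrier ?R" "\<And>K. subgroup K G \<Longrightarrow> mark G K u = (if x (conj_class G K) = 0 then 0 else 2)"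
      using x by (auto simp: S2_iff)
    obtain v where v: "v \<in> carrier ?R" "\<And>K. subgroup K G \<Longrightarrow> mark G K v = (if y (conj_class G K) = 0 then 0 else 2)"
      using y by (auto simp: S2_iff)
    define w where "w = (\<lambda>A. (u A + v A) + (-1) * (u \<otimes>\<^bsub>?R\<^esub> v) A)"
    have "w \<in> carrier ?R"
      using u(1) v(1) burnside_ring_mult_closed[of u v]
      by (auto simp: w_def burnside_ring_def simp del: mult_cancel_left1)
    moreover have "mark G K w = (if (x \<oplus>\<^bsub>V_space G\<^esub> y) (conj_class G K) = 0 then 0 else 2)" if K: "subgroup K G" for K
    proof -
      have "mark G K w = (mark G K u + mark G K v) + (-1) * (mark G K u * mark G K v)"
        unfolding w_def mark_add mark_scale mark_mult[OF subgroup.subset[OF K]] ..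
      then show ?thesis
        unfolding u(2)[OF K] v(2)[OF K]
        by (cases "x (conj_class G K)"; cases "y (conj_class G K)") (simp_all add: V_space_def f2_functions_def)
    qed
    moreover have "x \<oplus>\<^bsub>V_space G\<^esub> y \<in> carrier (V_space G)"
      using x y by (intro V.a_closed) (simp_all add: S2_iff)
    ultimately show ?thesis unfolding S2_iff by (intro conjI bexI[of _ w]) simp_all
  qed
qed

end

section \<open>Inflation and fixed points along an epimorphism\<close>

lemma V_space_module: "f2_module (V_space G)"
  unfolding V_space_def by (rule f2_functions_module)

lemma V_space_add: "x \<oplus>\<^bsub>V_space G\<^esub> y = (\<lambda>C. x C + y C)"
  by (simp add: V_space_def f2_functions_def)

lemma V_space_zero: "\<zero>\<^bsub>V_space G\<^esub> = (\<lambda>C. 0)"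
  by (simp add: V_space_def f2_functions_def)

lemma V_space_carrier: "x \<in> carrier (V_space G) \<longleftrightarrow> (\<forall>C. C \<notin> ncc_classes G \<longrightarrow> x C = 0)"
  by (simp add: V_space_def f2_functions_def)

locale finite_group_epi = group_epi G Q p for G (structure) and Q (structure) and p +
  assumes finite_G: "finite (carrier G)"
begin

sublocale fG: finite_group G
  by unfold_locales (rule finite_G)

sublocale fQ: finite_group Q
  by unfold_locales (use finite_G in \<open>simp flip: surj\<close>)

lemma preimage_image:
  assumes H: "subgroup H G" and ker: "kernel G Q p \<subseteq> H"
  shows "preimage G p (p ` H) = H"
proof (intro equalityI subsetI)
  fix g assume "g \<in> preimage G p (p ` H)"
  then obtain h where h: "g \<in> carrier G" "h \<in> H" "p g = p h" by (auto simp: preimage_def)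
  have hG: "h \<in> carrier G" using h subgroup.mem_carrier[OF H] by simp
  have "g \<otimes>\<^bsub>G\<^esub> inv\<^bsub>G\<^esub> h \<in> kernel G Q p" using h hG by (simp add: kernel_def)
  then have "g \<otimes>\<^bsub>G\<^esub> inv\<^bsub>G\<^esub> h \<otimes>\<^bsub>G\<^esub> h \<in> H" using ker h subgroup.m_closed[OF H] by blast
  then show "g \<in> H" using h hG by (simp add: G.m_assoc)
next
  fix h assume "h \<in> H"
  then show "h \<in> preimage G p (p ` H)" using subgroup.mem_carrier[OF H] by (simp add: preimage_def)
qed

lemma kernel_subset_preimage: "subgroup L Q \<Longrightarrow> kernel G Q p \<subseteq> preimage G p L"
  using subgroup.one_closed[of L Q] by (auto simp: kernel_def preimage_def)

lemma card_preimage: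
  assumes L: "L \<subseteq> carrier Q"
  shows "card (preimage G p L) = card (kernel G Q p) * card L"
proof -
  have fib: "card {g \<in> preimage G p L. p g = q} = card (kernel G Q p)" if q: "q \<in> L" for q
  proof -
    have "q \<in> p ` carrier G" using q L surj by auto
    then obtain a where a: "a \<in> carrier G" "q = p a" by auto
    have "{g \<in> preimage G p L. p g = q} = {g \<in> carrier G. p g = p a}"
      using q a by (auto simp: preimage_def)
    also have "\<dots> = (\<lambda>h. a \<otimes>\<^bsub>G\<^esub> h) ` kernel G Q p"
    proof (intro equalityI subsetI)
      fix g assume "g \<in> {g \<in> carrier G. p g = p a}"
      then have g: "g \<in> carrier G" "p g = p a" by auto
      have "inv\<^bsub>G\<^esub> a \<otimes>\<^bsub>G\<^esub> g \<in> kernel G Q p" using g a by (simp add: kernel_def)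
      moreover have "g = a \<otimes>\<^bsub>G\<^esub> (inv\<^bsub>G\<^esub> a \<otimes>\<^bsub>G\<^esub> g)" using g a by (simp flip: G.m_assoc)
      ultimately show "g \<in> (\<lambda>h. a \<otimes>\<^bsub>G\<^esub> h) ` kernel G Q p" by (rule rev_image_eqI)
    qed (use a in \<open>auto simp: kernel_def\<close>)
    finally show ?thesis
      using G.inj_on_g'[OF subgroup.subset[OF subgroup_kernel] a(1)] by (simp add: card_image)
  qed
  have fin: "finite (preimage G p L)" "finite L"
    using fG.finite_subset_carrier[OF preimage_subset] fQ.finite_subset_carrier[OF L] by auto
  have "p ` preimage G p L \<subseteq> L" by (auto simp: preimage_def)
  from sum.group[OF fin this, of "\<lambda>_. 1::nat"]
  have "card (preimage G p L) = (\<Sum>q\<in>L. card {g \<in> preimage G p L. p g = q})" by simp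
  then show ?thesis using fib by simp
qed

text \<open>The transporter upstairs is the preimage of the one downstairs. Both it and the preimage
  of \<open>L\<close> grow by the same factor, the order of the kernel, which cancels in the
  mark.\<close>

lemma coset_mark_preimage:
  assumes L: "subgroup L Q" and K: "K \<subseteq> carrier G"
  shows "coset_mark G (preimage G p L) K = coset_mark Q L (p ` K)"
proof -
  have LQ: "L \<subseteq> carrier Q" using L by (rule subgroup.subset)
  have ker: "card (kernel G Q p) > 0" by (rule fG.card_subgroup_pos[OF subgroup_kernel])
  have "transporter G (preimage G p L) K = preimage G p (transporter Q L (p ` K))"
    using K by (auto simp: transporter_def preimage_def p_conjugate subset_iff)
  then have "card (preimage G p L) * coset_mark G (preimage G p L) K =
      card (kernel G Q p) * card (transporter Q L (p ` K))"
    using fG.card_transporter[OF preimage_subgroup[OF L] K] card_preimage[OF transporter_subset] by simp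
  then have "card (kernel G Q p) * card L * coset_mark G (preimage G p L) K =
      card (kernel G Q p) * (card L * coset_mark Q L (p ` K))"
    using fQ.card_transporter[OF L image_closed[OF K]] card_preimage[OF LQ] by simp
  then show ?thesis using ker fQ.card_subgroup_pos[OF L] by simp
qed

text \<open>By \<open>ncc_of_image\<close>, a subgroup with non-core-cyclic image is itself
  non-core-cyclic. Hence the side conditions in \<open>Inf_V\<close> fail only where
  \<open>x\<close>, extended by zero, vanishes anyway, and the choice made by \<open>crep\<close>
  drops out.\<close>

lemma Inf_V_apply:
  assumes x: "x \<in> carrier (V_space Q)" and H: "subgroup H G"
  shows "Inf_V G Q p x (conj_class G H) = x (conj_class Q (p ` H))"
proof -
  let ?C = "conj_class G H"
  have C: "?C \<in> sub_classes G" using H by (rule G.conj_class_in_sub_classes)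
  note crep = G.crep_subgroup[OF C]
  have eq: "conj_class Q (p ` crep ?C) = conj_class Q (p ` H)"
    by (rule conj_class_p_cong[OF subgroup.subset[OF crep(1)] subgroup.subset[OF H] crep(2)])
  have "x (conj_class Q (p ` H)) = 0" if "?C \<notin> ncc_classes G \<or> p ` crep ?C \<notin> ncc_subgroups Q"
  proof -
    have "conj_class Q (p ` H) \<notin> ncc_classes Q"
    proof
      assume ncc: "conj_class Q (p ` H) \<in> ncc_classes Q"
      then have "p ` H \<in> ncc_subgroups Q" using H.ncc_conj_class_iff[OF image_subgroup[OF H]] by simp
      then have "?C \<in> ncc_classes G" using ncc_of_image[OF H] by (simp add: ncc_classes_def)
      moreover have "p ` crep ?C \<in> ncc_subgroups Q"
        using ncc H.ncc_conj_class_iff[OF image_subgroup[OF crep(1)]] eq by simp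
      ultimately show False using that by simp
    qed
    then show ?thesis using x by (simp add: V_space_carrier)
  qed
  then show ?thesis by (auto simp: Inf_V_def eq)
qed

text \<open>Outside \<open>ncc_classes Q\<close> the definition gives 0, and so does
  \<open>y\<close> at the preimage, since by \<open>ncc_of_preimage\<close> the preimage of a
  core-cyclic subgroup is core-cyclic.\<close>

lemma Fix_V_apply:
  assumes y: "y \<in> carrier (V_space G)" and L: "subgroup L Q"
  shows "Fix_V G Q p y (conj_class Q L) = y (conj_class G (preimage G p L))"
proof -
  let ?C = "conj_class Q L"
  have C: "?C \<in> sub_classes Q" using L by (rule H.conj_class_in_sub_classes)
  note crep = H.crep_subgroup[OF C]
  have eq: "conj_class G (preimage G p (crep ?C)) = conj_class G (preimage G p L)"
    by (rule conj_class_preimage_cong[OF subgroup.subset[OF crep(1)] subgroup.subset[OF L] crep(2)])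
  have "y (conj_class G (preimage G p L)) = 0" if "?C \<notin> ncc_classes Q"
  proof -
    have "preimage G p L \<notin> ncc_subgroups G"
      using that ncc_of_preimage[OF L] by (auto simp: ncc_classes_def)
    then show ?thesis
      using y G.ncc_conj_class_iff[OF preimage_subgroup[OF L]] by (simp add: V_space_carrier)
  qed
  then show ?thesis by (auto simp: Fix_V_def eq)
qed

lemma Inf_V_linear: "f2_linear (V_space Q) (V_space G) (Inf_V G Q p)"
  by (rule f2_linearI[OF V_space_module V_space_module])
    (auto simp: V_space_carrier V_space_add Inf_V_def)

lemma Fix_V_linear: "f2_linear (V_space G) (V_space Q) (Fix_V G Q p)"
  by (rule f2_linearI[OF V_space_module V_space_module])
    (auto simp: V_space_carrier V_space_add Fix_V_def)

lemma Fix_V_Inf_V: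
  assumes x: "x \<in> carrier (V_space Q)"
  shows "Fix_V G Q p (Inf_V G Q p x) = x"
proof
  fix C
  show "Fix_V G Q p (Inf_V G Q p x) C = x C"
  proof (cases "C \<in> ncc_classes Q")
    case False
    then show ?thesis using x by (simp add: V_space_carrier Fix_V_def)
  next
    case True
    then have C: "C \<in> sub_classes Q" using H.ncc_classes_subset by auto
    note crep = H.crep_subgroup[OF C]
    have "Fix_V G Q p (Inf_V G Q p x) C = Inf_V G Q p x (conj_class G (preimage G p (crep C)))"
      using True by (simp add: Fix_V_def)
    also have "\<dots> = x (conj_class Q (p ` preimage G p (crep C)))"
      by (rule Inf_V_apply[OF x preimage_subgroup[OF crep(1)]])
    finally show ?thesis using crep image_preimage[OF subgroup.subset[OF crep(1)]] by simp
  qed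
qed

text \<open>\<open>preimage_class\<close> is the map \<open>[Q/L] \<mapsto> [G/p\<inverse>(L)]\<close> of inflation on basis elements; its image
  consists of the orbits with a fixed point under the kernel.\<close>

definition preimage_class :: "'c set set \<Rightarrow> 'a set set" where
  "preimage_class A = conj_class G (preimage G p (crep A))"

lemma kernel_subset_conjugate_preimage:
  assumes a: "a \<in> carrier G" and L: "subgroup L Q"
  shows "kernel G Q p \<subseteq> conjugate G a ` preimage G p L"
  using kernel_subset_preimage[OF H.conjugate_subgroup[OF hom_closed[OF a] L]]
    preimage_conjugate[OF a subgroup.subset[OF L]] by simp

text \<open>The correspondence theorem passes to conjugacy classes, with images under
  \<open>p\<close> as inverse. The kernel is normal, so whether a subgroup contains it depends only
  on the class, and it may be tested on \<open>crep C\<close>.\<close>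

lemma bij_preimage_class:
  "bij_betw preimage_class (sub_classes Q) {C \<in> sub_classes G. kernel G Q p \<subseteq> crep C}"
  and conj_class_image_preimage_class: "A \<in> sub_classes Q \<Longrightarrow> conj_class Q (p ` crep (preimage_class A)) = A"
proof -
  have sub: "preimage_class A \<in> sub_classes G" if "A \<in> sub_classes Q" for A
    unfolding preimage_class_def
    by (rule G.conj_class_in_sub_classes[OF preimage_subgroup[OF H.crep_subgroup(1)[OF that]]])
  have ker: "kernel G Q p \<subseteq> crep (preimage_class A)" if A: "A \<in> sub_classes Q" for A
  proof -
    note L = H.crep_subgroup(1)[OF A]
    obtain a where "a \<in> carrier G" "crep (preimage_class A) = conjugate G a ` preimage G p (crep A)"
      unfolding preimage_class_def using G.crep_conj_class[OF preimage_subgroup[OF L]] .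
    then show ?thesis using kernel_subset_conjugate_preimage[OF _ L] by simp
  qed
  show inverse: "conj_class Q (p ` crep (preimage_class A)) = A" if A: "A \<in> sub_classes Q" for A
  proof -
    note L = H.crep_subgroup[OF A]
    have "conj_class Q (p ` crep (preimage_class A)) = conj_class Q (p ` preimage G p (crep A))"
      using G.crep_subgroup[OF sub[OF A]]
      by (intro conj_class_p_cong preimage_subset subgroup.subset[of _ G]) (simp_all add: preimage_class_def)
    then show ?thesis using L image_preimage[OF subgroup.subset[OF L(1)]] by simp
  qed
  show "bij_betw preimage_class (sub_classes Q) {C \<in> sub_classes G. kernel G Q p \<subseteq> crep C}"
  proof (rule bij_betw_byWitness[where f' = "\<lambda>C. conj_class Q (p ` crep C)"])
    show "\<forall>A\<in>sub_classes Q. conj_class Q (p ` crep (preimage_class A)) = A" using inverse by simp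
    show "preimage_class ` sub_classes Q \<subseteq> {C \<in> sub_classes G. kernel G Q p \<subseteq> crep C}"
      using sub ker by auto
    show "(\<lambda>C. conj_class Q (p ` crep C)) ` {C \<in> sub_classes G. kernel G Q p \<subseteq> crep C} \<subseteq> sub_classes Q"
      using H.conj_class_in_sub_classes[OF image_subgroup[OF G.crep_subgroup(1)]] by auto
    show "\<forall>C\<in>{C \<in> sub_classes G. kernel G Q p \<subseteq> crep C}. preimage_class (conj_class Q (p ` crep C)) = C"
    proof clarify
      fix C assume C: "C \<in> sub_classes G" "kernel G Q p \<subseteq> crep C"
      note K = G.crep_subgroup[OF C(1)]
      note pK = image_subgroup[OF K(1)]
      note L = H.crep_subgroup[OF H.conj_class_in_sub_classes[OF pK]]
      have "preimage_class (conj_class Q (p ` crep C)) = conj_class G (preimage G p (p ` crep C))"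
        unfolding preimage_class_def
        by (rule conj_class_preimage_cong[OF subgroup.subset[OF L(1)] subgroup.subset[OF pK] L(2)])
      then show "preimage_class (conj_class Q (p ` crep C)) = C"
        using preimage_image[OF K(1) C(2)] K(2) by simp
    qed
  qed
qed

lemma coset_mark_preimage_class:
  assumes A: "A \<in> sub_classes Q" and K: "K \<subseteq> carrier G"
  shows "coset_mark G (crep (preimage_class A)) K = coset_mark Q (crep A) (p ` K)"
proof -
  note L = H.crep_subgroup(1)[OF A]
  note C = G.crep_subgroup[OF G.conj_class_in_sub_classes[OF preimage_subgroup[OF L]]]
  have "coset_mark G (crep (preimage_class A)) K = coset_mark G (preimage G p (crep A)) K"
    unfolding preimage_class_def
    by (rule fG.coset_mark_cong[OF C(1) preimage_subgroup[OF L] K K C(2) refl])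
  then show ?thesis using coset_mark_preimage[OF L K] by simp
qed

text \<open>Classes not containing the kernel must contribute nothing. For inflation this holds
  because the coefficient vanishes there, for fixed points because the mark does; the remaining
  classes are reindexed by \<open>preimage_class\<close>.\<close>

lemma mark_eq_mark_image:
  assumes K: "K \<subseteq> carrier G"
    and zero: "\<And>C. C \<in> sub_classes G \<Longrightarrow> \<not> kernel G Q p \<subseteq> crep C \<Longrightarrow> f C * of_nat (coset_mark G (crep C) K) = 0"
  shows "mark G K f = mark Q (p ` K) (\<lambda>A. f (preimage_class A))"
proof -
  let ?S = "{C \<in> sub_classes G. kernel G Q p \<subseteq> crep C}"
  have "mark G K f = (\<Sum>C\<in>?S. f C * of_nat (coset_mark G (crep C) K))"
    unfolding mark_coset_mark using zero G.finite_sub_classes[OF finite_G] by (intro sum.mono_neutral_right) auto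
  also have "\<dots> = (\<Sum>A\<in>sub_classes Q. f (preimage_class A) * of_nat (coset_mark G (crep (preimage_class A)) K))"
    by (rule sum.reindex_bij_betw[OF bij_preimage_class, symmetric])
  also have "\<dots> = mark Q (p ` K) (\<lambda>A. f (preimage_class A))"
    unfolding mark_coset_mark using coset_mark_preimage_class[OF _ K] by simp
  finally show ?thesis .
qed

lemma Inf_V_S2:
  assumes x: "x \<in> S2 Q" shows "Inf_V G Q p x \<in> S2 G"
proof -
  have xV: "x \<in> carrier (V_space Q)" using x by (simp add: fQ.S2_iff)
  obtain z where z: "z \<in> carrier (burnside_ring Q :: ('c set set \<Rightarrow> int) ring)"
      "\<And>L. subgroup L Q \<Longrightarrow> mark Q L z = (if x (conj_class Q L) = 0 then 0 else 2)"
    using x by (auto simp: fQ.S2_iff)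
  \<comment> \<open>The inflated element: the coefficient of [Q/L] is moved to the class of the
    preimage of \<open>L\<close>, and all other coefficients are 0.\<close>
  define w where "w = (\<lambda>C. if C \<in> sub_classes G \<and> kernel G Q p \<subseteq> crep C then z (conj_class Q (p ` crep C)) else 0)"
  have w: "w (preimage_class A) = z A" if "A \<in> sub_classes Q" for A
    using bij_betw_apply[OF bij_preimage_class that] conj_class_image_preimage_class[OF that] by (simp add: w_def)
  have "mark G K w = (if Inf_V G Q p x (conj_class G K) = 0 then 0 else 2)" if K: "subgroup K G" for K
  proof -
    have "mark G K w = mark Q (p ` K) (\<lambda>A. w (preimage_class A))"
      by (rule mark_eq_mark_image[OF subgroup.subset[OF K]]) (simp add: w_def)
    also have "\<dots> = mark Q (p ` K) z" unfolding mark_coset_mark using w by simp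
    finally show ?thesis using z(2)[OF image_subgroup[OF K]] Inf_V_apply[OF xV K] by simp
  qed
  moreover have "w \<in> carrier (burnside_ring G)" by (auto simp: burnside_ring_def w_def)
  moreover have "Inf_V G Q p x \<in> carrier (V_space G)" using f2_linear_closed[OF Inf_V_linear xV] .
  ultimately show ?thesis unfolding fG.S2_iff by (intro conjI bexI[of _ w]) simp_all
qed

lemma Fix_V_S2:
  assumes y: "y \<in> S2 G" shows "Fix_V G Q p y \<in> S2 Q"
proof -
  have yV: "y \<in> carrier (V_space G)" using y by (simp add: fG.S2_iff)
  obtain z where z: "z \<in> carrier (burnside_ring G :: ('a set set \<Rightarrow> int) ring)"
      "\<And>K. subgroup K G \<Longrightarrow> mark G K z = (if y (conj_class G K) = 0 then 0 else 2)"
    using y by (auto simp: fG.S2_iff)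
  \<comment> \<open>The part of \<open>z\<close> fixed by the kernel: only the coefficients at
    classes containing the kernel are kept.\<close>
  define w where "w = (\<lambda>A. if A \<in> sub_classes Q then z (preimage_class A) else 0)"
  have "mark Q L w = (if Fix_V G Q p y (conj_class Q L) = 0 then 0 else 2)" if L: "subgroup L Q" for L
  proof -
    let ?K = "preimage G p L"
    have "mark G ?K z = mark Q (p ` ?K) (\<lambda>A. z (preimage_class A))"
    proof (rule mark_eq_mark_image[OF preimage_subset])
      fix C assume C: "C \<in> sub_classes G" "\<not> kernel G Q p \<subseteq> crep C"
      \<comment> \<open>Every conjugate of \<open>?K\<close> contains the kernel, so it cannot lie
        in a subgroup that does not.\<close>
      have "\<not> conjugate G a ` ?K \<subseteq> crep C" if "a \<in> carrier G" for a
        using kernel_subset_conjugate_preimage[OF that L] C(2) by (meson order_trans)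
      then have "coset_mark G (crep C) ?K = 0"
        using fG.coset_mark_nonzero_iff[OF G.crep_subgroup(1)[OF C(1)] preimage_subset] by blast
      then show "z C * of_nat (coset_mark G (crep C) ?K) = 0" by simp
    qed
    then have "mark Q L (\<lambda>A. z (preimage_class A)) = mark G ?K z"
      using image_preimage[OF subgroup.subset[OF L]] by simp
    moreover have "mark Q L w = mark Q L (\<lambda>A. z (preimage_class A))"
      unfolding mark_coset_mark by (simp add: w_def)
    ultimately show ?thesis using z(2)[OF preimage_subgroup[OF L]] Fix_V_apply[OF yV L] by simp
  qed
  moreover have "w \<in> carrier (burnside_ring Q)" by (auto simp: burnside_ring_def w_def)
  moreover have "Fix_V G Q p y \<in> carrier (V_space Q)" using f2_linear_closed[OF Fix_V_linear yV] .
  ultimately show ?thesis unfolding fQ.S2_iff by (intro conjI bexI[of _ w]) simp_all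
qed

end

section \<open>Defect spaces\<close>

lemma class_functions0_carrier:
  "f \<in> carrier (class_functions0 W) \<longleftrightarrow> (\<forall>x. x \<notin> carrier W \<longrightarrow> f x = 0) \<and> f \<one>\<^bsub>W\<^esub> = 0 \<and>
     (\<forall>x\<in>carrier W. \<forall>y\<in>carrier W. f (x \<otimes>\<^bsub>W\<^esub> y \<otimes>\<^bsub>W\<^esub> inv\<^bsub>W\<^esub> x) = f y)"
  by (simp add: class_functions0_def f2_functions_def)

lemma class_functions0_add: "f \<oplus>\<^bsub>class_functions0 W\<^esub> h = (\<lambda>x. f x + h x)"
  by (simp add: class_functions0_def f2_functions_def)

lemma class_functions0_zero: "\<zero>\<^bsub>class_functions0 W\<^esub> = (\<lambda>x. 0)"
  by (simp add: class_functions0_def f2_functions_def)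

lemma f2_homs_iff:
  "h \<in> f2_homs W \<longleftrightarrow> (\<forall>x. x \<notin> carrier W \<longrightarrow> h x = 0) \<and>
     (\<forall>x\<in>carrier W. \<forall>y\<in>carrier W. h (x \<otimes>\<^bsub>W\<^esub> y) = h x + h y)"
  by (simp add: f2_homs_def f2_functions_def)

lemma bit_add_eq_0_iff: "(a::bit) + b = 0 \<longleftrightarrow> a = b"
  by (cases a; cases b) simp_all

lemma bit_add_left_cancel: "(a::bit) + (a + b) = b"
  by (cases a; cases b) simp_all

lemma class_functions0_module: "f2_module (class_functions0 W)"
proof -
  have "comm_group (add_monoid (class_functions0 W))"
  proof (rule comm_groupI)
    fix x assume x: "x \<in> carrier (add_monoid (class_functions0 W))"
    then show "\<exists>y\<in>carrier (add_monoid (class_functions0 W)).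
        y \<otimes>\<^bsub>add_monoid (class_functions0 W)\<^esub> x = \<one>\<^bsub>add_monoid (class_functions0 W)\<^esub>"
      by (intro bexI[of _ x]) (simp_all add: class_functions0_add class_functions0_zero)
  qed (simp_all add: class_functions0_add class_functions0_zero class_functions0_carrier add_ac)
  moreover have "(0::bit) \<odot>\<^bsub>class_functions0 W\<^esub> f = \<zero>\<^bsub>class_functions0 W\<^esub> \<and> (1::bit) \<odot>\<^bsub>class_functions0 W\<^esub> f = f" for f
    by (simp add: class_functions0_def f2_functions_def)
  ultimately show ?thesis by (simp add: f2_module_def)
qed

lemma defect_class_alt: "defect_class W f = {\<lambda>x. h x + f x | h. h \<in> f2_homs W}"
  by (auto simp: defect_class_def a_r_coset_def r_coset_def class_functions0_add)

text \<open>The function underlying \<open>defect_pullback\<close>; it is set to zero off the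
  carrier because \<open>f2_functions\<close> demands this.\<close>

definition pull :: "('w, 'b) monoid_scheme \<Rightarrow> ('w \<Rightarrow> 'u) \<Rightarrow> ('u \<Rightarrow> bit) \<Rightarrow> 'w \<Rightarrow> bit" where
  "pull W \<theta> f = (\<lambda>w. if w \<in> carrier W then f (\<theta> w) else 0)"

lemma defect_pullback_alt: "defect_pullback W \<theta> \<omega> = (\<Union>f\<in>\<omega>. defect_class W (pull W \<theta> f))"
  by (simp add: defect_pullback_def pull_def)

context group
begin

lemma f2_homs_subgroup: "subgroup (f2_homs G) (add_monoid (class_functions0 G))"
proof (rule group.subgroupI)
  show "group (add_monoid (class_functions0 G))"
    using class_functions0_module[of G] by (simp add: f2_module_def comm_group_def)
  interpret C: abelian_group "class_functions0 G" by (rule f2_module_abelian_group[OF class_functions0_module])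
  have one: "h \<one> = 0" if "h \<in> f2_homs G" for h
  proof -
    have "h (\<one> \<otimes> \<one>) = h \<one> + h \<one>" using that one_closed unfolding f2_homs_iff by blast
    then show ?thesis by simp
  qed
  show sub: "f2_homs G \<subseteq> carrier (add_monoid (class_functions0 G))"
  proof
    fix h assume h: "h \<in> f2_homs G"
    then have mult: "h (x \<otimes> y) = h x + h y" if "x \<in> carrier G" "y \<in> carrier G" for x y
      using that by (simp add: f2_homs_iff)
    \<comment> \<open>The values at \<open>x\<close> and at its inverse cancel, so a homomorphism to
      an abelian group is a class function.\<close>
    have "h (x \<otimes> y \<otimes> inv x) = h y" if "x \<in> carrier G" "y \<in> carrier G" for x y
    proof -
      have "h x + h (inv x) = 0" using mult[of x "inv x"] one[OF h] that by simp
      then show ?thesis using that by (simp add: mult bit_add_eq_0_iff add_ac bit_add_left_cancel)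
    qed
    then show "h \<in> carrier (add_monoid (class_functions0 G))"
      using h one[OF h] by (simp add: class_functions0_carrier f2_homs_iff)
  qed
  have "(\<lambda>x. 0) \<in> f2_homs G" by (simp add: f2_homs_iff)
  then show "f2_homs G \<noteq> {}" by auto
  show "inv\<^bsub>add_monoid (class_functions0 G)\<^esub> h \<in> f2_homs G" if "h \<in> f2_homs G" for h
  proof -
    have "h \<oplus>\<^bsub>class_functions0 G\<^esub> h = \<zero>\<^bsub>class_functions0 G\<^esub>"
      by (simp add: class_functions0_add class_functions0_zero)
    then have "inv\<^bsub>add_monoid (class_functions0 G)\<^esub> h = h"
      using C.minus_equality[of h h] that sub by (auto simp: a_inv_def)
    then show ?thesis using that by simp
  qed
  show "h \<otimes>\<^bsub>add_monoid (class_functions0 G)\<^esub> k \<in> f2_homs G" if "h \<in> f2_homs G" "k \<in> f2_homs G" for h k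
    using that by (simp add: class_functions0_add f2_homs_iff add_ac)
qed

lemma local_defect_module: "f2_module (local_defect G)"
  unfolding local_defect_def by (rule quot_module_module[OF class_functions0_module f2_homs_subgroup])

lemma local_defect_carrier: "carrier (local_defect G) = defect_class G ` carrier (class_functions0 G)"
  by (auto simp: local_defect_def quot_module_def A_RCOSETS_def RCOSETS_def defect_class_def a_r_coset_def)

lemma local_defect_zero: "\<zero>\<^bsub>local_defect G\<^esub> = defect_class G (\<lambda>x. 0)"
  by (simp add: local_defect_def quot_module_def defect_class_alt)

lemma defect_class_add:
  assumes "f \<in> carrier (class_functions0 G)" "h \<in> carrier (class_functions0 G)"
  shows "defect_class G f \<oplus>\<^bsub>local_defect G\<^esub> defect_class G h = defect_class G (\<lambda>x. f x + h x)"
proof -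
  interpret A: comm_group "add_monoid (class_functions0 G)"
    using class_functions0_module[of G] by (simp add: f2_module_def)
  interpret N: normal "f2_homs G" "add_monoid (class_functions0 G)"
    by (rule A.subgroup_imp_normal[OF f2_homs_subgroup])
  show ?thesis
    using N.rcos_sum[of f h] assms
    by (simp add: local_defect_def quot_module_def defect_class_def a_r_coset_def set_add_def class_functions0_add)
qed

text \<open>In characteristic 2 a sum of two functions is also their difference, so this is the
  usual criterion for equality of cosets.\<close>

lemma defect_class_eq_iff:
  assumes f: "f \<in> carrier (class_functions0 G)" and h: "h \<in> carrier (class_functions0 G)"
  shows "defect_class G f = defect_class G h \<longleftrightarrow> (\<lambda>x. f x + h x) \<in> f2_homs G"
proof
  assume "defect_class G f = defect_class G h"
  moreover have "f \<in> defect_class G f"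
    unfolding defect_class_alt by (rule CollectI, rule exI[of _ "\<lambda>x. 0"]) (simp add: f2_homs_iff)
  ultimately obtain k where k: "k \<in> f2_homs G" "f = (\<lambda>x. k x + h x)" by (auto simp: defect_class_alt)
  then have "(\<lambda>x. f x + h x) = k" by (simp add: add.assoc)
  then show "(\<lambda>x. f x + h x) \<in> f2_homs G" using k by simp
next
  assume k: "(\<lambda>x. f x + h x) \<in> f2_homs G"
  interpret A: comm_group "add_monoid (class_functions0 G)"
    using class_functions0_module[of G] by (simp add: f2_module_def)
  have "(\<lambda>x. (f x + h x) + h x) \<in> defect_class G h" 
    unfolding defect_class_alt by (intro CollectI exI[of _ "\<lambda>x. f x + h x"] conjI refl k)
  then have "f \<in> defect_class G h" by (simp add: add.assoc)
  then show "defect_class G f = defect_class G h"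
    unfolding defect_class_def a_r_coset_def
    using A.repr_independence[OF _ _ f2_homs_subgroup] h by simp
qed

end

locale pullback = group_hom W U \<theta> for W and U and \<theta>
begin

lemma pull_class_functions0:
  assumes "f \<in> carrier (class_functions0 U)" shows "pull W \<theta> f \<in> carrier (class_functions0 W)"
  using assms by (simp add: class_functions0_carrier pull_def)

lemma pull_f2_homs: "h \<in> f2_homs U \<Longrightarrow> pull W \<theta> h \<in> f2_homs W"
  by (simp add: f2_homs_iff pull_def)

text \<open>\<open>defect_pullback\<close> is a union over all functions in a defect class. Two of
  them differ by a homomorphism, which pulls back to a homomorphism, so all members of the union are
  the same coset.\<close>

lemma defect_pullback_class:
  assumes f: "f \<in> carrier (class_functions0 U)"
  shows "defect_pullback W \<theta> (defect_class U f) = defect_class W (pull W \<theta> f)"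
proof -
  have "defect_class W (pull W \<theta> k) = defect_class W (pull W \<theta> f)" if k: "k \<in> defect_class U f" for k
  proof -
    obtain h where h: "h \<in> f2_homs U" "k = (\<lambda>x. h x + f x)" using k by (auto simp: defect_class_alt)
    have "h \<in> carrier (class_functions0 U)" using subgroup.subset[OF H.f2_homs_subgroup] h by auto
    then have k: "k \<in> carrier (class_functions0 U)" using f h by (simp add: class_functions0_carrier)
    have "(\<lambda>x. pull W \<theta> k x + pull W \<theta> f x) = pull W \<theta> h"
      using h by (auto simp: pull_def add.assoc)
    then show ?thesis
      using G.defect_class_eq_iff[OF pull_class_functions0[OF k] pull_class_functions0[OF f]] pull_f2_homs[OF h(1)]
      by simp
  qed
  moreover have "defect_class U f \<noteq> {}"
  proof -
    have "(\<lambda>x. 0) \<in> f2_homs U" by (simp add: f2_homs_iff)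
    then show ?thesis unfolding defect_class_alt by blast
  qed
  ultimately show ?thesis unfolding defect_pullback_alt by auto
qed

lemma defect_pullback_linear: "f2_linear (local_defect U) (local_defect W) (defect_pullback W \<theta>)"
proof (rule f2_linearI[OF H.local_defect_module G.local_defect_module])
  show "defect_pullback W \<theta> \<omega> \<in> carrier (local_defect W)" if "\<omega> \<in> carrier (local_defect U)" for \<omega>
    using that pull_class_functions0
    by (auto simp: H.local_defect_carrier G.local_defect_carrier defect_pullback_class)
  fix \<omega> \<omega>' assume "\<omega> \<in> carrier (local_defect U)" "\<omega>' \<in> carrier (local_defect U)"
  then obtain f f' where f: "f \<in> carrier (class_functions0 U)" "\<omega> = defect_class U f"
    and f': "f' \<in> carrier (class_functions0 U)" "\<omega>' = defect_class U f'"
    by (auto simp: H.local_defect_carrier)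
  have ff: "(\<lambda>x. f x + f' x) \<in> carrier (class_functions0 U)" using f(1) f'(1) by (simp add: class_functions0_carrier)
  have "pull W \<theta> (\<lambda>x. f x + f' x) = (\<lambda>x. pull W \<theta> f x + pull W \<theta> f' x)" by (auto simp: pull_def)
  then show "defect_pullback W \<theta> (\<omega> \<oplus>\<^bsub>local_defect U\<^esub> \<omega>') =
      defect_pullback W \<theta> \<omega> \<oplus>\<^bsub>local_defect W\<^esub> defect_pullback W \<theta> \<omega>'"
    by (simp add: f f' H.defect_class_add defect_pullback_class ff G.defect_class_add pull_class_functions0)
qed

text \<open>A difference of class functions that becomes a homomorphism after pulling back was one
  already, as every element of \<open>U\<close> is hit; this gives injectivity. Pulling back along
  the inverse isomorphism gives surjectivity.\<close>

lemma bij_defect_pullback: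
  assumes bij: "bij_betw \<theta> (carrier W) (carrier U)"
  shows "bij_betw (defect_pullback W \<theta>) (carrier (local_defect U)) (carrier (local_defect W))"
  unfolding bij_betw_def
proof
  have surj: "\<theta> ` carrier W = carrier U" using bij by (rule bij_betw_imp_surj_on)
  show "inj_on (defect_pullback W \<theta>) (carrier (local_defect U))"
  proof (rule inj_onI)
    fix \<omega> \<omega>' assume "\<omega> \<in> carrier (local_defect U)" "\<omega>' \<in> carrier (local_defect U)"
      and eq: "defect_pullback W \<theta> \<omega> = defect_pullback W \<theta> \<omega>'"
    then obtain f f' where f: "f \<in> carrier (class_functions0 U)" "\<omega> = defect_class U f"
      and f': "f' \<in> carrier (class_functions0 U)" "\<omega>' = defect_class U f'"
      by (auto simp: H.local_defect_carrier)
    have "(\<lambda>x. pull W \<theta> f x + pull W \<theta> f' x) \<in> f2_homs W"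
      using eq f f' by (simp add: defect_pullback_class G.defect_class_eq_iff pull_class_functions0)
    then have mult: "f (\<theta> x \<otimes>\<^bsub>U\<^esub> \<theta> y) + f' (\<theta> x \<otimes>\<^bsub>U\<^esub> \<theta> y) = (f (\<theta> x) + f' (\<theta> x)) + (f (\<theta> y) + f' (\<theta> y))"
      if "x \<in> carrier W" "y \<in> carrier W" for x y
      using that by (simp add: f2_homs_iff pull_def)
    have "(\<lambda>x. f x + f' x) \<in> f2_homs U"
      unfolding f2_homs_iff
    proof (intro conjI allI ballI impI)
      show "f x + f' x = 0" if "x \<notin> carrier U" for x
        using that f(1) f'(1) by (simp add: class_functions0_carrier)
      fix u v assume "u \<in> carrier U" "v \<in> carrier U"
      then have "u \<in> \<theta> ` carrier W" "v \<in> \<theta> ` carrier W" using surj by simp_all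
      then show "f (u \<otimes>\<^bsub>U\<^esub> v) + f' (u \<otimes>\<^bsub>U\<^esub> v) = (f u + f' u) + (f v + f' v)" using mult by auto
    qed
    then show "\<omega> = \<omega>'" using f f' by (simp add: H.defect_class_eq_iff)
  qed
  show "defect_pullback W \<theta> ` carrier (local_defect U) = carrier (local_defect W)"
  proof
    show "defect_pullback W \<theta> ` carrier (local_defect U) \<subseteq> carrier (local_defect W)"
      using f2_linear_closed[OF defect_pullback_linear] by auto
    let ?\<theta>' = "inv_into (carrier W) \<theta>"
    have "?\<theta>' \<in> iso U W"
      by (rule G.iso_set_sym) (use bij homh in \<open>simp add: iso_def\<close>)
    then interpret inv: pullback U W ?\<theta>'
      by (auto simp: pullback_def group_hom_def group_hom_axioms_def iso_def)
    show "carrier (local_defect W) \<subseteq> defect_pullback W \<theta> ` carrier (local_defect U)"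
    proof
      fix \<omega> assume "\<omega> \<in> carrier (local_defect W)"
      then obtain f where f: "f \<in> carrier (class_functions0 W)" "\<omega> = defect_class W f"
        by (auto simp: G.local_defect_carrier)
      have g: "pull U ?\<theta>' f \<in> carrier (class_functions0 U)" using inv.pull_class_functions0[OF f(1)] .
      have "pull W \<theta> (pull U ?\<theta>' f) = f"
        using f(1) bij_betw_inv_into_left[OF bij] by (auto simp: pull_def fun_eq_iff class_functions0_carrier)
      then have "\<omega> = defect_pullback W \<theta> (defect_class U (pull U ?\<theta>' f))"
        using defect_pullback_class[OF g] f by simp
      then show "\<omega> \<in> defect_pullback W \<theta> ` carrier (local_defect U)"
        using g by (simp add: H.local_defect_carrier)
    qed
  qed
qed

end

text \<open>Serves \<open>Fix_D\<close>, which is defined through the inverse of a pullback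
  isomorphism.\<close>

lemma f2_linear_the_inv_into:
  assumes M: "f2_module M" and N: "f2_module N" and f: "f2_linear N M f"
    and bij: "bij_betw f (carrier N) (carrier M)"
  shows "f2_linear M N (the_inv_into (carrier N) f)"
proof (rule f2_linearI[OF M N])
  interpret N: abelian_group N by (rule f2_module_abelian_group[OF N])
  have inj: "inj_on f (carrier N)" and im: "f ` carrier N = carrier M" using bij by (auto simp: bij_betw_def)
  have closed: "the_inv_into (carrier N) f v \<in> carrier N" if "v \<in> carrier M" for v
    using the_inv_into_into[OF inj, of v "carrier N"] that im by simp
  show "the_inv_into (carrier N) f v \<in> carrier N" if "v \<in> carrier M" for v using closed[OF that] .
  have f_inv: "f (the_inv_into (carrier N) f v) = v" if "v \<in> carrier M" for v
    using f_the_inv_into_f[OF inj, of v] that im by simp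
  fix v w assume v: "v \<in> carrier M" and w: "w \<in> carrier M"
  have "f (the_inv_into (carrier N) f v \<oplus>\<^bsub>N\<^esub> the_inv_into (carrier N) f w) = v \<oplus>\<^bsub>M\<^esub> w"
    using f2_linear_add[OF f closed[OF v] closed[OF w]] f_inv v w by simp
  then show "the_inv_into (carrier N) f (v \<oplus>\<^bsub>M\<^esub> w) = the_inv_into (carrier N) f v \<oplus>\<^bsub>N\<^esub> the_inv_into (carrier N) f w"
    using closed v w by (intro the_inv_into_f_eq[OF inj]) simp_all
qed

section \<open>Weyl groups and the maps induced between them\<close>

lemma (in group_hom) image_r_coset:
  "K \<subseteq> carrier G \<Longrightarrow> g \<in> carrier G \<Longrightarrow> h ` (K #> g) = h ` K #>\<^bsub>H\<^esub> h g"
  by (simp add: r_coset_def image_UN subset_iff)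

lemma (in group_hom) image_set_mult:
  "A \<subseteq> carrier G \<Longrightarrow> B \<subseteq> carrier G \<Longrightarrow> h ` (A <#> B) = h ` A <#>\<^bsub>H\<^esub> h ` B"
  by (simp add: set_mult_def image_UN subset_iff)

context group
begin

lemma normalizer_subgroup: "subgroup K G \<Longrightarrow> subgroup (normalizer G K) G"
  by (rule normalizer_imp_subgroup[OF subgroup.subset])

lemma weyl_normal: "subgroup K G \<Longrightarrow> K \<lhd> G\<lparr>carrier := normalizer G K\<rparr>"
  by (rule subgroup_in_normalizer)

lemma weyl_group_group: "subgroup K G \<Longrightarrow> group (weyl_group G K)"
  unfolding weyl_group_def by (rule normal.factorgroup_is_group[OF weyl_normal])

lemma weyl_group_carrier: "carrier (weyl_group G K) = (\<lambda>g. K #> g) ` normalizer G K"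
  by (simp add: weyl_group_def carrier_FactGroup)

lemma weyl_group_one: "\<one>\<^bsub>weyl_group G K\<^esub> = K"
  by (simp add: weyl_group_def)

lemma weyl_group_mult: "monoid.mult (weyl_group G K) = set_mult G"
  by (simp add: weyl_group_def set_mult_def fun_eq_iff)

lemma weyl_element_subset:
  assumes "subgroup K G" "c \<in> carrier (weyl_group G K)" shows "c \<subseteq> carrier G"
  using assms r_coset_subset_G[OF subgroup.subset] normalizer_alt[OF subgroup.subset]
  by (auto simp: weyl_group_carrier)

lemma weyl_coset_mult:
  assumes K: "subgroup K G" and g: "g \<in> normalizer G K" "h \<in> normalizer G K"
  shows "(K #> g) \<otimes>\<^bsub>weyl_group G K\<^esub> (K #> h) = K #> (g \<otimes> h)"
  using normal.rcos_sum[OF weyl_normal[OF K], of g h] g by (simp add: weyl_group_mult)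

text \<open>Elements of a Weyl group are cosets, hence subsets of the group, and multiply as sets.
  Its inner automorphism by the coset of \<open>n\<close> is therefore elementwise conjugation by
  \<open>n\<close>, the form in which \<open>component\<close> moves cosets.\<close>

lemma weyl_conjugate:
  assumes K: "subgroup K G" and n: "n \<in> normalizer G K" and c: "c \<in> carrier (weyl_group G K)"
  shows "(K #> n) \<otimes>\<^bsub>weyl_group G K\<^esub> c \<otimes>\<^bsub>weyl_group G K\<^esub> inv\<^bsub>weyl_group G K\<^esub> (K #> n) = conjugate G n ` c"
proof -
  interpret W: group "weyl_group G K" using K by (rule weyl_group_group)
  have KG: "K \<subseteq> carrier G" using K by (rule subgroup.subset)
  have nG: "n \<in> carrier G" "conjugate G n ` K = K" using n by (simp_all add: normalizer_alt[OF KG])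
  obtain g where g: "g \<in> normalizer G K" "c = K #> g" using c by (auto simp: weyl_group_carrier)
  have gG: "g \<in> carrier G" using g by (simp add: normalizer_alt[OF KG])
  have cl: "n \<otimes> g \<in> normalizer G K" "inv n \<in> normalizer G K"
    using subgroup.m_closed[OF normalizer_subgroup[OF K] n g(1)]
      subgroup.m_inv_closed[OF normalizer_subgroup[OF K] n] by auto
  have nc: "K #> n \<in> carrier (weyl_group G K)" using n by (simp add: weyl_group_carrier)
  have "(K #> inv n) \<otimes>\<^bsub>weyl_group G K\<^esub> (K #> n) = \<one>\<^bsub>weyl_group G K\<^esub>"
    using weyl_coset_mult[OF K cl(2) n] nG KG by (simp add: weyl_group_one)
  then have inv: "inv\<^bsub>weyl_group G K\<^esub> (K #> n) = K #> inv n"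
    using nc cl by (intro W.inv_equality) (auto simp: weyl_group_carrier)
  have "conjugate G n ` c = K #> conjugate G n g"
    using group_hom.image_r_coset[OF conjugate_group_hom[OF nG(1)] KG gG] nG(2) g(2) by simp
  then show ?thesis
    unfolding g(2) inv weyl_coset_mult[OF K n g(1)] weyl_coset_mult[OF K cl] by (simp add: conjugate_def)
qed

text \<open>If \<open>n\<close> normalizes \<open>K\<close>, conjugation by it is inner on the Weyl
  group. This is what makes the choice of a conjugating element in \<open>component\<close>
  immaterial.\<close>

lemma weyl_inner:
  assumes K: "subgroup K G" and n: "n \<in> carrier G" "conjugate G n ` K = K"
    and f: "f \<in> carrier (class_functions0 (weyl_group G K))" and c: "c \<in> carrier (weyl_group G K)"
  shows "f (conjugate G n ` c) = f c"
proof -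
  have nN: "n \<in> normalizer G K" using n by (simp add: normalizer_alt[OF subgroup.subset[OF K]])
  then have "K #> n \<in> carrier (weyl_group G K)" by (simp add: weyl_group_carrier)
  then show ?thesis
    using f c unfolding weyl_conjugate[OF K nN c, symmetric] by (simp add: class_functions0_carrier)
qed

end

text \<open>The image of a normalizing element normalizes the image. Being stated for any
  homomorphism, it covers both the projections and the conjugations that transport
  components.\<close>

lemma (in group_hom) weyl_pullback:
  assumes K: "subgroup K G"
  shows "pullback (weyl_group G K) (weyl_group H (h ` K)) (image h)"
proof -
  have KG: "K \<subseteq> carrier G" using K by (rule subgroup.subset)
  have hK: "subgroup (h ` K) H" using K by (rule subgroup_img_is_subgroup)
  have norm: "h g \<in> normalizer H (h ` K)" if "g \<in> normalizer G K" for g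
  proof -
    have g: "g \<in> carrier G" "conjugate G g ` K = K" using that by (auto simp: G.normalizer_alt[OF KG])
    have "conjugate H (h g) ` h ` K = h ` conjugate G g ` K"
      unfolding image_image using g(1) KG by (intro image_cong) (auto simp: conjugate_def subset_iff)
    then show ?thesis using g by (simp add: H.normalizer_alt[OF subgroup.subset[OF hK]])
  qed
  have "image h \<in> hom (weyl_group G K) (weyl_group H (h ` K))"
  proof (rule homI)
    fix c assume "c \<in> carrier (weyl_group G K)"
    then obtain g where "g \<in> normalizer G K" "c = K #> g" by (auto simp: G.weyl_group_carrier)
    then show "h ` c \<in> carrier (weyl_group H (h ` K))"
      using norm image_r_coset[OF KG] by (auto simp: H.weyl_group_carrier G.normalizer_alt[OF KG])
  next
    fix c d assume "c \<in> carrier (weyl_group G K)" "d \<in> carrier (weyl_group G K)"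
    then show "h ` (c \<otimes>\<^bsub>weyl_group G K\<^esub> d) = h ` c \<otimes>\<^bsub>weyl_group H (h ` K)\<^esub> h ` d"
      using G.weyl_element_subset[OF K] by (simp add: G.weyl_group_mult H.weyl_group_mult image_set_mult)
  qed
  then show ?thesis
    using G.weyl_group_group[OF K] H.weyl_group_group[OF hK]
    by (simp add: pullback_def group_hom_def group_hom_axioms_def)
qed

section \<open>The defect map, inflation and fixed points\<close>

context group
begin

lemma generate_insert_coset:
  assumes "subgroup K G" "c \<in> carrier (weyl_group G K)"
  shows "K \<union> c \<subseteq> carrier G" "subgroup (generate G (K \<union> c)) G"
proof -
  show *: "K \<union> c \<subseteq> carrier G" using weyl_element_subset[OF assms] subgroup.subset[OF assms(1)] by simp
  show "subgroup (generate G (K \<union> c)) G" using generate_is_subgroup[OF *] .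
qed

lemma generate_subgroup_self: "subgroup K G \<Longrightarrow> generate G K = K"
  by (rule generateI[symmetric]) auto

lemma lambda_fun_conjugate:
  assumes K: "subgroup K G" and c: "c \<in> carrier (weyl_group G K)" and a: "a \<in> carrier G"
  shows "lambda_fun G x (conjugate G a ` K) (conjugate G a ` c) = lambda_fun G x K c"
proof -
  interpret conj: group_hom G G "conjugate G a" using a by (rule conjugate_group_hom)
  interpret pb: pullback "weyl_group G K" "weyl_group G (conjugate G a ` K)" "image (conjugate G a)"
    by (rule conj.weyl_pullback[OF K])
  have mem: "conjugate G a ` c \<in> carrier (weyl_group G (conjugate G a ` K))" using c by (rule pb.hom_closed)
  have "generate G (conjugate G a ` K \<union> conjugate G a ` c) = conjugate G a ` generate G (K \<union> c)"
    using conj.generate_img[OF generate_insert_coset(1)[OF K c]] by (simp add: image_Un)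
  then show ?thesis
    using conj_class_conjugate[OF a subgroup.subset[OF generate_insert_coset(2)[OF K c]]]
      conj_class_conjugate[OF a subgroup.subset[OF K]] mem c
    by (simp add: lambda_fun_def)
qed

lemma lambda_fun_class_function:
  assumes K: "subgroup K G"
  shows "lambda_fun G x K \<in> carrier (class_functions0 (weyl_group G K))"
  unfolding class_functions0_carrier
proof (intro conjI allI ballI impI)
  show "lambda_fun G x K c = 0" if "c \<notin> carrier (weyl_group G K)" for c
    using that by (simp add: lambda_fun_def)
  interpret W: group "weyl_group G K" using K by (rule weyl_group_group)
  have "K \<in> carrier (weyl_group G K)" using W.one_closed by (simp add: weyl_group_one)
  \<comment> \<open>At the trivial coset the generated subgroup is \<open>K\<close> itself, and the
    two values of \<open>x\<close> cancel.\<close>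
  then show "lambda_fun G x K \<one>\<^bsub>weyl_group G K\<^esub> = 0"
    by (simp add: lambda_fun_def weyl_group_one generate_subgroup_self[OF K])
  fix d c assume d: "d \<in> carrier (weyl_group G K)" and c: "c \<in> carrier (weyl_group G K)"
  obtain n where n: "n \<in> normalizer G K" "d = K #> n" using d by (auto simp: weyl_group_carrier)
  then have nG: "n \<in> carrier G" "conjugate G n ` K = K"
    by (simp_all add: normalizer_alt[OF subgroup.subset[OF K]])
  show "lambda_fun G x K (d \<otimes>\<^bsub>weyl_group G K\<^esub> c \<otimes>\<^bsub>weyl_group G K\<^esub> inv\<^bsub>weyl_group G K\<^esub> d) = lambda_fun G x K c"
    unfolding n(2) weyl_conjugate[OF K n(1) c] using lambda_fun_conjugate[OF K c nG(1), of x] nG(2) by simp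
qed

lemma D_space_module: "f2_module (D_space G)"
  unfolding D_space_def
  by (intro sum_module_module group.local_defect_module weyl_group_group crep_subgroup(1))

lemma D_space_carrier: "carrier (D_space G) = (\<Pi>\<^sub>E C\<in>sub_classes G. carrier (local_defect (weyl_group G (crep C))))"
  by (simp add: D_space_def sum_module_def)

lemma D_space_add:
  "\<eta> \<oplus>\<^bsub>D_space G\<^esub> \<zeta> = (\<lambda>C\<in>sub_classes G. \<eta> C \<oplus>\<^bsub>local_defect (weyl_group G (crep C))\<^esub> \<zeta> C)"
  by (simp add: D_space_def sum_module_def)

lemma D_space_zero: "\<zero>\<^bsub>D_space G\<^esub> = (\<lambda>C\<in>sub_classes G. \<zero>\<^bsub>local_defect (weyl_group G (crep C))\<^esub>)"
  by (simp add: D_space_def sum_module_def)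

text \<open>The choice inside \<open>component\<close> depends on \<open>K\<close> only, so one
  \<open>b\<close> serves all \<eta> at once, and linearity in \<eta> reduces to that of a
  pullback.\<close>

lemma component_eq_pullback:
  assumes K: "subgroup K G"
  obtains b where "b \<in> carrier G" "conjugate G b ` K = crep (conj_class G K)"
    "\<forall>\<eta>. component G \<eta> K = defect_pullback (weyl_group G K) (image (conjugate G b)) (\<eta> (conj_class G K))"
proof -
  let ?P = "\<lambda>a. a \<in> carrier G \<and> conjugate G a ` K = crep (conj_class G K)"
  have "\<exists>a. ?P a" using crep_conj_class[OF K] by metis
  then have "?P (SOME a. ?P a)" by (rule someI_ex)
  then show ?thesis
    by (intro that[of "SOME a. ?P a"]) (simp_all add: component_def Let_def conjugate_image)
qed

lemma component_linear:
  assumes K: "subgroup K G"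
  shows "f2_linear (D_space G) (local_defect (weyl_group G K)) (\<lambda>\<eta>. component G \<eta> K)"
proof -
  obtain b where b: "b \<in> carrier G" "conjugate G b ` K = crep (conj_class G K)"
    "\<forall>\<eta>. component G \<eta> K = defect_pullback (weyl_group G K) (image (conjugate G b)) (\<eta> (conj_class G K))"
    using component_eq_pullback[OF K] .
  interpret pb: pullback "weyl_group G K" "weyl_group G (crep (conj_class G K))" "image (conjugate G b)"
    using group_hom.weyl_pullback[OF conjugate_group_hom[OF b(1)] K] b(2) by simp
  have C: "conj_class G K \<in> sub_classes G" using K by (rule conj_class_in_sub_classes)
  have mem: "\<eta> (conj_class G K) \<in> carrier (local_defect (weyl_group G (crep (conj_class G K))))"
    if "\<eta> \<in> carrier (D_space G)" for \<eta>
    using that C by (auto simp: D_space_carrier)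
  show ?thesis
  proof (rule f2_linearI[OF D_space_module pb.G.local_defect_module])
    show "component G \<eta> K \<in> carrier (local_defect (weyl_group G K))" if "\<eta> \<in> carrier (D_space G)" for \<eta>
      unfolding b(3)[rule_format] by (rule f2_linear_closed[OF pb.defect_pullback_linear mem[OF that]])
    show "component G (\<eta> \<oplus>\<^bsub>D_space G\<^esub> \<zeta>) K = component G \<eta> K \<oplus>\<^bsub>local_defect (weyl_group G K)\<^esub> component G \<zeta> K"
      if "\<eta> \<in> carrier (D_space G)" "\<zeta> \<in> carrier (D_space G)" for \<eta> \<zeta>
      unfolding b(3)[rule_format] using f2_linear_add[OF pb.defect_pullback_linear mem[OF that(1)] mem[OF that(2)]] C
      by (simp add: D_space_add)
  qed
qed

text \<open>Two conjugating elements differ by an element \<open>n\<close> normalizing the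
  representative, and \<open>weyl_inner\<close> applies. A transport can thus be computed with
  whichever conjugating element is at hand.\<close>

lemma component_class:
  assumes K: "subgroup K G" and a: "a \<in> carrier G" "conjugate G a ` K = crep (conj_class G K)"
    and f: "f \<in> carrier (class_functions0 (weyl_group G (crep (conj_class G K))))"
      "\<eta> (conj_class G K) = defect_class (weyl_group G (crep (conj_class G K))) f"
  shows "component G \<eta> K = defect_class (weyl_group G K) (pull (weyl_group G K) (image (conjugate G a)) f)"
proof -
  let ?M = "crep (conj_class G K)"
  obtain b where b: "b \<in> carrier G" "conjugate G b ` K = ?M"
    "\<forall>\<eta>. component G \<eta> K = defect_pullback (weyl_group G K) (image (conjugate G b)) (\<eta> (conj_class G K))"
    using component_eq_pullback[OF K] .
  interpret pb: pullback "weyl_group G K" "weyl_group G ?M" "image (conjugate G b)"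
    using group_hom.weyl_pullback[OF conjugate_group_hom[OF b(1)] K] b(2) by simp
  interpret pa: pullback "weyl_group G K" "weyl_group G ?M" "image (conjugate G a)"
    using group_hom.weyl_pullback[OF conjugate_group_hom[OF a(1)] K] a(2) by simp
  note M = crep_subgroup(1)[OF conj_class_in_sub_classes[OF K]]
  have KG: "K \<subseteq> carrier G" using K by (rule subgroup.subset)
  define n where "n = b \<otimes> inv a"
  have n: "n \<in> carrier G" using a b by (simp add: n_def)
  have nb: "conjugate G n ` conjugate G a ` S = conjugate G b ` S" if "S \<subseteq> carrier G" for S
    using that a b by (simp add: n_def conjugate_set_conjugate m_assoc)
  have nM: "conjugate G n ` ?M = ?M" using nb[OF KG] a b by simp
  have "pull (weyl_group G K) (image (conjugate G b)) f = pull (weyl_group G K) (image (conjugate G a)) f"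
  proof
    fix c
    show "pull (weyl_group G K) (image (conjugate G b)) f c = pull (weyl_group G K) (image (conjugate G a)) f c"
    proof (cases "c \<in> carrier (weyl_group G K)")
      case True
      have "f (conjugate G n ` conjugate G a ` c) = f (conjugate G a ` c)"
        by (rule weyl_inner[OF M n nM f(1) pa.hom_closed[OF True]])
      then show ?thesis using True nb[OF weyl_element_subset[OF K True]] by (simp add: pull_def)
    qed (simp add: pull_def)
  qed
  then show ?thesis unfolding b(3)[rule_format] f(2) using pb.defect_pullback_class[OF f(1)] by simp
qed

lemma Def_map_in_D_space: "Def_map G x \<in> carrier (D_space G)"
  unfolding D_space_carrier Def_map_def
  using lambda_fun_class_function[OF crep_subgroup(1)]
  by (auto simp: group.local_defect_carrier[OF weyl_group_group[OF crep_subgroup(1)]])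

lemma Def_map_linear: "f2_linear (V_space G) (D_space G) (Def_map G)"
proof (rule f2_linearI[OF V_space_module D_space_module Def_map_in_D_space])
  fix x y
  have "defect_class (weyl_group G (crep C)) (lambda_fun G (\<lambda>C. x C + y C) (crep C)) =
      defect_class (weyl_group G (crep C)) (lambda_fun G x (crep C))
      \<oplus>\<^bsub>local_defect (weyl_group G (crep C))\<^esub> defect_class (weyl_group G (crep C)) (lambda_fun G y (crep C))"
    if C: "C \<in> sub_classes G" for C
  proof -
    note K = crep_subgroup(1)[OF C]
    have "lambda_fun G (\<lambda>C. x C + y C) (crep C) = (\<lambda>c. lambda_fun G x (crep C) c + lambda_fun G y (crep C) c)"
      by (auto simp: lambda_fun_def add_ac)
    then show ?thesis
      using group.defect_class_add[OF weyl_group_group[OF K] lambda_fun_class_function[OF K] lambda_fun_class_function[OF K]]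
      by simp
  qed
  then show "Def_map G (x \<oplus>\<^bsub>V_space G\<^esub> y) = Def_map G x \<oplus>\<^bsub>D_space G\<^esub> Def_map G y"
    by (auto simp: Def_map_def D_space_add V_space_add intro!: restrict_ext)
qed

text \<open>By \<open>lambda_fun_conjugate\<close> the functions at conjugate subgroups correspond,
  so the entry stored at the representative is transported to the function defined directly at
  \<open>K\<close>.\<close>

lemma component_Def_map:
  assumes K: "subgroup K G"
  shows "component G (Def_map G x) K = defect_class (weyl_group G K) (lambda_fun G x K)"
proof -
  let ?C = "conj_class G K"
  have C: "?C \<in> sub_classes G" using K by (rule conj_class_in_sub_classes)
  obtain a where a: "a \<in> carrier G" "crep ?C = conjugate G a ` K" using crep_conj_class[OF K] .
  have "component G (Def_map G x) K =
      defect_class (weyl_group G K) (pull (weyl_group G K) (image (conjugate G a)) (lambda_fun G x (crep ?C)))"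
    using C a by (intro component_class[OF K] lambda_fun_class_function crep_subgroup) (simp_all add: Def_map_def)
  also have "pull (weyl_group G K) (image (conjugate G a)) (lambda_fun G x (crep ?C)) = lambda_fun G x K"
  proof
    fix c
    show "pull (weyl_group G K) (image (conjugate G a)) (lambda_fun G x (crep ?C)) c = lambda_fun G x K c"
      using lambda_fun_conjugate[OF K _ a(1), of c x] a(2)
      by (cases "c \<in> carrier (weyl_group G K)") (simp_all add: pull_def, simp add: lambda_fun_def)
  qed
  finally show ?thesis .
qed

end

context finite_group_epi
begin

lemma weyl_image_pullback:
  "subgroup K G \<Longrightarrow> pullback (weyl_group G K) (weyl_group Q (p ` K)) (image p)"
  by (rule weyl_pullback)

lemma weyl_preimage_pullback:
  assumes L: "subgroup L Q"
  shows "pullback (weyl_group G (preimage G p L)) (weyl_group Q L) (image p)"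
  using weyl_image_pullback[OF preimage_subgroup[OF L]] image_preimage[OF subgroup.subset[OF L]] by simp

text \<open>Cosets of the preimage are full preimages of cosets of \<open>L\<close>, which gives
  injectivity. Surjectivity holds because an element lying over the normalizer of \<open>L\<close>
  normalizes the preimage.\<close>

lemma bij_weyl_preimage:
  assumes L: "subgroup L Q"
  shows "bij_betw (image p) (carrier (weyl_group G (preimage G p L))) (carrier (weyl_group Q L))"
proof -
  let ?K = "preimage G p L"
  interpret pb: pullback "weyl_group G ?K" "weyl_group Q L" "image p"
    by (rule weyl_preimage_pullback[OF L])
  have LQ: "L \<subseteq> carrier Q" using L by (rule subgroup.subset)
  note K = preimage_subgroup[OF L]
  have K_coset: "preimage G p (L #>\<^bsub>Q\<^esub> p g) = ?K #>\<^bsub>G\<^esub> g" if g: "g \<in> carrier G" for g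
  proof (intro equalityI subsetI)
    fix x assume x: "x \<in> preimage G p (L #>\<^bsub>Q\<^esub> p g)"
    then obtain l where l: "x \<in> carrier G" "l \<in> L" "p x = l \<otimes>\<^bsub>Q\<^esub> p g" by (auto simp: preimage_def r_coset_def)
    have "p (x \<otimes>\<^bsub>G\<^esub> inv\<^bsub>G\<^esub> g) = l" using l g LQ by (auto simp: H.m_assoc subset_iff)
    then have "x \<otimes>\<^bsub>G\<^esub> inv\<^bsub>G\<^esub> g \<in> ?K" using l g by (simp add: preimage_def)
    moreover have "x = (x \<otimes>\<^bsub>G\<^esub> inv\<^bsub>G\<^esub> g) \<otimes>\<^bsub>G\<^esub> g" using l g by (simp add: G.m_assoc)
    ultimately show "x \<in> ?K #>\<^bsub>G\<^esub> g" unfolding r_coset_def by blast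
  qed (use g in \<open>auto simp: preimage_def r_coset_def\<close>)
  show ?thesis
    unfolding bij_betw_def
  proof
    show "inj_on (image p) (carrier (weyl_group G ?K))"
    proof (rule inj_onI)
      fix c d assume "c \<in> carrier (weyl_group G ?K)" "d \<in> carrier (weyl_group G ?K)" and eq: "p ` c = p ` d"
      then obtain g h where g: "g \<in> carrier G" "c = ?K #>\<^bsub>G\<^esub> g" and h: "h \<in> carrier G" "d = ?K #>\<^bsub>G\<^esub> h"
        by (auto simp: G.weyl_group_carrier G.normalizer_alt[OF preimage_subset])
      then have "L #>\<^bsub>Q\<^esub> p g = L #>\<^bsub>Q\<^esub> p h"
        using eq image_r_coset[OF preimage_subset] image_preimage[OF LQ] by simp
      then show "c = d" using K_coset g h by metis
    qed
    show "image p ` carrier (weyl_group G ?K) = carrier (weyl_group Q L)"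
    proof
      show "image p ` carrier (weyl_group G ?K) \<subseteq> carrier (weyl_group Q L)"
        using pb.hom_closed by auto
      show "carrier (weyl_group Q L) \<subseteq> image p ` carrier (weyl_group G ?K)"
      proof
        fix d assume "d \<in> carrier (weyl_group Q L)"
        then obtain q where q: "q \<in> carrier Q" "conjugate Q q ` L = L" "d = L #>\<^bsub>Q\<^esub> q"
          by (auto simp: H.weyl_group_carrier H.normalizer_alt[OF LQ])
        have "q \<in> p ` carrier G" using q surj by simp
        then obtain g where g: "g \<in> carrier G" "q = p g" by auto
        have "g \<in> normalizer G ?K"
          using g q preimage_conjugate[OF g(1) LQ] by (simp add: G.normalizer_alt[OF preimage_subset])
        moreover have "d = p ` (?K #>\<^bsub>G\<^esub> g)"
          using image_r_coset[OF preimage_subset g(1)] image_preimage[OF LQ] q g by simp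
        ultimately show "d \<in> image p ` carrier (weyl_group G ?K)" by (auto simp: G.weyl_group_carrier)
      qed
    qed
  qed
qed

lemma Inf_D_linear: "f2_linear (D_space Q) (D_space G) (Inf_D G Q p)"
proof (rule f2_linearI[OF H.D_space_module G.D_space_module])
  have lin: "f2_linear (D_space Q) (local_defect (weyl_group G (crep C)))
      (\<lambda>\<omega>. defect_pullback (weyl_group G (crep C)) (image p) (component Q \<omega> (p ` crep C)))"
    if C: "C \<in> sub_classes G" for C
  proof -
    note K = G.crep_subgroup(1)[OF C]
    interpret pb: pullback "weyl_group G (crep C)" "weyl_group Q (p ` crep C)" "image p"
      by (rule weyl_image_pullback[OF K])
    note comp = H.component_linear[OF image_subgroup[OF K]]
    show ?thesis
      using f2_linear_closed[OF comp] f2_linear_add[OF comp]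
        f2_linear_closed[OF pb.defect_pullback_linear] f2_linear_add[OF pb.defect_pullback_linear]
      by (intro f2_linearI[OF H.D_space_module pb.G.local_defect_module]) simp_all
  qed
  show "Inf_D G Q p \<omega> \<in> carrier (D_space G)" if "\<omega> \<in> carrier (D_space Q)" for \<omega>
    using f2_linear_closed[OF lin that] by (auto simp: G.D_space_carrier Inf_D_def)
  show "Inf_D G Q p (\<omega> \<oplus>\<^bsub>D_space Q\<^esub> \<omega>') = Inf_D G Q p \<omega> \<oplus>\<^bsub>D_space G\<^esub> Inf_D G Q p \<omega>'"
    if "\<omega> \<in> carrier (D_space Q)" "\<omega>' \<in> carrier (D_space Q)" for \<omega> \<omega>'
    using f2_linear_add[OF lin that] by (auto simp: G.D_space_add Inf_D_def intro!: restrict_ext)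
qed

text \<open>\<open>Fix_D\<close> is a component followed by the inverse of a pullback isomorphism,
  both linear. A zero component thus gives a zero value, the form in which orthogonality of
  different factors is checked.\<close>

lemma Fix_D_linear: "f2_linear (D_space G) (D_space Q) (Fix_D G Q p)"
  and Fix_D_zero: "C \<in> sub_classes Q \<Longrightarrow> component G \<eta> (preimage G p (crep C)) =
      \<zero>\<^bsub>local_defect (weyl_group G (preimage G p (crep C)))\<^esub> \<Longrightarrow>
      Fix_D G Q p \<eta> C = \<zero>\<^bsub>local_defect (weyl_group Q (crep C))\<^esub>"
proof -
  let ?I = "\<lambda>C. the_inv_into (carrier (local_defect (weyl_group Q (crep C))))
       (defect_pullback (weyl_group G (preimage G p (crep C))) (image p))"
  have inv: "f2_linear (local_defect (weyl_group G (preimage G p (crep C)))) (local_defect (weyl_group Q (crep C))) (?I C)"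
    and zero: "?I C \<zero>\<^bsub>local_defect (weyl_group G (preimage G p (crep C)))\<^esub> = \<zero>\<^bsub>local_defect (weyl_group Q (crep C))\<^esub>"
    and lin: "f2_linear (D_space G) (local_defect (weyl_group Q (crep C)))
      (\<lambda>\<eta>. ?I C (component G \<eta> (preimage G p (crep C))))"
    if C: "C \<in> sub_classes Q" for C
  proof -
    note L = H.crep_subgroup(1)[OF C]
    interpret pb: pullback "weyl_group G (preimage G p (crep C))" "weyl_group Q (crep C)" "image p"
      by (rule weyl_preimage_pullback[OF L])
    show inv: "f2_linear (local_defect (weyl_group G (preimage G p (crep C)))) (local_defect (weyl_group Q (crep C))) (?I C)"
      by (rule f2_linear_the_inv_into[OF pb.G.local_defect_module pb.H.local_defect_module
            pb.defect_pullback_linear pb.bij_defect_pullback[OF bij_weyl_preimage[OF L]]])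
    show "?I C \<zero>\<^bsub>local_defect (weyl_group G (preimage G p (crep C)))\<^esub> = \<zero>\<^bsub>local_defect (weyl_group Q (crep C))\<^esub>"
      by (rule f2_linear_zero[OF pb.G.local_defect_module pb.H.local_defect_module inv])
    note comp = G.component_linear[OF preimage_subgroup[OF L]]
    show "f2_linear (D_space G) (local_defect (weyl_group Q (crep C)))
      (\<lambda>\<eta>. ?I C (component G \<eta> (preimage G p (crep C))))"
      using f2_linear_closed[OF comp] f2_linear_add[OF comp] f2_linear_closed[OF inv] f2_linear_add[OF inv]
      by (intro f2_linearI[OF G.D_space_module pb.H.local_defect_module]) simp_all
  qed
  show "f2_linear (D_space G) (D_space Q) (Fix_D G Q p)"
  proof (rule f2_linearI[OF G.D_space_module H.D_space_module])
    show "Fix_D G Q p \<eta> \<in> carrier (D_space Q)" if "\<eta> \<in> carrier (D_space G)" for \<eta>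
      using f2_linear_closed[OF lin that] by (auto simp: H.D_space_carrier Fix_D_def)
    show "Fix_D G Q p (\<eta> \<oplus>\<^bsub>D_space G\<^esub> \<eta>') = Fix_D G Q p \<eta> \<oplus>\<^bsub>D_space Q\<^esub> Fix_D G Q p \<eta>'"
      if "\<eta> \<in> carrier (D_space G)" "\<eta>' \<in> carrier (D_space G)" for \<eta> \<eta>'
      using f2_linear_add[OF lin that] by (auto simp: H.D_space_add Fix_D_def intro!: restrict_ext)
  qed
  show "Fix_D G Q p \<eta> C = \<zero>\<^bsub>local_defect (weyl_group Q (crep C))\<^esub>"
    if "C \<in> sub_classes Q" "component G \<eta> (preimage G p (crep C)) =
      \<zero>\<^bsub>local_defect (weyl_group G (preimage G p (crep C)))\<^esub>"
    using that zero by (simp add: Fix_D_def)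
qed

text \<open>Identifies values of \<open>Fix_D\<close> without handling the inverse map: the pullback
  is injective, so it is enough to compare after pulling back.\<close>

lemma Fix_D_eqI:
  assumes C: "C \<in> sub_classes Q" and \<omega>: "\<omega> \<in> carrier (local_defect (weyl_group Q (crep C)))"
    and eq: "component G \<eta> (preimage G p (crep C)) =
      defect_pullback (weyl_group G (preimage G p (crep C))) (image p) \<omega>"
  shows "Fix_D G Q p \<eta> C = \<omega>"
proof -
  note L = H.crep_subgroup(1)[OF C]
  interpret pb: pullback "weyl_group G (preimage G p (crep C))" "weyl_group Q (crep C)" "image p"
    by (rule weyl_preimage_pullback[OF L])
  show ?thesis
    using the_inv_into_f_f[OF bij_betw_imp_inj_on[OF pb.bij_defect_pullback[OF bij_weyl_preimage[OF L]]] \<omega>] C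
    by (simp add: Fix_D_def eq)
qed

text \<open>From the Weyl group of the preimage of \<open>crep C\<close> the transport runs to that
  of its chosen conjugate, then to that of the image in \<open>Q\<close>, and back to that of
  \<open>crep C\<close>. The conjugations by \<open>a\<close> and by the inverse of
  \<open>p a\<close> cancel, so the composite is \<open>p\<close> itself.\<close>

lemma Fix_D_Inf_D:
  assumes \<omega>: "\<omega> \<in> carrier (D_space Q)"
  shows "Fix_D G Q p (Inf_D G Q p \<omega>) = \<omega>"
proof -
  have "Fix_D G Q p (Inf_D G Q p \<omega>) C = \<omega> C" if C: "C \<in> sub_classes Q" for C
  proof (rule Fix_D_eqI[OF C])
    note L = H.crep_subgroup[OF C]
    have LQ: "crep C \<subseteq> carrier Q" using L(1) by (rule subgroup.subset)
    let ?K0 = "preimage G p (crep C)"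
    note K0 = preimage_subgroup[OF L(1)]
    let ?D = "conj_class G ?K0"
    have D: "?D \<in> sub_classes G" using K0 by (rule G.conj_class_in_sub_classes)
    note K = G.crep_subgroup[OF D]
    obtain a where a: "a \<in> carrier G" "crep ?D = conjugate G a ` ?K0" using G.crep_conj_class[OF K0] .
    have pK: "p ` crep ?D = conjugate Q (p a) ` crep C"
      using p_conjugate_set[OF a(1) preimage_subset] image_preimage[OF LQ] a(2) by simp
    have cls: "conj_class Q (p ` crep ?D) = C"
      using pK H.conj_class_conjugate[OF hom_closed[OF a(1)] LQ] L(2) by simp
    show \<omega>C: "\<omega> C \<in> carrier (local_defect (weyl_group Q (crep C)))" using \<omega> C by (auto simp: H.D_space_carrier)
    then obtain f where f: "f \<in> carrier (class_functions0 (weyl_group Q (crep C)))"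
        "\<omega> C = defect_class (weyl_group Q (crep C)) f"
      by (auto simp: group.local_defect_carrier[OF H.weyl_group_group[OF L(1)]])
    \<comment> \<open>This element leads from the image of the representative back to
      \<open>crep C\<close>; \<open>component_class\<close> permits it in place of the one chosen by
      \<open>component\<close>.\<close>
    let ?b = "inv\<^bsub>Q\<^esub> p a"
    let ?f1 = "pull (weyl_group Q (p ` crep ?D)) (image (conjugate Q ?b)) f"
    let ?f2 = "pull (weyl_group G (crep ?D)) (image p) ?f1"
    let ?f3 = "pull (weyl_group G ?K0) (image (conjugate G a)) ?f2"
    note pK_sub = image_subgroup[OF K(1)]
    have b: "?b \<in> carrier Q" "conjugate Q ?b ` p ` crep ?D = crep C"
      using a(1) pK H.conjugate_set_inv[OF hom_closed[OF a(1)] LQ] by simp_all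
    interpret p1: pullback "weyl_group Q (p ` crep ?D)" "weyl_group Q (crep C)" "image (conjugate Q ?b)"
      using group_hom.weyl_pullback[OF H.conjugate_group_hom[OF b(1)] pK_sub] b(2) by simp
    interpret p2: pullback "weyl_group G (crep ?D)" "weyl_group Q (p ` crep ?D)" "image p"
      by (rule weyl_image_pullback[OF K(1)])
    interpret p3: pullback "weyl_group G ?K0" "weyl_group G (crep ?D)" "image (conjugate G a)"
      using group_hom.weyl_pullback[OF G.conjugate_group_hom[OF a(1)] K0] a(2) by simp
    interpret p4: pullback "weyl_group G ?K0" "weyl_group Q (crep C)" "image p"
      by (rule weyl_preimage_pullback[OF L(1)])
    have "component Q \<omega> (p ` crep ?D) = defect_class (weyl_group Q (p ` crep ?D)) ?f1"
      by (rule H.component_class[OF pK_sub b(1)]) (simp_all add: cls b f)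
    then have "Inf_D G Q p \<omega> ?D = defect_class (weyl_group G (crep ?D)) ?f2"
      using D p2.defect_pullback_class[OF p1.pull_class_functions0[OF f(1)]] by (simp add: Inf_D_def)
    then have "component G (Inf_D G Q p \<omega>) ?K0 = defect_class (weyl_group G ?K0) ?f3"
      by (intro G.component_class[OF K0 a(1) a(2)[symmetric]] p2.pull_class_functions0 p1.pull_class_functions0 f(1))
    also have "?f3 = pull (weyl_group G ?K0) (image p) f"
    proof
      fix c
      show "?f3 c = pull (weyl_group G ?K0) (image p) f c"
      proof (cases "c \<in> carrier (weyl_group G ?K0)")
        case True
        have cG: "c \<subseteq> carrier G" by (rule G.weyl_element_subset[OF K0 True])
        have "conjugate Q ?b ` p ` conjugate G a ` c = p ` c"
          using p_conjugate_set[OF a(1) cG] H.conjugate_set_inv[OF hom_closed[OF a(1)] image_closed[OF cG]] by simp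
        then show ?thesis
          using True p3.hom_closed[OF True] p2.hom_closed[OF p3.hom_closed[OF True]] by (simp add: pull_def)
      qed (simp add: pull_def)
    qed
    also have "defect_class (weyl_group G ?K0) \<dots> = defect_pullback (weyl_group G ?K0) (image p) (\<omega> C)"
      using p4.defect_pullback_class[OF f(1)] f(2) by simp
    finally show "component G (Inf_D G Q p \<omega>) ?K0 = defect_pullback (weyl_group G ?K0) (image p) (\<omega> C)" .
  qed
  moreover have "Fix_D G Q p (Inf_D G Q p \<omega>) \<in> carrier (D_space Q)"
    using f2_linear_closed[OF Fix_D_linear f2_linear_closed[OF Inf_D_linear \<omega>]] .
  ultimately show ?thesis
    using \<omega> unfolding H.D_space_carrier by (intro PiE_ext)
qed

text \<open>Homomorphisms commute with generating subgroups: the image of the subgroup generated by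
  \<open>K\<close> and a coset is generated by their images. With \<open>Inf_V_apply\<close>, the
  local function of the inflated element is the pullback of that of \<open>x\<close>.\<close>

lemma Def_map_Inf_V:
  assumes x: "x \<in> carrier (V_space Q)"
  shows "Def_map G (Inf_V G Q p x) = Inf_D G Q p (Def_map Q x)"
proof -
  have "Def_map G (Inf_V G Q p x) C = Inf_D G Q p (Def_map Q x) C" if C: "C \<in> sub_classes G" for C
  proof -
    note K = G.crep_subgroup(1)[OF C]
    note pK = image_subgroup[OF K]
    interpret pb: pullback "weyl_group G (crep C)" "weyl_group Q (p ` crep C)" "image p"
      by (rule weyl_image_pullback[OF K])
    have "lambda_fun G (Inf_V G Q p x) (crep C) c = pull (weyl_group G (crep C)) (image p) (lambda_fun Q x (p ` crep C)) c" for c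
    proof (cases "c \<in> carrier (weyl_group G (crep C))")
      case True
      note gen = G.generate_insert_coset[OF K True]
      have "p ` generate G (crep C \<union> c) = generate Q (p ` crep C \<union> p ` c)"
        using generate_img[OF gen(1)] by (simp add: image_Un)
      then show ?thesis
        using True pb.hom_closed[OF True] Inf_V_apply[OF x K] Inf_V_apply[OF x gen(2)]
        by (simp add: lambda_fun_def pull_def)
    qed (simp add: lambda_fun_def pull_def)
    then have "lambda_fun G (Inf_V G Q p x) (crep C) =
        pull (weyl_group G (crep C)) (image p) (lambda_fun Q x (p ` crep C))" ..
    then have "Def_map G (Inf_V G Q p x) C =
        defect_class (weyl_group G (crep C)) (pull (weyl_group G (crep C)) (image p) (lambda_fun Q x (p ` crep C)))"
      using C by (simp add: Def_map_def)
    also have "\<dots> = defect_pullback (weyl_group G (crep C)) (image p) (component Q (Def_map Q x) (p ` crep C))"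
      unfolding H.component_Def_map[OF pK] using pb.defect_pullback_class[OF H.lambda_fun_class_function[OF pK]] by simp
    finally show ?thesis using C by (simp add: Inf_D_def)
  qed
  moreover have "Inf_D G Q p (Def_map Q x) \<in> carrier (D_space G)"
    using f2_linear_closed[OF Inf_D_linear H.Def_map_in_D_space] .
  ultimately show ?thesis
    using G.Def_map_in_D_space[of "Inf_V G Q p x"] unfolding G.D_space_carrier by (intro PiE_ext)
qed

lemma Fix_D_Def_map:
  assumes y: "y \<in> carrier (V_space G)"
  shows "Fix_D G Q p (Def_map G y) = Def_map Q (Fix_V G Q p y)"
proof -
  have "Fix_D G Q p (Def_map G y) C = Def_map Q (Fix_V G Q p y) C" if C: "C \<in> sub_classes Q" for C
  proof (rule Fix_D_eqI[OF C])
    show "Def_map Q (Fix_V G Q p y) C \<in> carrier (local_defect (weyl_group Q (crep C)))"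
      using H.Def_map_in_D_space[of "Fix_V G Q p y"] C by (auto simp: H.D_space_carrier)
    note L = H.crep_subgroup(1)[OF C]
    note LQ = subgroup.subset[OF L]
    let ?K = "preimage G p (crep C)"
    note K = preimage_subgroup[OF L]
    interpret pb: pullback "weyl_group G ?K" "weyl_group Q (crep C)" "image p"
      by (rule weyl_preimage_pullback[OF L])
    have "lambda_fun G y ?K c = pull (weyl_group G ?K) (image p) (lambda_fun Q (Fix_V G Q p y) (crep C)) c" for c
    proof (cases "c \<in> carrier (weyl_group G ?K)")
      case True
      note gen = G.generate_insert_coset[OF K True]
      note genQ = H.generate_insert_coset[OF L pb.hom_closed[OF True]]
      \<comment> \<open>The subgroup generated upstairs contains the kernel, so it is the full
        preimage of its image, and \<open>Fix_V_apply\<close> can be used.\<close>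
      have "kernel G Q p \<subseteq> generate G (?K \<union> c)"
        using kernel_subset_preimage[OF L] generate.incl[of _ "?K \<union> c" G] by blast
      moreover have "p ` generate G (?K \<union> c) = generate Q (crep C \<union> p ` c)"
        using generate_img[OF gen(1)] image_preimage[OF LQ] by (simp add: image_Un)
      ultimately have "preimage G p (generate Q (crep C \<union> p ` c)) = generate G (?K \<union> c)"
        using preimage_image[OF gen(2)] by simp
      then show ?thesis
        using True pb.hom_closed[OF True] Fix_V_apply[OF y L] Fix_V_apply[OF y genQ(2)]
        by (simp add: lambda_fun_def pull_def)
    qed (simp add: lambda_fun_def pull_def)
    then have "lambda_fun G y ?K = pull (weyl_group G ?K) (image p) (lambda_fun Q (Fix_V G Q p y) (crep C))" ..
    then show "component G (Def_map G y) ?K = defect_pullback (weyl_group G ?K) (image p) (Def_map Q (Fix_V G Q p y) C)"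
      unfolding G.component_Def_map[OF K]
      using C pb.defect_pullback_class[OF H.lambda_fun_class_function[OF L]] by (simp add: Def_map_def)
  qed
  moreover have "Fix_D G Q p (Def_map G y) \<in> carrier (D_space Q)"
    using f2_linear_closed[OF Fix_D_linear G.Def_map_in_D_space] .
  ultimately show ?thesis
    using H.Def_map_in_D_space[of "Fix_V G Q p y"] unfolding H.D_space_carrier by (intro PiE_ext)
qed

text \<open>A group is its own core in itself, so the quotient is trivial and in particular
  cyclic.\<close>

lemma full_subgroup_not_ncc: "carrier Q \<notin> ncc_subgroups Q"
proof -
  have "core Q (carrier Q) = carrier Q"
    using H.conjugate_epi group_epi.surj by (fastforce simp: H.core_iff)
  then show ?thesis
    using H.coset_join2[OF H.one_closed H.subgroup_self] by (force simp: H.ncc_subgroups_iff)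
qed

lemma Inf_V_vanish:
  assumes "x \<in> carrier (V_space Q)" "subgroup K G" "p ` K = carrier Q"
  shows "Inf_V G Q p x (conj_class G K) = 0"
  using assms Inf_V_apply[OF assms(1,2)] H.ncc_conj_class_iff[OF H.subgroup_self] full_subgroup_not_ncc
  by (simp add: V_space_carrier)

text \<open>The Weyl group of \<open>Q\<close> in itself is trivial, so its defect space vanishes.\<close>

lemma component_Inf_D_vanish:
  assumes \<omega>: "\<omega> \<in> carrier (D_space Q)" and K: "subgroup K G" and full: "p ` K = carrier Q"
  shows "component G (Inf_D G Q p \<omega>) K = \<zero>\<^bsub>local_defect (weyl_group G K)\<^esub>"
proof -
  let ?C = "conj_class G K"
  have C: "?C \<in> sub_classes G" using K by (rule G.conj_class_in_sub_classes)
  note M = G.crep_subgroup(1)[OF C]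
  obtain a where a: "a \<in> carrier G" "crep ?C = conjugate G a ` K" using G.crep_conj_class[OF K] .
  have pM: "p ` crep ?C = carrier Q"
    using p_conjugate_set[OF a(1) subgroup.subset[OF K]] a full group_epi.surj[OF H.conjugate_epi] by simp
  interpret pb: pullback "weyl_group G (crep ?C)" "weyl_group Q (carrier Q)" "image p"
    using weyl_image_pullback[OF M] pM by simp
  have triv: "carrier (weyl_group Q (carrier Q)) = {carrier Q}"
    using H.coset_join2[OF _ H.subgroup_self] H.one_closed pb.H.one_closed
    by (auto simp: H.weyl_group_carrier H.normalizer_alt H.weyl_group_one)
  have "f = (\<lambda>c. 0)" if "f \<in> carrier (class_functions0 (weyl_group Q (carrier Q)))" for f
    using that unfolding class_functions0_carrier triv H.weyl_group_one by (intro ext) (metis singletonD)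
  then have "carrier (local_defect (weyl_group Q (carrier Q))) \<subseteq> {\<zero>\<^bsub>local_defect (weyl_group Q (carrier Q))\<^esub>}"
    unfolding pb.H.local_defect_carrier pb.H.local_defect_zero by blast
  then have "component Q \<omega> (carrier Q) = \<zero>\<^bsub>local_defect (weyl_group Q (carrier Q))\<^esub>"
    using f2_linear_closed[OF H.component_linear[OF H.subgroup_self] \<omega>] by auto
  then have I: "Inf_D G Q p \<omega> ?C = \<zero>\<^bsub>local_defect (weyl_group G (crep ?C))\<^esub>"
    using C pM f2_linear_zero[OF pb.H.local_defect_module pb.G.local_defect_module pb.defect_pullback_linear]
    by (simp add: Inf_D_def)
  \<comment> \<open>\<open>component\<close> at \<open>K\<close> only looks at the entry of the
    class of \<open>K\<close>, so the whole element may be replaced by zero.\<close>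
  have "component G (Inf_D G Q p \<omega>) K = component G \<zero>\<^bsub>D_space G\<^esub> K"
    unfolding component_def Let_def using C I by (simp add: G.D_space_zero)
  then show ?thesis
    using f2_linear_zero[OF G.D_space_module group.local_defect_module[OF G.weyl_group_group[OF K]] G.component_linear[OF K]]
    by simp
qed

end

section \<open>Direct products\<close>

lemma (in finite_group) finite_V_space: "finite (carrier (V_space G))"
proof -
  have "finite (ncc_classes G)"
    using finite_sub_classes[OF finite_carrier] ncc_classes_subset by (rule finite_subset[rotated])
  moreover have "finite (UNIV :: bit set)"
    by (rule finite_subset[of _ "{0, 1}"]) auto
  ultimately have "finite {x. \<forall>C. (C \<in> ncc_classes G \<longrightarrow> x C \<in> (UNIV :: bit set)) \<and> (C \<notin> ncc_classes G \<longrightarrow> x C = 0)}"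
    by (rule finite_set_of_finite_funs)
  then show ?thesis by (rule finite_subset[rotated]) (auto simp: V_space_carrier)
qed

lemma submodule_subgroup: "submodule H R M \<Longrightarrow> subgroup H (add_monoid M)"
  by (simp add: submodule_def)

lemma carrier_subgroup: "f2_module M \<Longrightarrow> subgroup (carrier M) (add_monoid M)"
  using group.subgroup_self[of "add_monoid M"] by (simp add: f2_module_def comm_group_def)

text \<open>The bijection behind the decomposition multiplies cardinalities, all of which are powers
  of 2, so dimensions add. The summands enter by size only, since they will be injective images of
  the spaces \<open>S2 (Gs i)\<close>.\<close>

lemma (in finite_group) f2_dim_direct_decomposition:
  assumes dec: "direct_decomposition (V_space G) (S2 G) I A B" and I: "finite I" and B: "B \<subseteq> S2 G"
    and A: "\<And>i. i \<in> I \<Longrightarrow> finite (A i) \<and> card (A i) = 2 ^ d i"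
  shows "f2_dim (S2 G) = (\<Sum>i\<in>I. d i) + f2_dim B"
proof -
  have S2_V: "S2 G \<subseteq> carrier (V_space G)" by (auto simp: S2_iff)
  have fin: "finite (S2 G)" "finite B"
    using S2_V B finite_V_space finite_subset by metis+
  have dims: "card (S2 G) = 2 ^ f2_dim (S2 G)" "card B = 2 ^ f2_dim B"
    using dec S2_subgroup submodule_subgroup[of B]
    by (auto simp: direct_decomposition_def V_space_def intro!: card_eq_power_f2_dim fin f2_subspaceI)
  have "card (S2 G) = card ((\<Pi>\<^sub>E i\<in>I. A i) \<times> B)"
    using dec bij_betw_same_card by (force simp: direct_decomposition_def)
  also have "\<dots> = (\<Prod>i\<in>I. 2 ^ d i) * card B"
    using A by (simp add: card_cartesian_product card_PiE[OF I])
  finally have "(2::nat) ^ f2_dim (S2 G) = 2 ^ ((\<Sum>i\<in>I. d i) + f2_dim B)"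
    by (simp add: dims power_add power_sum)
  then show ?thesis by simp
qed

lemma product_group_epi:
  assumes grp: "\<And>i. i \<in> I \<Longrightarrow> group (Gs i)" and fin: "\<And>i. i \<in> I \<Longrightarrow> finite (carrier (Gs i))"
    and I: "finite I" and i: "i \<in> I"
  shows "finite_group_epi (product_group I Gs) (Gs i) (\<lambda>g. g i)"
proof (intro finite_group_epi.intro group_epi.intro group_hom.intro group_hom_axioms.intro
    group_epi_axioms.intro finite_group_epi_axioms.intro)
  show "group (product_group I Gs)" using grp by (rule product_group)
  show "group (Gs i)" using grp i .
  show "(\<lambda>g. g i) \<in> hom (product_group I Gs) (Gs i)" using i by (auto simp: hom_def)
  show "finite (carrier (product_group I Gs))" using I fin by (auto intro!: finite_PiE)
  \<comment> \<open>A projection is onto because the other factors are nonempty, each containing its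
    unit.\<close>
  show "(\<lambda>g. g i) ` carrier (product_group I Gs) = carrier (Gs i)"
    using i grp by (auto simp: image_projection_PiE PiE_eq_empty_iff dest: group.is_monoid monoid.one_closed)
qed

lemma product_group_image_preimage:
  assumes grp: "\<And>i. i \<in> I \<Longrightarrow> group (Gs i)" and ij: "i \<in> I" "j \<in> I" "i \<noteq> j" and L: "subgroup L (Gs j)"
  shows "(\<lambda>g. g i) ` preimage (product_group I Gs) (\<lambda>g. g j) L = carrier (Gs i)"
proof
  show "(\<lambda>g. g i) ` preimage (product_group I Gs) (\<lambda>g. g j) L \<subseteq> carrier (Gs i)"
    using ij by (auto simp: preimage_def)
  show "carrier (Gs i) \<subseteq> (\<lambda>g. g i) ` preimage (product_group I Gs) (\<lambda>g. g j) L"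
  proof
    fix x assume x: "x \<in> carrier (Gs i)"
    \<comment> \<open>The entry \<open>x\<close> at \<open>i\<close> and units elsewhere; the unit
      at \<open>j\<close> lies in \<open>L\<close>, whatever \<open>L\<close> is.\<close>
    define g where "g = (\<lambda>k\<in>I. if k = i then x else \<one>\<^bsub>Gs k\<^esub>)"
    have "g \<in> preimage (product_group I Gs) (\<lambda>g. g j) L"
      using x ij subgroup.one_closed[OF L] monoid.one_closed[OF group.is_monoid[OF grp]]
      by (auto simp: g_def preimage_def)
    moreover have "x = g i" using ij by (simp add: g_def)
    ultimately show "x \<in> (\<lambda>g. g i) ` preimage (product_group I Gs) (\<lambda>g. g j) L" by blast
  qed
qed

theorem theorem6p16:
  fixes m :: nat and Gs :: "nat \<Rightarrow> ('a, 'b) monoid_scheme" and G :: "(nat \<Rightarrow> 'a) monoid"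
  assumes "\<And>i. i \<in> {1..m} \<Longrightarrow> group (Gs i)"
    and "\<And>i. i \<in> {1..m} \<Longrightarrow> finite (carrier (Gs i))"
  defines "G \<equiv> product_group {1..m} Gs"
  defines "InfV \<equiv> \<lambda>i. Inf_V G (Gs i) (\<lambda>g. g i)"
    and "FixV \<equiv> \<lambda>i. Fix_V G (Gs i) (\<lambda>g. g i)"
    and "InfD \<equiv> \<lambda>i. Inf_D G (Gs i) (\<lambda>g. g i)"
    and "FixD \<equiv> \<lambda>i. Fix_D G (Gs i) (\<lambda>g. g i)"
  defines "KV \<equiv> joint_kernel (V_space G) {1..m} (\<lambda>i. V_space (Gs i)) FixV"
    and "KD \<equiv> joint_kernel (D_space G) {1..m} (\<lambda>i. D_space (Gs i)) FixD"
  shows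
    "direct_decomposition (V_space G) (carrier (V_space G)) {1..m}
       (\<lambda>i. InfV i ` carrier (V_space (Gs i))) KV \<and>
    direct_decomposition (D_space G) (carrier (D_space G)) {1..m}
       (\<lambda>i. InfD i ` carrier (D_space (Gs i))) KD \<and>
    (\<forall>i\<in>{1..m}. f2_linear (V_space (Gs i)) (V_space G) (InfV i) \<and>
       inj_on (InfV i) (carrier (V_space (Gs i)))) \<and>
    (\<forall>i\<in>{1..m}. f2_linear (D_space (Gs i)) (D_space G) (InfD i) \<and>
       inj_on (InfD i) (carrier (D_space (Gs i)))) \<and>
    f2_linear (V_space G) (D_space G) (Def_map G) \<and>
    (\<forall>i\<in>{1..m}. f2_linear (V_space (Gs i)) (D_space (Gs i)) (Def_map (Gs i))) \<and>
    (\<forall>i\<in>{1..m}. Def_map G ` InfV i ` carrier (V_space (Gs i))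
       \<subseteq> InfD i ` carrier (D_space (Gs i))) \<and>
    (\<forall>i\<in>{1..m}. \<forall>x\<in>carrier (V_space (Gs i)). Def_map G (InfV i x) = InfD i (Def_map (Gs i) x)) \<and>
    Def_map G ` KV \<subseteq> KD \<and>
    direct_decomposition (V_space G) (S2 G) {1..m} (\<lambda>i. InfV i ` S2 (Gs i)) (S2 G \<inter> KV) \<and>
    f2_dim (S2 G) = (\<Sum>i=1..m. f2_dim (S2 (Gs i))) + f2_dim (S2 G \<inter> KV)"
proof -
  let ?I = "{1..m}"
  have epi: "finite_group_epi G (Gs i) (\<lambda>g. g i)" if "i \<in> ?I" for i
    unfolding G_def using assms(1,2) that by (intro product_group_epi) auto
  have G: "group G" unfolding G_def using assms(1) by (rule product_group)
  have "finite (carrier G)" unfolding G_def using assms(2) by (auto intro!: finite_PiE)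
  then interpret finite_group G using G by (simp add: finite_group_def finite_group_axioms_def)
  have full: "(\<lambda>g. g i) ` preimage G (\<lambda>g. g j) L = carrier (Gs i)"
    if "i \<in> ?I" "j \<in> ?I" "i \<noteq> j" "subgroup L (Gs j)" for i j L
    unfolding G_def using assms(1) that by (rule product_group_image_preimage)
  have linear: "f2_linear (V_space (Gs i)) (V_space G) (InfV i)" "f2_linear (V_space G) (V_space (Gs i)) (FixV i)"
    "f2_linear (D_space (Gs i)) (D_space G) (InfD i)" "f2_linear (D_space G) (D_space (Gs i)) (FixD i)"
    if "i \<in> ?I" for i
    unfolding InfV_def FixV_def InfD_def FixD_def
    using finite_group_epi.Inf_V_linear finite_group_epi.Fix_V_linear
      finite_group_epi.Inf_D_linear finite_group_epi.Fix_D_linear epi[OF that] by blast+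
  have retract_V: "FixV i (InfV i x) = x" if "i \<in> ?I" "x \<in> carrier (V_space (Gs i))" for i x
    unfolding InfV_def FixV_def by (rule finite_group_epi.Fix_V_Inf_V[OF epi[OF that(1)] that(2)])
  have retract_D: "FixD i (InfD i \<omega>) = \<omega>" if "i \<in> ?I" "\<omega> \<in> carrier (D_space (Gs i))" for i \<omega>
    unfolding InfD_def FixD_def by (rule finite_group_epi.Fix_D_Inf_D[OF epi[OF that(1)] that(2)])
  have orth_V: "FixV j (InfV i x) = \<zero>\<^bsub>V_space (Gs j)\<^esub>"
    if i: "i \<in> ?I" and j: "j \<in> ?I" and ij: "i \<noteq> j" and x: "x \<in> carrier (V_space (Gs i))" for i j x
  proof -
    interpret pi: finite_group_epi G "Gs i" "\<lambda>g. g i" using epi[OF i] .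
    interpret pj: finite_group_epi G "Gs j" "\<lambda>g. g j" using epi[OF j] .
    have "InfV i x (conj_class G (preimage G (\<lambda>g. g j) (crep C))) = 0" if "C \<in> ncc_classes (Gs j)" for C
    proof -
      have L: "subgroup (crep C) (Gs j)" using that pj.H.ncc_classes_subset pj.H.crep_subgroup(1) by blast
      show ?thesis unfolding InfV_def
        by (rule pi.Inf_V_vanish[OF x pj.preimage_subgroup[OF L] full[OF i j ij L]])
    qed
    then show ?thesis by (auto simp: FixV_def Fix_V_def V_space_zero)
  qed
  have orth_D: "FixD j (InfD i \<omega>) = \<zero>\<^bsub>D_space (Gs j)\<^esub>"
    if i: "i \<in> ?I" and j: "j \<in> ?I" and ij: "i \<noteq> j" and \<omega>: "\<omega> \<in> carrier (D_space (Gs i))" for i j \<omega>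
  proof -
    interpret pi: finite_group_epi G "Gs i" "\<lambda>g. g i" using epi[OF i] .
    interpret pj: finite_group_epi G "Gs j" "\<lambda>g. g j" using epi[OF j] .
    have "FixD j (InfD i \<omega>) C = \<zero>\<^bsub>local_defect (weyl_group (Gs j) (crep C))\<^esub>" if C: "C \<in> sub_classes (Gs j)" for C
    proof -
      note L = pj.H.crep_subgroup(1)[OF C]
      show ?thesis unfolding FixD_def InfD_def
        by (rule pj.Fix_D_zero[OF C pi.component_Inf_D_vanish[OF \<omega> pj.preimage_subgroup[OF L] full[OF i j ij L]]])
    qed
    moreover have "FixD j (InfD i \<omega>) \<in> extensional (sub_classes (Gs j))"
      by (simp add: FixD_def Fix_D_def)
    ultimately show ?thesis unfolding pj.H.D_space_zero by (intro extensionalityI[of _ "sub_classes (Gs j)"]) auto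
  qed
  note D_module = group.D_space_module[OF assms(1)] D_space_module
  have dec_V: "direct_decomposition (V_space G) (carrier (V_space G)) ?I (\<lambda>i. InfV i ` carrier (V_space (Gs i))) KV"
  proof -
    have "direct_decomposition (V_space G) (carrier (V_space G)) ?I (\<lambda>i. InfV i ` carrier (V_space (Gs i)))
        (carrier (V_space G) \<inter> joint_kernel (V_space G) ?I (\<lambda>i. V_space (Gs i)) FixV)"
      by (rule direct_decomposition_retractions[where N = "\<lambda>i. V_space (Gs i)" and infl = InfV and fixm = FixV,
            OF V_space_module V_space_module _ linear(1,2) retract_V orth_V])
        (use f2_linear_closed[OF linear(1)] f2_linear_closed[OF linear(2)] in \<open>auto intro!: carrier_subgroup V_space_module\<close>)
    then show ?thesis by (simp add: KV_def Int_absorb1 joint_kernel_def)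
  qed
  have dec_D: "direct_decomposition (D_space G) (carrier (D_space G)) ?I (\<lambda>i. InfD i ` carrier (D_space (Gs i))) KD"
  proof -
    have "direct_decomposition (D_space G) (carrier (D_space G)) ?I (\<lambda>i. InfD i ` carrier (D_space (Gs i)))
        (carrier (D_space G) \<inter> joint_kernel (D_space G) ?I (\<lambda>i. D_space (Gs i)) FixD)"
      by (rule direct_decomposition_retractions[where N = "\<lambda>i. D_space (Gs i)" and infl = InfD and fixm = FixD,
            OF D_module(2) D_module(1) _ linear(3,4) retract_D orth_D])
        (use f2_linear_closed[OF linear(3)] f2_linear_closed[OF linear(4)] in \<open>auto intro!: carrier_subgroup D_module\<close>)
    then show ?thesis by (simp add: KD_def Int_absorb1 joint_kernel_def)
  qed
  \<comment> \<open>\<open>S2\<close> is treated directly and not as a kernel of the defect map: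
    \<open>Inf_V\<close> and \<open>Fix_V\<close> preserve it, so the retraction argument restricts
    to it.\<close>
  have dec_S2: "direct_decomposition (V_space G) (S2 G) ?I (\<lambda>i. InfV i ` S2 (Gs i)) (S2 G \<inter> KV)"
    unfolding KV_def
  proof (rule direct_decomposition_retractions[where N = "\<lambda>i. V_space (Gs i)" and infl = InfV and fixm = FixV, OF V_space_module V_space_module _ linear(1,2) retract_V orth_V S2_subgroup])
    fix i assume i: "i \<in> ?I"
    interpret pi: finite_group_epi G "Gs i" "\<lambda>g. g i" using epi[OF i] .
    show "subgroup (S2 (Gs i)) (add_monoid (V_space (Gs i)))" by (rule pi.fQ.S2_subgroup)
    show "InfV i x \<in> S2 G" if "x \<in> S2 (Gs i)" for x
      unfolding InfV_def using that by (rule pi.Inf_V_S2)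
    show "FixV i x \<in> S2 (Gs i)" if "x \<in> S2 G" for x
      unfolding FixV_def using that by (rule pi.Fix_V_S2)
  qed auto
  have inj_V: "inj_on (InfV i) (carrier (V_space (Gs i)))" if "i \<in> ?I" for i
    by (rule inj_on_inverseI[of _ "FixV i"], rule retract_V[OF that])
  have inj_D: "inj_on (InfD i) (carrier (D_space (Gs i)))" if "i \<in> ?I" for i
    by (rule inj_on_inverseI[of _ "FixD i"], rule retract_D[OF that])
  have Def_Inf: "Def_map G (InfV i x) = InfD i (Def_map (Gs i) x)"
    if "i \<in> ?I" "x \<in> carrier (V_space (Gs i))" for i x
    unfolding InfV_def InfD_def by (rule finite_group_epi.Def_map_Inf_V[OF epi[OF that(1)] that(2)])
  \<comment> \<open>The defect map commutes with fixed points, so a vector killed by every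
    \<open>FixV i\<close> is sent to one killed by every \<open>FixD i\<close>.\<close>
  have Def_KV: "Def_map G ` KV \<subseteq> KD"
  proof (rule image_subsetI)
    fix y assume y: "y \<in> KV"
    have "FixD i (Def_map G y) = \<zero>\<^bsub>D_space (Gs i)\<^esub>" if i: "i \<in> ?I" for i
    proof -
      interpret pi: finite_group_epi G "Gs i" "\<lambda>g. g i" using epi[OF i] .
      have "FixD i (Def_map G y) = Def_map (Gs i) (FixV i y)"
        unfolding FixD_def FixV_def by (rule pi.Fix_D_Def_map) (use y in \<open>simp add: KV_def joint_kernel_def\<close>)
      then show ?thesis
        using y i f2_linear_zero[OF V_space_module pi.H.D_space_module pi.H.Def_map_linear]
        by (simp add: KV_def joint_kernel_def)
    qed
    then show "Def_map G y \<in> KD" by (simp add: KD_def joint_kernel_def Def_map_in_D_space)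
  qed
  have dim: "f2_dim (S2 G) = (\<Sum>i=1..m. f2_dim (S2 (Gs i))) + f2_dim (S2 G \<inter> KV)"
  proof (rule f2_dim_direct_decomposition[OF dec_S2])
    fix i assume i: "i \<in> ?I"
    interpret pi: finite_group_epi G "Gs i" "\<lambda>g. g i" using epi[OF i] .
    have S2_V: "S2 (Gs i) \<subseteq> carrier (V_space (Gs i))" by (auto simp: pi.fQ.S2_iff)
    have fin: "finite (S2 (Gs i))" using S2_V pi.fQ.finite_V_space by (rule finite_subset)
    \<comment> \<open>Inflation is injective, so the summand at \<open>i\<close> has as many
      elements as \<open>S2 (Gs i)\<close>.\<close>
    have "card (InfV i ` S2 (Gs i)) = card (S2 (Gs i))"
      by (rule card_image[OF inj_on_subset[OF inj_V[OF i] S2_V]])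
    also have "\<dots> = 2 ^ f2_dim (S2 (Gs i))"
      using pi.fQ.S2_subgroup fin by (intro card_eq_power_f2_dim f2_subspaceI) (simp_all add: V_space_def)
    finally show "finite (InfV i ` S2 (Gs i)) \<and> card (InfV i ` S2 (Gs i)) = 2 ^ f2_dim (S2 (Gs i))"
      using fin by simp
  qed auto
  have Def_Inf_image: "Def_map G ` InfV i ` carrier (V_space (Gs i)) \<subseteq> InfD i ` carrier (D_space (Gs i))"
    if i: "i \<in> ?I" for i
    using Def_Inf[OF i] group.Def_map_in_D_space[OF assms(1)[OF i]] by auto
  show ?thesis
    using dec_V dec_D dec_S2 linear inj_V inj_D Def_map_linear group.Def_map_linear[OF assms(1)]
      Def_Inf_image Def_Inf Def_KV dim by (intro conjI ballI) simp_all
qed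

end
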